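(* (i) There exist sequences $\mathbf{a},\mathbf{b}$ of integers $\ge2$, a state $\omega$ of $\mathcal{A}(\mathbf{a})$ and a state $\omega'$ of $\mathcal{A}(\mathbf{b})$ such that $\omega\otimes_\varphi\omega'\neq\omega'\otimes_\varphi\omega$. (ii) There exist sequences $\mathbf{a},\mathbf{b}$ of integers $\ge2$, a unitary equivalence class $[\pi]$ of representations of $\mathcal{A}(\mathbf{a})$ and a unitary equivalence class $[\pi']$ of representations of $\mathcal{A}(\mathbf{b})$ such that $[\pi]\otimes_\varphi[\pi']\neq[\pi']\otimes_\varphi[\pi]$.
   Context: For $1\le n<\infty$, $M_n$ is the C$^*$-algebra of complex $n\times n$ matrices, with standard matrix units $\{E^{(n)}_{ij}\}_{i,j=1}^n$. For a sequence $\mathbf{a}=(a_n)_{n\ge1}$ of integers $\ge2$, put $\mathcal{A}_n(\mathbf{a})=\bigotimes_{j=1}^n M_{a_j}$, and let $\mathcal{A}(\mathbf{a})$ be the C$^*$-inductive limit (a UHF algebra) of the $\mathcal{A}_n(\mathbf{a})$ along the embeddings $A\mapsto A\otimes I\in\mathcal{A}_n(\mathbf{a})\otimes M_{a_{n+1}}=\mathcal{A}_{n+1}(\mathbf{a})$; each $\mathcal{A}_n(\mathbf{a})$ is regarded as a subalgebra of $\mathcal{A}(\mathbf{a})$. Isomorphisms: for sequences $\mathbf{a}=(a_n),\mathbf{b}=(b_n)$ of integers $\ge 2$, $\mathbf{a}\cdot\mathbf{b}=(a_1b_1,a_2b_2,\ldots)$ (so $\mathbf{a}\cdot\mathbf{b}=\mathbf{b}\cdot\mathbf{a}$).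 The $*$-isomorphism $\varphi_{\mathbf{a},\mathbf{b}}:\mathcal{A}(\mathbf{a}\cdot\mathbf{b})\to\mathcal{A}(\mathbf{a})\otimes\mathcal{A}(\mathbf{b})$ is the one whose restriction to each $\mathcal{A}_n(\mathbf{a}\cdot\mathbf{b})$ is given by $$E^{(a_1b_1)}_{j_1k_1}\otimes\cdots\otimes E^{(a_nb_n)}_{j_nk_n}\mapsto(E^{(a_1)}_{j_1'k_1'}\otimes\cdots\otimes E^{(a_n)}_{j_n'k_n'})\otimes(E^{(b_1)}_{j_1''k_1''}\otimes\cdots\otimes E^{(b_n)}_{j_n''k_n''}),$$ where $j_i=b_i(j_i'-1)+j_i''$, $k_i=b_i(k_i'-1)+k_i''$ with $j_i',k_i'\in\{1,\ldots,a_i\}$ and $j_i'',k_i''\in\{1,\ldots,b_i\}$. Tensor product $\otimes_\varphi$: for representations $\pi_1$ of $\mathcal{A}(\mathbf{a})$ and $\pi_2$ of $\mathcal{A}(\mathbf{b})$, $\pi_1\otimes_\varphi\pi_2=(\pi_1\otimes\pi_2)\circ\varphi_{\mathbf{a},\mathbf{b}}$, a representation of $\mathcal{A}(\mathbf{a}\cdot\mathbf{b})$; for states $\rho_1$ of $\mathcal{A}(\mathbf{a})$ and $\rho_2$ of $\mathcal{A}(\mathbf{b})$, $\rho_1\otimes_\varphi\rho_2=(\rho_1\otimes\rho_2)\circ\varphi_{\mathbf{a},\mathbf{b}}$, a state of $\mathcal{A}(\mathbf{a}\cdot\mathbf{b})$. The operation on representations respects unitary equivalence, and on unitary equivalence classes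 one sets $[\pi_1]\otimes_\varphi[\pi_2]=[\pi_1\otimes_\varphi\pi_2]$. *)

theory Defs
  imports "HOL-Analysis.Analysis" "Jordan_Normal_Form.Schur_Decomposition"
begin

section \<open>Completions\<close>

text \<open>
  The structures completed below (formal finite sums, matrices of varying size) satisfy the vector
  space laws only up to differences of seminorm zero; the passage to classes of Cauchy sequences
  modulo null sequences divides these out as well. For this reason differences are formed as
  \<open>x + (-1) y\<close> and not with the additive inverse of the carrier.
\<close>

definition vdiff :: "(complex, 'a, 'm) module_scheme \<Rightarrow> 'a \<Rightarrow> 'a \<Rightarrow> 'a" where
  "vdiff M x y = x \<oplus>\<^bsub>M\<^esub> ((-1) \<odot>\<^bsub>M\<^esub> y)"

definition cauchy_seqs :: "(complex, 'a, 'm) module_scheme \<Rightarrow> ('a \<Rightarrow> real) \<Rightarrow> (nat \<Rightarrow> 'a) set" where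
  "cauchy_seqs M nrm = {X. (\<forall>n. X n \<in> carrier M) \<and>
     (\<forall>e>0. \<exists>N. \<forall>m\<ge>N. \<forall>n\<ge>N. nrm (vdiff M (X m) (X n)) < e)}"

definition completion_rel ::
  "(complex, 'a, 'm) module_scheme \<Rightarrow> ('a \<Rightarrow> real) \<Rightarrow> ((nat \<Rightarrow> 'a) \<times> (nat \<Rightarrow> 'a)) set" where
  "completion_rel M nrm = {(X, Y). X \<in> cauchy_seqs M nrm \<and> Y \<in> cauchy_seqs M nrm \<and>
     (\<lambda>n. nrm (vdiff M (X n) (Y n))) \<longlonglongrightarrow> 0}"

definition class_repr :: "(nat \<Rightarrow> 'a) set \<Rightarrow> nat \<Rightarrow> 'a" where
  "class_repr S = (SOME X. X \<in> S)"

definition lift_unary ::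
  "((nat \<Rightarrow> 'a) \<times> (nat \<Rightarrow> 'a)) set \<Rightarrow> ('a \<Rightarrow> 'a) \<Rightarrow> (nat \<Rightarrow> 'a) set \<Rightarrow> (nat \<Rightarrow> 'a) set" where
  "lift_unary r f S = r `` {\<lambda>n. f (class_repr S n)}"

definition lift_binary ::
  "((nat \<Rightarrow> 'a) \<times> (nat \<Rightarrow> 'a)) set \<Rightarrow> ('a \<Rightarrow> 'a \<Rightarrow> 'a) \<Rightarrow>
     (nat \<Rightarrow> 'a) set \<Rightarrow> (nat \<Rightarrow> 'a) set \<Rightarrow> (nat \<Rightarrow> 'a) set" where
  "lift_binary r f S T = r `` {\<lambda>n. f (class_repr S n) (class_repr T n)}"


section \<open>Normed star-algebras\<close>

record 'a star_alg = "(complex, 'a) module" +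
  invol :: "'a \<Rightarrow> 'a"
  anorm :: "'a \<Rightarrow> real"

abbreviation alg_completion_rel :: "'a star_alg \<Rightarrow> ((nat \<Rightarrow> 'a) \<times> (nat \<Rightarrow> 'a)) set" where
  "alg_completion_rel A \<equiv> completion_rel A (anorm A)"

definition alg_completion :: "'a star_alg \<Rightarrow> (nat \<Rightarrow> 'a) set star_alg" where
  "alg_completion A = (let r = alg_completion_rel A in
     \<lparr> carrier = cauchy_seqs A (anorm A) // r,
       mult = lift_binary r (mult A),
       one = r `` {\<lambda>_. \<one>\<^bsub>A\<^esub>},
       zero = r `` {\<lambda>_. \<zero>\<^bsub>A\<^esub>},
       add = lift_binary r (add A),
       smult = (\<lambda>c. lift_unary r (smult A c)),
       invol = lift_unary r (invol A),
       anorm = (\<lambda>S. lim (\<lambda>n. anorm A (class_repr S n))) \<rparr>)"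

text \<open>
  A star-isomorphism of C*-algebras is automatically isometric, a positive functional
  and a star-representation automatically bounded (with \<open>\<parallel>f\<parallel> = f 1\<close> and
  \<open>\<parallel>\<pi>(x)\<parallel> \<le> \<parallel>x\<parallel>\<close>); the norm clauses in the definitions of \<open>star_iso\<close>, \<open>state\<close> and
  \<open>star_representation\<close> record this and exclude nothing. In \<open>state\<close> the clauses
  \<open>\<bar>f x\<bar> \<le> \<parallel>x\<parallel>\<close> and \<open>f 1 = 1\<close> together say that \<open>f\<close> has norm one.

  Maps are extensional (\<open>undefined\<close> off the carrier), so that equality of maps is equality on the
  carrier.
\<close>

definition star_iso :: "'a star_alg \<Rightarrow> 'b star_alg \<Rightarrow> ('a \<Rightarrow> 'b) \<Rightarrow> bool" where
  "star_iso A B f \<longleftrightarrow>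
     f \<in> extensional (carrier A) \<and> bij_betw f (carrier A) (carrier B) \<and>
     (\<forall>x\<in>carrier A. \<forall>y\<in>carrier A.
        f (x \<oplus>\<^bsub>A\<^esub> y) = f x \<oplus>\<^bsub>B\<^esub> f y \<and> f (x \<otimes>\<^bsub>A\<^esub> y) = f x \<otimes>\<^bsub>B\<^esub> f y) \<and>
     (\<forall>c. \<forall>x\<in>carrier A. f (c \<odot>\<^bsub>A\<^esub> x) = c \<odot>\<^bsub>B\<^esub> f x) \<and>
     f \<one>\<^bsub>A\<^esub> = \<one>\<^bsub>B\<^esub> \<and>
     (\<forall>x\<in>carrier A. f (invol A x) = invol B (f x) \<and> anorm B (f x) = anorm A x)"

definition state :: "'a star_alg \<Rightarrow> ('a \<Rightarrow> complex) \<Rightarrow> bool" where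
  "state A f \<longleftrightarrow>
     f \<in> extensional (carrier A) \<and>
     (\<forall>x\<in>carrier A. \<forall>y\<in>carrier A. f (x \<oplus>\<^bsub>A\<^esub> y) = f x + f y) \<and>
     (\<forall>c. \<forall>x\<in>carrier A. f (c \<odot>\<^bsub>A\<^esub> x) = c * f x) \<and>
     (\<forall>x\<in>carrier A. f (invol A x \<otimes>\<^bsub>A\<^esub> x) \<in> \<real>\<^sub>\<ge>\<^sub>0) \<and>
     (\<forall>x\<in>carrier A. cmod (f x) \<le> anorm A x) \<and>
     f \<one>\<^bsub>A\<^esub> = 1"


section \<open>Tensor products of C*-algebras\<close>

text \<open>
  A list of pairs \<open>[(x\<^sub>1, y\<^sub>1), \<dots>, (x\<^sub>k, y\<^sub>k)]\<close> stands for the formal sum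
  \<open>x\<^sub>1 \<otimes> y\<^sub>1 + \<dots> + x\<^sub>k \<otimes> y\<^sub>k\<close>. Two formal sums denote the same element of the algebraic tensor
  product iff no bilinear form distinguishes them.
\<close>

definition bilinear_form ::
  "(complex, 'a, 'm) module_scheme \<Rightarrow> (complex, 'b, 'n) module_scheme \<Rightarrow>
     ('a \<Rightarrow> 'b \<Rightarrow> complex) \<Rightarrow> bool" where
  "bilinear_form A B f \<longleftrightarrow>
     (\<forall>x\<in>carrier A. \<forall>x'\<in>carrier A. \<forall>y\<in>carrier B. f (x \<oplus>\<^bsub>A\<^esub> x') y = f x y + f x' y) \<and>
     (\<forall>x\<in>carrier A. \<forall>y\<in>carrier B. \<forall>y'\<in>carrier B. f x (y \<oplus>\<^bsub>B\<^esub> y') = f x y + f x y') \<and>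
     (\<forall>c. \<forall>x\<in>carrier A. \<forall>y\<in>carrier B.
        f (c \<odot>\<^bsub>A\<^esub> x) y = c * f x y \<and> f x (c \<odot>\<^bsub>B\<^esub> y) = c * f x y)"

definition tensor_eq ::
  "(complex, 'a, 'm) module_scheme \<Rightarrow> (complex, 'b, 'n) module_scheme \<Rightarrow>
     ('a \<times> 'b) list \<Rightarrow> ('a \<times> 'b) list \<Rightarrow> bool" where
  "tensor_eq A B s t \<longleftrightarrow>
     (\<forall>f. bilinear_form A B f \<longrightarrow> (\<Sum>(x, y)\<leftarrow>s. f x y) = (\<Sum>(x, y)\<leftarrow>t. f x y))"

definition tensor_smult ::
  "(complex, 'a, 'm) module_scheme \<Rightarrow> complex \<Rightarrow> ('a \<times> 'b) list \<Rightarrow> ('a \<times> 'b) list" where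
  "tensor_smult A c t = map (\<lambda>(x, y). (c \<odot>\<^bsub>A\<^esub> x, y)) t"

definition tensor_mult ::
  "'a star_alg \<Rightarrow> 'b star_alg \<Rightarrow> ('a \<times> 'b) list \<Rightarrow> ('a \<times> 'b) list \<Rightarrow> ('a \<times> 'b) list" where
  "tensor_mult A B s t =
     concat (map (\<lambda>(x, y). map (\<lambda>(x', y'). (x \<otimes>\<^bsub>A\<^esub> x', y \<otimes>\<^bsub>B\<^esub> y')) t) s)"

definition tensor_invol ::
  "'a star_alg \<Rightarrow> 'b star_alg \<Rightarrow> ('a \<times> 'b) list \<Rightarrow> ('a \<times> 'b) list" where
  "tensor_invol A B t = map (\<lambda>(x, y). (invol A x, invol B y)) t"

definition tensor_cstar_seminorm ::
  "'a star_alg \<Rightarrow> 'b star_alg \<Rightarrow> (('a \<times> 'b) list \<Rightarrow> real) \<Rightarrow> bool" where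
  "tensor_cstar_seminorm A B p \<longleftrightarrow>
     (let T = lists (carrier A \<times> carrier B) in
      (\<forall>t\<in>T. 0 \<le> p t) \<and>
      (\<forall>s\<in>T. \<forall>t\<in>T. tensor_eq A B s t \<longrightarrow> p s = p t) \<and>
      (\<forall>s\<in>T. \<forall>t\<in>T. p (s @ t) \<le> p s + p t) \<and>
      (\<forall>c. \<forall>t\<in>T. p (tensor_smult A c t) = cmod c * p t) \<and>
      (\<forall>s\<in>T. \<forall>t\<in>T. p (tensor_mult A B s t) \<le> p s * p t) \<and>
      (\<forall>t\<in>T. p (tensor_mult A B (tensor_invol A B t) t) = (p t)\<^sup>2) \<and>
      (\<forall>x\<in>carrier A. \<forall>y\<in>carrier B. p [(x, y)] \<le> anorm A x * anorm B y))"

text \<open>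
  The greatest C*-norm on the algebraic tensor product. UHF algebras are nuclear, so for them it is
  the only one and the completion is the C*-tensor product without further qualification. (The last
  clause of the definition above holds for every C*-seminorm on the algebraic tensor product of
  C*-algebras.)
\<close>

definition alg_tensor :: "'a star_alg \<Rightarrow> 'b star_alg \<Rightarrow> ('a \<times> 'b) list star_alg" where
  "alg_tensor A B =
     \<lparr> carrier = lists (carrier A \<times> carrier B),
       mult = tensor_mult A B,
       one = [(\<one>\<^bsub>A\<^esub>, \<one>\<^bsub>B\<^esub>)],
       zero = [],
       add = (@),
       smult = tensor_smult A,
       invol = tensor_invol A B,
       anorm = (\<lambda>t. Sup {p t | p. tensor_cstar_seminorm A B p}) \<rparr>"

definition cstar_tensor ::
  "'a star_alg \<Rightarrow> 'b star_alg \<Rightarrow> (nat \<Rightarrow> ('a \<times> 'b) list) set star_alg" where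
  "cstar_tensor A B = alg_completion (alg_tensor A B)"

definition cstar_elem_tensor ::
  "'a star_alg \<Rightarrow> 'b star_alg \<Rightarrow> 'a \<Rightarrow> 'b \<Rightarrow> (nat \<Rightarrow> ('a \<times> 'b) list) set" where
  "cstar_elem_tensor A B x y = alg_completion_rel (alg_tensor A B) `` {\<lambda>_. [(x, y)]}"

definition state_tensor ::
  "'a star_alg \<Rightarrow> 'b star_alg \<Rightarrow> ('a \<Rightarrow> complex) \<Rightarrow> ('b \<Rightarrow> complex) \<Rightarrow>
     (nat \<Rightarrow> ('a \<times> 'b) list) set \<Rightarrow> complex" where
  "state_tensor A B f g = (THE h. state (cstar_tensor A B) h \<and>
     (\<forall>x\<in>carrier A. \<forall>y\<in>carrier B. h (cstar_elem_tensor A B x y) = f x * g y))"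


section \<open>Hilbert spaces and representations\<close>

text \<open>
  The ring multiplication and unit inherited from the record type of modules carry no meaning for
  Hilbert spaces. The inner product is linear in the second argument.
\<close>

record 'h inner_module = "(complex, 'h) module" +
  cinner :: "'h \<Rightarrow> 'h \<Rightarrow> complex"

definition hnorm :: "'h inner_module \<Rightarrow> 'h \<Rightarrow> real" where
  "hnorm H x = sqrt (Re (cinner H x x))"

definition hilbert_space :: "'h inner_module \<Rightarrow> bool" where
  "hilbert_space H \<longleftrightarrow>
     Module.module (class_ring :: complex ring) H \<and>
     (\<forall>x\<in>carrier H. \<forall>y\<in>carrier H. \<forall>z\<in>carrier H.
        cinner H x (y \<oplus>\<^bsub>H\<^esub> z) = cinner H x y + cinner H x z) \<and>
     (\<forall>c. \<forall>x\<in>carrier H. \<forall>y\<in>carrier H. cinner H x (c \<odot>\<^bsub>H\<^esub> y) = c * cinner H x y) \<and>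
     (\<forall>x\<in>carrier H. \<forall>y\<in>carrier H. cinner H y x = cnj (cinner H x y)) \<and>
     (\<forall>x\<in>carrier H. cinner H x x \<in> \<real>\<^sub>\<ge>\<^sub>0 \<and> (cinner H x x = 0 \<longrightarrow> x = \<zero>\<^bsub>H\<^esub>)) \<and>
     (\<forall>X\<in>cauchy_seqs H (hnorm H). \<exists>x\<in>carrier H. (\<lambda>n. hnorm H (vdiff H (X n) x)) \<longlonglongrightarrow> 0)"

definition pre_hilbert_tensor ::
  "'h inner_module \<Rightarrow> 'k inner_module \<Rightarrow> ('h \<times> 'k) list inner_module" where
  "pre_hilbert_tensor H K =
     \<lparr> carrier = lists (carrier H \<times> carrier K),
       mult = undefined,
       one = undefined,
       zero = [],
       add = (@),
       smult = tensor_smult H,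
       cinner = (\<lambda>s t. \<Sum>(x, y)\<leftarrow>s. \<Sum>(x', y')\<leftarrow>t. cinner H x x' * cinner K y y') \<rparr>"

abbreviation hilbert_tensor_rel where
  "hilbert_tensor_rel H K \<equiv>
     completion_rel (pre_hilbert_tensor H K) (hnorm (pre_hilbert_tensor H K))"

definition hilbert_tensor ::
  "'h inner_module \<Rightarrow> 'k inner_module \<Rightarrow> (nat \<Rightarrow> ('h \<times> 'k) list) set inner_module" where
  "hilbert_tensor H K = (let P = pre_hilbert_tensor H K; r = hilbert_tensor_rel H K in
     \<lparr> carrier = cauchy_seqs P (hnorm P) // r,
       mult = undefined,
       one = undefined,
       zero = r `` {\<lambda>_. \<zero>\<^bsub>P\<^esub>},
       add = lift_binary r (add P),
       smult = (\<lambda>c. lift_unary r (smult P c)),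
       cinner = (\<lambda>S T. lim (\<lambda>n. cinner P (class_repr S n) (class_repr T n))) \<rparr>)"

definition hilbert_elem_tensor ::
  "'h inner_module \<Rightarrow> 'k inner_module \<Rightarrow> 'h \<Rightarrow> 'k \<Rightarrow> (nat \<Rightarrow> ('h \<times> 'k) list) set" where
  "hilbert_elem_tensor H K x y = hilbert_tensor_rel H K `` {\<lambda>_. [(x, y)]}"

definition bounded_ops :: "'h inner_module \<Rightarrow> ('h \<Rightarrow> 'h) set" where
  "bounded_ops H = {T \<in> carrier H \<rightarrow>\<^sub>E carrier H.
     (\<forall>x\<in>carrier H. \<forall>y\<in>carrier H. T (x \<oplus>\<^bsub>H\<^esub> y) = T x \<oplus>\<^bsub>H\<^esub> T y) \<and>
     (\<forall>c. \<forall>x\<in>carrier H. T (c \<odot>\<^bsub>H\<^esub> x) = c \<odot>\<^bsub>H\<^esub> T x) \<and>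
     (\<exists>C. \<forall>x\<in>carrier H. hnorm H (T x) \<le> C * hnorm H x)}"

definition star_representation ::
  "'a star_alg \<Rightarrow> 'h inner_module \<Rightarrow> ('a \<Rightarrow> 'h \<Rightarrow> 'h) \<Rightarrow> bool" where
  "star_representation A H \<pi> \<longleftrightarrow>
     hilbert_space H \<and>
     \<pi> \<in> carrier A \<rightarrow>\<^sub>E bounded_ops H \<and>
     (\<forall>x\<in>carrier A. \<forall>y\<in>carrier A. \<forall>\<xi>\<in>carrier H.
        \<pi> (x \<oplus>\<^bsub>A\<^esub> y) \<xi> = \<pi> x \<xi> \<oplus>\<^bsub>H\<^esub> \<pi> y \<xi> \<and> \<pi> (x \<otimes>\<^bsub>A\<^esub> y) \<xi> = \<pi> x (\<pi> y \<xi>)) \<and>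
     (\<forall>c. \<forall>x\<in>carrier A. \<forall>\<xi>\<in>carrier H. \<pi> (c \<odot>\<^bsub>A\<^esub> x) \<xi> = c \<odot>\<^bsub>H\<^esub> \<pi> x \<xi>) \<and>
     (\<forall>x\<in>carrier A. \<forall>\<xi>\<in>carrier H. \<forall>\<eta>\<in>carrier H.
        cinner H (\<pi> (invol A x) \<xi>) \<eta> = cinner H \<xi> (\<pi> x \<eta>)) \<and>
     (\<forall>\<xi>\<in>carrier H. \<pi> \<one>\<^bsub>A\<^esub> \<xi> = \<xi>) \<and>
     (\<forall>x\<in>carrier A. \<forall>\<xi>\<in>carrier H. hnorm H (\<pi> x \<xi>) \<le> anorm A x * hnorm H \<xi>)"

definition hilbert_unitary ::
  "'h inner_module \<Rightarrow> 'k inner_module \<Rightarrow> ('h \<Rightarrow> 'k) \<Rightarrow> bool" where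
  "hilbert_unitary H K U \<longleftrightarrow>
     bij_betw U (carrier H) (carrier K) \<and>
     (\<forall>x\<in>carrier H. \<forall>y\<in>carrier H. U (x \<oplus>\<^bsub>H\<^esub> y) = U x \<oplus>\<^bsub>K\<^esub> U y) \<and>
     (\<forall>c. \<forall>x\<in>carrier H. U (c \<odot>\<^bsub>H\<^esub> x) = c \<odot>\<^bsub>K\<^esub> U x) \<and>
     (\<forall>x\<in>carrier H. \<forall>y\<in>carrier H. cinner K (U x) (U y) = cinner H x y)"

definition unitarily_equivalent ::
  "'a star_alg \<Rightarrow> 'h inner_module \<Rightarrow> ('a \<Rightarrow> 'h \<Rightarrow> 'h) \<Rightarrow>
     'k inner_module \<Rightarrow> ('a \<Rightarrow> 'k \<Rightarrow> 'k) \<Rightarrow> bool" where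
  "unitarily_equivalent A H \<pi> K \<rho> \<longleftrightarrow>
     (\<exists>U. hilbert_unitary H K U \<and> (\<forall>x\<in>carrier A. \<forall>\<xi>\<in>carrier H. U (\<pi> x \<xi>) = \<rho> x (U \<xi>)))"

definition unitary_class ::
  "'a star_alg \<Rightarrow> 'h inner_module \<Rightarrow> ('a \<Rightarrow> 'h \<Rightarrow> 'h) \<Rightarrow>
     ('h inner_module \<times> ('a \<Rightarrow> 'h \<Rightarrow> 'h)) set" where
  "unitary_class A H \<pi> = {(K, \<rho>). star_representation A K \<rho> \<and> unitarily_equivalent A H \<pi> K \<rho>}"

definition rep_tensor ::
  "'a star_alg \<Rightarrow> 'b star_alg \<Rightarrow> 'h inner_module \<Rightarrow> 'k inner_module \<Rightarrow>
     ('a \<Rightarrow> 'h \<Rightarrow> 'h) \<Rightarrow> ('b \<Rightarrow> 'k \<Rightarrow> 'k) \<Rightarrow>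
     (nat \<Rightarrow> ('a \<times> 'b) list) set \<Rightarrow>
     (nat \<Rightarrow> ('h \<times> 'k) list) set \<Rightarrow> (nat \<Rightarrow> ('h \<times> 'k) list) set" where
  "rep_tensor A B H K \<pi> \<rho> = (THE \<sigma>.
     star_representation (cstar_tensor A B) (hilbert_tensor H K) \<sigma> \<and>
     (\<forall>x\<in>carrier A. \<forall>y\<in>carrier B. \<forall>\<xi>\<in>carrier H. \<forall>\<eta>\<in>carrier K.
        \<sigma> (cstar_elem_tensor A B x y) (hilbert_elem_tensor H K \<xi> \<eta>) =
        hilbert_elem_tensor H K (\<pi> x \<xi>) (\<rho> y \<eta>)))"


section \<open>UHF algebras\<close>

text \<open>
  Matrix and sequence indices start at 0. The tensor product of \<open>M\<^sub>m\<close> and \<open>M\<^sub>n\<close> is \<open>M\<^sub>m\<^sub>n\<close> with the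
  Kronecker product; accordingly the \<open>n\<close>-th algebra is the algebra of square matrices of size
  \<open>a 0 * \<dots> * a (n - 1)\<close>.
\<close>

definition kron :: "complex mat \<Rightarrow> complex mat \<Rightarrow> complex mat" where
  "kron A B = mat (dim_row A * dim_row B) (dim_col A * dim_col B)
     (\<lambda>(i, j). A $$ (i div dim_row B, j div dim_col B) * B $$ (i mod dim_row B, j mod dim_col B))"

definition matrix_unit :: "nat \<Rightarrow> nat \<Rightarrow> nat \<Rightarrow> complex mat" where
  "matrix_unit n i j = mat n n (\<lambda>(r, c). if r = i \<and> c = j then 1 else 0)"

definition vec_l2norm :: "complex vec \<Rightarrow> real" where
  "vec_l2norm v = L2_set (\<lambda>i. cmod (v $ i)) {..<dim_vec v}"

definition mat_opnorm :: "complex mat \<Rightarrow> real" where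
  "mat_opnorm A = Sup {vec_l2norm (A *\<^sub>v v) | v. v \<in> carrier_vec (dim_col A) \<and> vec_l2norm v \<le> 1}"

definition uhf_size :: "(nat \<Rightarrow> nat) \<Rightarrow> nat \<Rightarrow> nat" where
  "uhf_size a n = (\<Prod>i<n. a i)"

primrec uhf_embed :: "(nat \<Rightarrow> nat) \<Rightarrow> nat \<Rightarrow> nat \<Rightarrow> complex mat \<Rightarrow> complex mat" where
  "uhf_embed a n 0 X = X"
| "uhf_embed a n (Suc k) X = kron (uhf_embed a n k X) (1\<^sub>m (a (n + k)))"

primrec unit_tensor ::
  "(nat \<Rightarrow> nat) \<Rightarrow> (nat \<Rightarrow> nat) \<Rightarrow> (nat \<Rightarrow> nat) \<Rightarrow> nat \<Rightarrow> complex mat" where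
  "unit_tensor a j k 0 = 1\<^sub>m 1"
| "unit_tensor a j k (Suc n) = kron (unit_tensor a j k n) (matrix_unit (a n) (j n) (k n))"

definition uhf_lift2 ::
  "(nat \<Rightarrow> nat) \<Rightarrow> (complex mat \<Rightarrow> complex mat \<Rightarrow> complex mat) \<Rightarrow>
     nat \<times> complex mat \<Rightarrow> nat \<times> complex mat \<Rightarrow> nat \<times> complex mat" where
  "uhf_lift2 a f = (\<lambda>(m, X) (n, Y). let l = max m n in
     (l, f (uhf_embed a m (l - m) X) (uhf_embed a n (l - n) Y)))"

text \<open>
  The pair \<open>(n, X)\<close> stands for the matrix \<open>X\<close> of the \<open>n\<close>-th algebra; \<open>(n, X)\<close> and
  \<open>(n + k, uhf_embed a n k X)\<close> have a difference of norm zero and so are identified in the completion.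
\<close>

definition uhf_local :: "(nat \<Rightarrow> nat) \<Rightarrow> (nat \<times> complex mat) star_alg" where
  "uhf_local a =
     \<lparr> carrier = {(n, X). X \<in> carrier_mat (uhf_size a n) (uhf_size a n)},
       mult = uhf_lift2 a (*),
       one = (0, 1\<^sub>m 1),
       zero = (0, 0\<^sub>m 1 1),
       add = uhf_lift2 a (+),
       smult = (\<lambda>c (n, X). (n, c \<cdot>\<^sub>m X)),
       invol = (\<lambda>(n, X). (n, mat_adjoint X)),
       anorm = (\<lambda>(n, X). mat_opnorm X) \<rparr>"

definition uhf :: "(nat \<Rightarrow> nat) \<Rightarrow> (nat \<Rightarrow> nat \<times> complex mat) set star_alg" where
  "uhf a = alg_completion (uhf_local a)"

definition uhf_incl :: "(nat \<Rightarrow> nat) \<Rightarrow> nat \<Rightarrow> complex mat \<Rightarrow> (nat \<Rightarrow> nat \<times> complex mat) set" where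
  "uhf_incl a n X = alg_completion_rel (uhf_local a) `` {\<lambda>_. (n, X)}"


section \<open>The nonsymmetric tensor product\<close>

definition seq_times :: "(nat \<Rightarrow> nat) \<Rightarrow> (nat \<Rightarrow> nat) \<Rightarrow> nat \<Rightarrow> nat"  (infixl \<open>\<bullet>\<^sub>s\<close> 70) where
  "a \<bullet>\<^sub>s b = (\<lambda>n. a n * b n)"

lemma seq_times_commute: "a \<bullet>\<^sub>s b = b \<bullet>\<^sub>s a"
  by (simp add: seq_times_def mult.commute)

definition uhf_phi ::
  "(nat \<Rightarrow> nat) \<Rightarrow> (nat \<Rightarrow> nat) \<Rightarrow> (nat \<Rightarrow> nat \<times> complex mat) set \<Rightarrow>
     (nat \<Rightarrow> ((nat \<Rightarrow> nat \<times> complex mat) set \<times> (nat \<Rightarrow> nat \<times> complex mat) set) list) set" where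
  "uhf_phi a b = (THE f.
     star_iso (uhf (a \<bullet>\<^sub>s b)) (cstar_tensor (uhf a) (uhf b)) f \<and>
     (\<forall>n j' k' j'' k''.
        (\<forall>i<n. j' i < a i \<and> k' i < a i \<and> j'' i < b i \<and> k'' i < b i) \<longrightarrow>
        f (uhf_incl (a \<bullet>\<^sub>s b) n
             (unit_tensor (a \<bullet>\<^sub>s b) (\<lambda>i. b i * j' i + j'' i) (\<lambda>i. b i * k' i + k'' i) n)) =
        cstar_elem_tensor (uhf a) (uhf b)
          (uhf_incl a n (unit_tensor a j' k' n)) (uhf_incl b n (unit_tensor b j'' k'' n))))"

definition state_tensor_phi where
  "state_tensor_phi a b \<omega> \<omega>' =
     restrict (state_tensor (uhf a) (uhf b) \<omega> \<omega>' \<circ> uhf_phi a b) (carrier (uhf (a \<bullet>\<^sub>s b)))"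

definition rep_tensor_phi where
  "rep_tensor_phi a b H K \<pi> \<rho> =
     restrict (rep_tensor (uhf a) (uhf b) H K \<pi> \<rho> \<circ> uhf_phi a b) (carrier (uhf (a \<bullet>\<^sub>s b)))"

end

theory Submission
  imports Defs
begin

text \<open>
  Take \<open>a = b = (2, 2, \<dots>)\<close>, so that both orders of the factors use the same isomorphism \<open>\<phi>\<close>. Counting
  from 0, let \<open>\<omega>\<^sub>0\<close> and \<open>\<omega>\<^sub>1\<close> be the product states given by the basis vector \<open>e\<^sub>0\<close>, respectively \<open>e\<^sub>1\<close>,
  in every factor. Since \<open>1 = 2 \<cdot> 0 + 1\<close>, \<open>\<phi>\<close> maps the \<open>n\<close>-fold tensor power \<open>p\<^sub>n\<close> of the matrix unit
  \<open>E\<^sub>1\<^sub>1\<close> of \<open>M\<^sub>4\<close> to the tensor product of the \<open>n\<close>-fold powers of \<open>E\<^sub>0\<^sub>0\<close> and \<open>E\<^sub>1\<^sub>1\<close>. Hence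
  \<open>\<omega>\<^sub>0 \<otimes> \<omega>\<^sub>1\<close> takes the value 1 at \<open>p\<^sub>1\<close>, and \<open>\<omega>\<^sub>1 \<otimes> \<omega>\<^sub>0\<close> the value 0. For the associated
  representations, some unit vector is fixed by all \<open>p\<^sub>n\<close> in the first tensor product, whereas in the second
  one \<open>p\<^sub>n\<close> tends strongly to 0; so no unitary intertwines them.

  Existence and uniqueness of \<open>\<phi>\<close> and of the tensor products of states and representations are
  obtained by identifying each completion with a norm closed space of operators on an \<open>\<ell>\<^sup>2\<close>-space. The
  greatest C*-seminorm on the algebraic tensor product then becomes the operator norm: on the part
  coming from matrices of a fixed level every C*-seminorm is bounded by a multiple of the operator norm,
  the C*-identity reduces the factor to 1, and these parts are dense.
\<close>

section \<open>Complex Banach spaces\<close>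

text \<open>The maps to be compared are given by definite descriptions on classes of Cauchy
  sequences of formal expressions, which below the completion do not even obey the vector space
  laws. So a model asks for little: a map into a Banach space that respects the operations and turns
  the seminorm into the norm. It extends to the completion, is injective there, and makes identities
  of classes into identities of operators.

  The operators originate in q injections of an index set whose ranges partition it. Words of length
  n in them are base q numerals, and a matrix unit of level n replaces one initial word by another.
  Pairing digits to bases q and q' gives digits to base q q' in the order in which \<phi> splits
  indices; hence in these models \<phi> becomes the identity on operators, and only the equality of
  two operator spaces is left to prove. The injections also encode the product states: an index
  fixed by one injection gives a basis vector fixed by all tensor powers of the corresponding
  diagonal matrix unit. Two such systems on one index set then give both states by the same
  vector.\<close>

class cbanach = banach +
  fixes cscale :: "complex \<Rightarrow> 'a \<Rightarrow> 'a" (infixr \<open>*\<^sub>C\<close> 75)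
  assumes cscale_add_right: "c *\<^sub>C (x + y) = c *\<^sub>C x + c *\<^sub>C y"
    and cscale_add_left: "(c + d) *\<^sub>C x = c *\<^sub>C x + d *\<^sub>C x"
    and cscale_cscale [simp]: "c *\<^sub>C d *\<^sub>C x = (c * d) *\<^sub>C x"
    and cscale_of_real: "complex_of_real r *\<^sub>C x = r *\<^sub>R x"
    and norm_cscale [simp]: "norm (c *\<^sub>C x) = cmod c * norm x"

lemma cscale_one [simp]: "1 *\<^sub>C x = (x::'a::cbanach)"
  using cscale_of_real[of 1 x] by simp

lemma cscale_minus_one [simp]: "(-1) *\<^sub>C x = - (x::'a::cbanach)"
  using cscale_of_real[of "-1" x] by simp

lemma cscale_zero_left [simp]: "0 *\<^sub>C (x::'a::cbanach) = 0"
  using cscale_of_real[of 0 x] by simp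

lemma cscale_zero_right [simp]: "c *\<^sub>C 0 = (0::'a::cbanach)"
  using norm_cscale[of c "0::'a"] by (simp del: norm_cscale)

lemma cscale_minus_right [simp]: "c *\<^sub>C (- x) = - (c *\<^sub>C (x::'a::cbanach))"
  using cscale_cscale[of c "-1" x] cscale_cscale[of "-1" c x] by (simp del: cscale_cscale)

lemma cscale_sum_right: "c *\<^sub>C (\<Sum>i\<in>A. f i) = (\<Sum>i\<in>A. c *\<^sub>C (f i :: 'a::cbanach))"
  by (induction A rule: infinite_finite_induct) (auto simp: cscale_add_right)

lemma cscale_sum_left: "(\<Sum>i\<in>A. f i) *\<^sub>C x = (\<Sum>i\<in>A. f i *\<^sub>C (x::'a::cbanach))"
  by (induction A rule: infinite_finite_induct) (auto simp: cscale_add_left)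

lemma bounded_linear_cscale: "bounded_linear (\<lambda>x::'a::cbanach. c *\<^sub>C x)"
proof (rule bounded_linear_intro)
  show "c *\<^sub>C (r *\<^sub>R x) = r *\<^sub>R (c *\<^sub>C x)" for r and x :: 'a
    by (metis cscale_cscale cscale_of_real mult.commute)
  show "norm (c *\<^sub>C x) \<le> norm x * cmod c" for x :: 'a
    by simp
qed (rule cscale_add_right)

lemmas tendsto_cscale [tendsto_intros] = bounded_linear.tendsto[OF bounded_linear_cscale]

instantiation complex :: cbanach
begin
definition cscale_complex :: "complex \<Rightarrow> complex \<Rightarrow> complex" where
  "cscale_complex = (*)"
instance
  by standard (auto simp: cscale_complex_def algebra_simps norm_mult scaleR_conv_of_real)
end

definition csubspace :: "'a::cbanach set \<Rightarrow> bool" where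
  "csubspace S \<longleftrightarrow> 0 \<in> S \<and> (\<forall>x\<in>S. \<forall>y\<in>S. x + y \<in> S) \<and> (\<forall>c. \<forall>x\<in>S. c *\<^sub>C x \<in> S)"

lemma csubspace_sum:
  assumes "csubspace S" "\<And>i. i \<in> A \<Longrightarrow> f i \<in> S"
  shows "(\<Sum>i\<in>A. f i) \<in> S"
  using assms(2)
  by (induction A rule: infinite_finite_induct) (use assms(1) in \<open>auto simp: csubspace_def\<close>)

lemma csubspace_closure:
  assumes "csubspace S"
  shows "csubspace (closure S)"
  unfolding csubspace_def
proof (intro conjI ballI allI)
  show "0 \<in> closure S"
    using assms closure_subset unfolding csubspace_def by blast
  show "x + y \<in> closure S" if xy: "x \<in> closure S" "y \<in> closure S" for x y
  proof -
    from xy obtain f g where "\<forall>n. f n \<in> S" "f \<longlonglongrightarrow> x" "\<forall>n. g n \<in> S" "g \<longlonglongrightarrow> y"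
      unfolding closure_sequential by blast
    hence "\<forall>n. f n + g n \<in> S" "(\<lambda>n. f n + g n) \<longlonglongrightarrow> x + y"
      using assms by (auto simp: csubspace_def intro: tendsto_add)
    thus ?thesis
      unfolding closure_sequential by (intro exI[of _ "\<lambda>n. f n + g n"]) blast
  qed
  show "c *\<^sub>C x \<in> closure S" if x: "x \<in> closure S" for c x
  proof -
    from x obtain f where "\<forall>n. f n \<in> S" "f \<longlonglongrightarrow> x"
      unfolding closure_sequential by blast
    hence "\<forall>n. c *\<^sub>C f n \<in> S" "(\<lambda>n. c *\<^sub>C f n) \<longlonglongrightarrow> c *\<^sub>C x"
      using assms by (auto simp: csubspace_def intro: tendsto_intros)
    thus ?thesis
      unfolding closure_sequential by (intro exI[of _ "\<lambda>n. c *\<^sub>C f n"]) blast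
  qed
qed

section \<open>The Hilbert space of square summable families\<close>

text \<open>The index type is a parameter so that the Hilbert tensor product of two such spaces is
  again one, over pairs of indices.\<close>

typedef 'i ell2 = "{f :: 'i \<Rightarrow> complex. (\<lambda>i. (cmod (f i))\<^sup>2) summable_on UNIV}"
  morphisms coord Abs_ell2
  by (rule exI[of _ "\<lambda>_. 0"]) simp

setup_lifting type_definition_ell2

lemma coord_summable: "(\<lambda>i. (cmod (coord x i))\<^sup>2) summable_on UNIV"
  using coord[of x] by simp

lemma square_summable_add:
  fixes f g :: "'i \<Rightarrow> complex"
  assumes "(\<lambda>i. (cmod (f i))\<^sup>2) summable_on UNIV" "(\<lambda>i. (cmod (g i))\<^sup>2) summable_on UNIV"
  shows "(\<lambda>i. (cmod (f i + g i))\<^sup>2) summable_on UNIV"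
proof (rule summable_on_comparison_test)
  show "(\<lambda>i. 2 * (cmod (f i))\<^sup>2 + 2 * (cmod (g i))\<^sup>2) summable_on UNIV"
    by (intro summable_on_add summable_on_cmult_right assms)
  show "(cmod (f i + g i))\<^sup>2 \<le> 2 * (cmod (f i))\<^sup>2 + 2 * (cmod (g i))\<^sup>2" for i
  proof -
    have "(cmod (f i + g i))\<^sup>2 \<le> (cmod (f i) + cmod (g i))\<^sup>2"
      by (intro power_mono norm_triangle_ineq) auto
    also have "\<dots> \<le> 2 * (cmod (f i))\<^sup>2 + 2 * (cmod (g i))\<^sup>2"
      using zero_le_power2[of "cmod (f i) - cmod (g i)"]
      by (simp add: power2_eq_square algebra_simps)
    finally show ?thesis .
  qed
qed auto

lemma square_summable_mult:
  fixes f :: "'i \<Rightarrow> complex"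
  assumes "(\<lambda>i. (cmod (f i))\<^sup>2) summable_on UNIV"
  shows "(\<lambda>i. (cmod (c * f i))\<^sup>2) summable_on UNIV"
  using summable_on_cmult_right[OF assms, of "(cmod c)\<^sup>2"] by (simp add: norm_mult power_mult_distrib)

instantiation ell2 :: (type) real_vector
begin
lift_definition zero_ell2 :: "'a ell2" is "\<lambda>_. 0" by simp
lift_definition plus_ell2 :: "'a ell2 \<Rightarrow> 'a ell2 \<Rightarrow> 'a ell2" is "\<lambda>f g i. f i + g i"
  by (rule square_summable_add)
lift_definition uminus_ell2 :: "'a ell2 \<Rightarrow> 'a ell2" is "\<lambda>f i. - f i" by simp
lift_definition minus_ell2 :: "'a ell2 \<Rightarrow> 'a ell2 \<Rightarrow> 'a ell2" is "\<lambda>f g i. f i - g i"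
  using square_summable_add[of _ "\<lambda>i. - _ i"] by simp
lift_definition scaleR_ell2 :: "real \<Rightarrow> 'a ell2 \<Rightarrow> 'a ell2" is "\<lambda>r f i. complex_of_real r * f i"
  by (rule square_summable_mult)
instance
  by standard (transfer; auto simp: algebra_simps)+
end

lemma coord_arith [simp]:
  "coord 0 i = 0" "coord (x + y) i = coord x i + coord y i" "coord (x - y) i = coord x i - coord y i"
  "coord (- x) i = - coord x i"
  by (transfer; simp)+

lemma coord_sum [simp]: "coord (\<Sum>a\<in>A. f a) i = (\<Sum>a\<in>A. coord (f a) i)"
  by (induction A rule: infinite_finite_induct) auto

lemma ell2_eqI: "(\<And>i. coord x i = coord y i) \<Longrightarrow> x = y"
  by (metis coord_inject ext)

lemma inner_summable: "(\<lambda>i. inner (coord x i) (coord y i)) summable_on UNIV"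
proof (rule abs_summable_summable)
  show "(\<lambda>i. norm (inner (coord x i) (coord y i))) summable_on UNIV"
  proof (rule summable_on_comparison_test)
    show "(\<lambda>i. (cmod (coord x i))\<^sup>2 + (cmod (coord y i))\<^sup>2) summable_on UNIV"
      by (intro summable_on_add coord_summable)
    show "norm (inner (coord x i) (coord y i)) \<le> (cmod (coord x i))\<^sup>2 + (cmod (coord y i))\<^sup>2" for i
    proof -
      have "norm (inner (coord x i) (coord y i)) \<le> cmod (coord x i) * cmod (coord y i)"
        using Cauchy_Schwarz_ineq2 by auto
      also have "\<dots> \<le> 2 * (cmod (coord x i) * cmod (coord y i))"
        by simp
      also have "\<dots> \<le> (cmod (coord x i))\<^sup>2 + (cmod (coord y i))\<^sup>2"
        using sum_squares_bound[of "cmod (coord x i)" "cmod (coord y i)"] by simp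
      finally show ?thesis .
    qed
  qed auto
qed

text \<open>Only the real part of the inner product is needed for norm and topology;
  \<open>cip\<close> recovers the complex one from it.\<close>

instantiation ell2 :: (type) real_inner
begin
definition inner_ell2 :: "'a ell2 \<Rightarrow> 'a ell2 \<Rightarrow> real" where
  "inner_ell2 x y = (\<Sum>\<^sub>\<infinity>i. inner (coord x i) (coord y i))"
definition norm_ell2 :: "'a ell2 \<Rightarrow> real" where "norm_ell2 x = sqrt (inner x x)"
definition dist_ell2 :: "'a ell2 \<Rightarrow> 'a ell2 \<Rightarrow> real" where "dist_ell2 x y = norm (x - y)"
definition sgn_ell2 :: "'a ell2 \<Rightarrow> 'a ell2" where "sgn_ell2 x = x /\<^sub>R norm x"
definition uniformity_ell2 :: "('a ell2 \<times> 'a ell2) filter" where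
  "uniformity_ell2 = (INF e\<in>{0 <..}. principal {(x, y). dist x y < e})"
definition open_ell2 :: "'a ell2 set \<Rightarrow> bool" where
  "open_ell2 S = (\<forall>x\<in>S. \<forall>\<^sub>F (x', y) in uniformity. x' = x \<longrightarrow> y \<in> S)"
instance
proof
  fix x y z :: "'a ell2" and r :: real
  show "inner x y = inner y x"
    by (simp add: inner_ell2_def inner_commute)
  show "inner (x + y) z = inner x z + inner y z"
    by (simp add: inner_ell2_def inner_add_left infsum_add inner_summable)
  show "inner (r *\<^sub>R x) y = r * inner x y"
    unfolding inner_ell2_def
    by (subst infsum_cmult_right'[symmetric])
       (transfer, simp add: inner_complex_def algebra_simps)
  show nn: "0 \<le> inner x x"
    by (simp add: inner_ell2_def infsum_nonneg)
  show "inner x x = 0 \<longleftrightarrow> x = 0"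
  proof
    assume "inner x x = 0"
    hence "coord x i = 0" for i
      using nonneg_infsum_le_0D[of "\<lambda>i. inner (coord x i) (coord x i)" UNIV i] inner_summable[of x x]
      by (simp add: inner_ell2_def)
    thus "x = 0"
      by (intro ell2_eqI) simp
  qed (simp add: inner_ell2_def)
qed (rule norm_ell2_def dist_ell2_def sgn_ell2_def uniformity_ell2_def open_ell2_def)+
end

lemma norm_ell2_sq: "(norm x)\<^sup>2 = (\<Sum>\<^sub>\<infinity>i. (cmod (coord x i))\<^sup>2)"
  by (simp only: power2_norm_eq_inner inner_ell2_def)

lemma sum_coord_le_norm: "finite F \<Longrightarrow> (\<Sum>i\<in>F. (cmod (coord x i))\<^sup>2) \<le> (norm x)\<^sup>2"
  unfolding norm_ell2_sq by (rule finite_sum_le_infsum[OF coord_summable]) auto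

lemma coord_le_norm: "cmod (coord x i) \<le> norm x"
  using sum_coord_le_norm[of "{i}" x] by (auto intro: power2_le_imp_le)

lemma norm_ell2_le:
  assumes "\<And>F. finite F \<Longrightarrow> (\<Sum>i\<in>F. (cmod (coord x i))\<^sup>2) \<le> B\<^sup>2" "0 \<le> B"
  shows "norm x \<le> B"
proof -
  have "(norm x)\<^sup>2 \<le> B\<^sup>2"
    unfolding norm_ell2_sq by (rule infsum_le_finite_sums[OF coord_summable]) (use assms in auto)
  thus ?thesis
    using assms(2) by (rule power2_le_imp_le)
qed

lemma bounded_linear_coord: "bounded_linear (\<lambda>x. coord x i)"
proof (rule bounded_linear_intro)
  show "coord (r *\<^sub>R x) i = r *\<^sub>R coord x i" for r and x :: "'a ell2"
    by (transfer) (simp add: scaleR_conv_of_real)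
  show "norm (coord x i) \<le> norm x * 1" for x :: "'a ell2"
    by (simp add: coord_le_norm)
qed simp

instance ell2 :: (type) complete_space
proof
  fix X :: "nat \<Rightarrow> 'a ell2"
  assume X: "Cauchy X"
  have "Cauchy (\<lambda>n. coord (X n) i)" for i
    by (rule bounded_linear.Cauchy[OF bounded_linear_coord X])
  hence "\<exists>l. (\<lambda>n. coord (X n) i) \<longlonglongrightarrow> l" for i
    using Cauchy_convergent unfolding convergent_def by blast
  then obtain f where f: "\<And>i. (\<lambda>n. coord (X n) i) \<longlonglongrightarrow> f i"
    by metis
  \<comment> \<open>Letting n tend to infinity on a finite index set \<open>F\<close> gives an
    estimate that does not depend on \<open>F\<close>.\<close>
  have bound: "(\<Sum>i\<in>F. (cmod (coord (X m) i - f i))\<^sup>2) \<le> e\<^sup>2"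
    if N: "\<forall>m\<ge>N. \<forall>n\<ge>N. norm (X m - X n) < e" and m: "m \<ge> N" and F: "finite F" for e N m F
  proof (rule tendsto_upperbound)
    show "(\<lambda>n. \<Sum>i\<in>F. (cmod (coord (X m) i - coord (X n) i))\<^sup>2)
        \<longlonglongrightarrow> (\<Sum>i\<in>F. (cmod (coord (X m) i - f i))\<^sup>2)"
      by (intro tendsto_intros f)
    show "\<forall>\<^sub>F n in sequentially. (\<Sum>i\<in>F. (cmod (coord (X m) i - coord (X n) i))\<^sup>2) \<le> e\<^sup>2"
    proof (rule eventually_sequentiallyI[of N])
      fix n assume "n \<ge> N"
      hence "norm (X m - X n) \<le> e"
        using N m by (simp add: less_imp_le)
      hence "(norm (X m - X n))\<^sup>2 \<le> e\<^sup>2"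
        by (intro power_mono) auto
      thus "(\<Sum>i\<in>F. (cmod (coord (X m) i - coord (X n) i))\<^sup>2) \<le> e\<^sup>2"
        using sum_coord_le_norm[OF F, of "X m - X n"] by simp
    qed
  qed simp
  \<comment> \<open>A single late term suffices: the limit f is \<open>X M\<close> minus a square
    summable family.\<close>
  obtain M where M: "\<forall>m\<ge>M. \<forall>n\<ge>M. norm (X m - X n) < 1"
    using CauchyD[OF X, of 1] by auto
  have "(\<lambda>i. (cmod (coord (X M) i - f i))\<^sup>2) summable_on UNIV"
    by (rule nonneg_bdd_above_summable_on)
       (use bound[OF M order_refl] in \<open>auto intro!: bdd_aboveI2[where M="1\<^sup>2"]\<close>)
  hence "(\<lambda>i. (cmod (coord (X M) i + - (coord (X M) i - f i)))\<^sup>2) summable_on UNIV"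
    by (intro square_summable_add coord_summable) (simp add: norm_minus_commute)
  hence f_sum: "(\<lambda>i. (cmod (f i))\<^sup>2) summable_on UNIV"
    by simp
  define x where "x = Abs_ell2 f"
  have coord_x: "coord x = f"
    unfolding x_def using f_sum by (intro Abs_ell2_inverse) simp
  have "X \<longlonglongrightarrow> x"
  proof (rule LIMSEQ_I)
    fix r :: real assume r: "r > 0"
    obtain N where N: "\<forall>m\<ge>N. \<forall>n\<ge>N. norm (X m - X n) < r / 2"
      using CauchyD[OF X, of "r / 2"] r by auto
    have "norm (X m - x) \<le> r / 2" if "m \<ge> N" for m
      by (rule norm_ell2_le) (use bound[OF N that] r in \<open>auto simp: coord_x\<close>)
    thus "\<exists>N. \<forall>n\<ge>N. norm (X n - x) < r"
      using r by (intro exI[of _ N]) fastforce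
  qed
  thus "convergent X"
    unfolding convergent_def by blast
qed

instantiation ell2 :: (type) cbanach
begin
lift_definition cscale_ell2 :: "complex \<Rightarrow> 'a ell2 \<Rightarrow> 'a ell2" is "\<lambda>c f i. c * f i"
  by (rule square_summable_mult)
instance
proof
  fix c d :: complex and x y :: "'a ell2" and r :: real
  have "(norm (c *\<^sub>C x))\<^sup>2 = (cmod c * norm x)\<^sup>2"
    unfolding norm_ell2_sq power_mult_distrib
    by (subst infsum_cmult_right'[symmetric]) (transfer, simp add: norm_mult power_mult_distrib)
  thus "norm (c *\<^sub>C x) = cmod c * norm x"
    by (rule power2_eq_imp_eq) auto
qed (transfer; simp add: algebra_simps)+
end

lemma coord_cscale [simp]: "coord (c *\<^sub>C x) i = c * coord x i"
  by transfer simp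

text \<open>The form is antilinear on the left, so scaling x by \<i> multiplies it by -\<i>, and the
  real part of the result is the imaginary part of the original.\<close>

definition cip :: "'i ell2 \<Rightarrow> 'i ell2 \<Rightarrow> complex" where
  "cip x y = Complex (inner x y) (inner (\<i> *\<^sub>C x) y)"

lemma inner_ii: "inner (\<i> *\<^sub>C x) (y :: 'i ell2) = - inner x (\<i> *\<^sub>C y)"
  unfolding inner_ell2_def by (subst infsum_uminus[symmetric]) (simp add: inner_complex_def)

lemma Re_cip: "Re (cip x y) = inner x y"
  by (simp add: cip_def)

lemma cscale_Complex: "c *\<^sub>C x = Re c *\<^sub>R x + Im c *\<^sub>R (\<i> *\<^sub>C (x::'a::cbanach))"
proof -
  have "c *\<^sub>C x = (complex_of_real (Re c) + complex_of_real (Im c) * \<i>) *\<^sub>C x"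
    using complex_eq[of c] by (simp add: mult.commute)
  also have "\<dots> = complex_of_real (Re c) *\<^sub>C x + complex_of_real (Im c) *\<^sub>C \<i> *\<^sub>C x"
    by (simp only: cscale_add_left cscale_cscale)
  finally show ?thesis
    by (simp only: cscale_of_real)
qed

lemma cip_add_right: "cip x (y + z) = cip x y + cip x z"
  by (simp add: cip_def complex_eq_iff inner_add_right)

lemma cip_cscale_right: "cip x (c *\<^sub>C y) = c * cip x y"
proof -
  have "inner x (\<i> *\<^sub>C y) = - inner (\<i> *\<^sub>C x) y" "inner (\<i> *\<^sub>C x) (\<i> *\<^sub>C y) = inner x y"
    using inner_ii[of x y] inner_ii[of x "\<i> *\<^sub>C y"] by auto
  thus ?thesis
    by (subst cscale_Complex) (simp add: cip_def complex_eq_iff inner_add_right)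
qed

lemma cip_commute: "cip y x = cnj (cip x y)"
  using inner_ii[of x y] by (simp add: cip_def complex_eq_iff inner_commute)

lemma cip_add_left: "cip (x + y) z = cip x z + cip y z"
  by (metis cip_add_right cip_commute complex_cnj_add)

lemma cip_cscale_left: "cip (c *\<^sub>C x) y = cnj c * cip x y"
  by (metis cip_commute cip_cscale_right complex_cnj_mult)

lemma cip_minus: "cip (- x) y = - cip x y" "cip x (- y) = - cip x y"
  using cip_cscale_left[of "-1" x y] cip_cscale_right[of x "-1" y] by auto

lemma cip_diff: "cip (x - y) z = cip x z - cip y z" "cip x (y - z) = cip x y - cip x z"
  using cip_add_left[of x "- y" z] cip_add_right[of x y "- z"] by (auto simp: cip_minus)

lemma cip_zero [simp]: "cip 0 x = 0" "cip x 0 = 0"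
  by (simp_all add: cip_def complex_eq_iff)

lemma cip_sum_right: "cip x (\<Sum>a\<in>A. f a) = (\<Sum>a\<in>A. cip x (f a))"
  by (induction A rule: infinite_finite_induct) (auto simp: cip_add_right)

lemma cip_self: "cip x x = complex_of_real ((norm x)\<^sup>2)"
proof -
  have "inner (\<i> *\<^sub>C x) x = 0"
    using inner_ii[of x x] by (simp add: inner_commute)
  thus ?thesis
    by (simp add: cip_def complex_eq_iff power2_norm_eq_inner)
qed

lemma norm_cip_le: "cmod (cip x y) \<le> norm x * norm y"
proof (cases "cip x y = 0")
  case False
  \<comment> \<open>This phase makes the product real and nonnegative, so that the real
    Cauchy-Schwarz inequality applies.\<close>
  define c where "c = cnj (cip x y) / cmod (cip x y)"
  have c: "cmod c = 1"
    using False by (simp add: c_def norm_divide)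
  have "cip x (c *\<^sub>C y) = cip x y * cnj (cip x y) / cmod (cip x y)"
    by (simp add: cip_cscale_right c_def)
  also have "\<dots> = cmod (cip x y)"
    using False by (simp only: complex_norm_square[symmetric]) (simp add: power2_eq_square)
  finally have "cip x (c *\<^sub>C y) = cmod (cip x y)" .
  hence "cmod (cip x y) = inner x (c *\<^sub>C y)"
    using Re_cip by (metis Re_complex_of_real)
  also have "\<dots> \<le> norm x * norm (c *\<^sub>C y)"
    by (rule norm_cauchy_schwarz)
  finally show ?thesis
    by (simp add: c)
qed simp

lemma bounded_bilinear_cip: "bounded_bilinear cip"
proof
  show "cip (r *\<^sub>R x) y = r *\<^sub>R cip x y" "cip x (r *\<^sub>R y) = r *\<^sub>R cip x y" for r and x y :: "'i ell2"
    by (simp_all add: cscale_of_real[symmetric] cip_cscale_left cip_cscale_right cscale_complex_def)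
  show "\<exists>K. \<forall>x y :: 'i ell2. norm (cip x y) \<le> norm x * norm y * K"
    by (rule exI[of _ 1]) (simp add: norm_cip_le)
qed (rule cip_add_left cip_add_right)+

lemmas tendsto_cip = bounded_bilinear.tendsto[OF bounded_bilinear_cip]

lift_definition ket :: "'i \<Rightarrow> 'i ell2" is "\<lambda>i j. if j = i then 1 else 0"
proof -
  fix i :: 'i
  have "(\<lambda>j. (cmod (if j = i then 1 else 0))\<^sup>2) summable_on {i}"
    by (rule summable_on_finite) simp
  thus "(\<lambda>j. (cmod (if j = i then 1 else 0))\<^sup>2) summable_on UNIV"
    using summable_on_cong_neutral[of UNIV "{i}" "\<lambda>j. (cmod (if j = i then 1 else 0))\<^sup>2"
        "\<lambda>j. (cmod (if j = i then 1 else 0))\<^sup>2"]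
    by auto
qed

lemma coord_ket: "coord (ket i) j = (if j = i then 1 else 0)"
  by transfer simp

lemma inner_ket_left: "inner (ket i) x = Re (coord x i)"
proof -
  have "inner (ket i) x = (\<Sum>\<^sub>\<infinity>j\<in>{i}. inner (coord (ket i) j) (coord x j))"
    unfolding inner_ell2_def by (rule infsum_cong_neutral) (auto simp: coord_ket)
  also have "\<dots> = Re (coord x i)"
    by (simp add: coord_ket inner_complex_def)
  finally show ?thesis .
qed

lemma cip_ket_left: "cip (ket i) x = coord x i"
  using inner_ii[of "ket i" x] by (simp add: cip_def complex_eq_iff inner_ket_left)

lemma norm_ket [simp]: "norm (ket i) = 1"
proof -
  have "complex_of_real ((norm (ket i))\<^sup>2) = 1"
    unfolding cip_self[symmetric] cip_ket_left by (simp add: coord_ket)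
  hence "(norm (ket i))\<^sup>2 = 1\<^sup>2"
    by (simp only: of_real_eq_1_iff one_power2)
  thus ?thesis
    by (rule power2_eq_imp_eq) auto
qed

text \<open>Finite partial sums of the basis expansion of x lie in \<open>S\<close>, and the squared
  norm of the remainder is the tail of a convergent sum.\<close>

lemma closed_csubspace_kets:
  assumes "csubspace S" "closed S" "\<And>i. ket i \<in> S"
  shows "x \<in> S"
proof -
  have "\<exists>y\<in>S. dist y x < e" if e: "e > 0" for e
  proof -
    have "((\<lambda>i. (cmod (coord x i))\<^sup>2) has_sum (norm x)\<^sup>2) UNIV"
      unfolding norm_ell2_sq by (rule has_sum_infsum[OF coord_summable])
    hence "\<forall>\<^sub>F F in finite_subsets_at_top UNIV. dist (\<Sum>i\<in>F. (cmod (coord x i))\<^sup>2) ((norm x)\<^sup>2) < e\<^sup>2"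
      unfolding has_sum_def using e by (intro tendstoD) auto
    then obtain F where F: "finite F" "dist (\<Sum>i\<in>F. (cmod (coord x i))\<^sup>2) ((norm x)\<^sup>2) < e\<^sup>2"
      unfolding eventually_finite_subsets_at_top by auto
    define y where "y = (\<Sum>i\<in>F. coord x i *\<^sub>C ket i)"
    have cy: "coord y i = (if i \<in> F then coord x i else 0)" for i
      using F(1) by (simp add: y_def coord_ket if_distrib[of "\<lambda>u. _ * u"] cong: if_cong)
    have "(norm (x - y))\<^sup>2 = (\<Sum>\<^sub>\<infinity>i\<in>UNIV - F. (cmod (coord x i))\<^sup>2)"
      unfolding norm_ell2_sq by (rule infsum_cong_neutral) (auto simp: cy)
    also have "\<dots> = (norm x)\<^sup>2 - (\<Sum>i\<in>F. (cmod (coord x i))\<^sup>2)"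
      unfolding norm_ell2_sq using F(1)
      by (subst infsum_Diff) (auto simp: coord_summable)
    also have "\<dots> < e\<^sup>2"
      using F(2) by (simp add: dist_real_def abs_if split: if_splits)
    finally have "norm (x - y) < e"
      using e by (rule power2_less_imp_less[OF _ less_imp_le])
    moreover have "y \<in> S"
      unfolding y_def using assms by (intro csubspace_sum) (auto simp: csubspace_def)
    ultimately show ?thesis
      by (auto simp: dist_norm norm_minus_commute)
  qed
  hence "x \<in> closure S"
    by (auto simp: closure_approachable)
  thus ?thesis
    using assms(2) by simp
qed

section \<open>Adjointable operators\<close>

lemma cip_eqI: "(\<And>z. cip z x = cip z y) \<Longrightarrow> x = y"
  by (rule ell2_eqI) (simp flip: cip_ket_left)

text \<open>With the adjoint required by the type, no representation theorem for functionals enters: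
  every operator constructed below comes with an explicit adjoint.\<close>

typedef 'i cop = "{T :: 'i ell2 \<Rightarrow>\<^sub>L 'i ell2. \<exists>S :: 'i ell2 \<Rightarrow>\<^sub>L 'i ell2.
    \<forall>x y. cip (blinfun_apply S x) y = cip x (blinfun_apply T y)}"
  morphisms blin Abs_cop
  by (rule exI[of _ 0]) (auto intro!: exI[of _ 0] simp: zero_blinfun.rep_eq)

setup_lifting type_definition_cop

definition ap :: "'i cop \<Rightarrow> 'i ell2 \<Rightarrow> 'i ell2" where
  "ap T = blinfun_apply (blin T)"

lemma ap_bounded_linear: "bounded_linear (ap T)"
  unfolding ap_def by (rule blinfun.bounded_linear_right)

lemma cop_eqI: "(\<And>x. ap T x = ap U x) \<Longrightarrow> T = U"
  by (simp add: ap_def blin_inject[symmetric] blinfun_eqI)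

text \<open>Meaningful for bounded maps with an adjoint; \<open>cop_of_blin\<close> then returns the
  map itself.\<close>

definition cop_of :: "('i ell2 \<Rightarrow> 'i ell2) \<Rightarrow> 'i cop" where
  "cop_of f = Abs_cop (Blinfun f)"

text \<open>An adjoint forces linearity: both sides of each linearity equation have the same inner
  product with every vector. Later constructions therefore only exhibit an adjoint and a
  bound.\<close>

lemma adjointable_bounded_linear:
  fixes f g :: "'i ell2 \<Rightarrow> 'i ell2"
  assumes adj: "\<And>x y. cip (g x) y = cip x (f y)" and bound: "\<And>y. norm (f y) \<le> K * norm y"
  shows "bounded_linear f"
proof (rule bounded_linear_intro)
  show "f (x + y) = f x + f y" for x y
    by (rule cip_eqI) (simp add: adj[symmetric] cip_add_right)
  show "f (r *\<^sub>R x) = r *\<^sub>R f x" for r x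
    by (rule cip_eqI) (simp add: adj[symmetric] cip_cscale_right flip: cscale_of_real)
  show "norm (f x) \<le> norm x * K" for x
    using bound[of x] by (simp add: mult.commute)
qed

text \<open>The squared norm of g x is the inner product of x with f (g x); Cauchy-Schwarz and
  cancelling one factor give the bound.\<close>

lemma adjoint_bound:
  fixes f g :: "'i ell2 \<Rightarrow> 'i ell2"
  assumes adj: "\<And>x y. cip (g x) y = cip x (f y)" and bound: "\<And>y. norm (f y) \<le> K * norm y"
  shows "norm (g x) \<le> K * norm x"
proof (cases "g x = 0")
  case True
  have "0 \<le> K * norm x"
    using bound[of x] norm_ge_zero order_trans by blast
  thus ?thesis by (simp add: True)
next
  case False
  have "(norm (g x))\<^sup>2 = cmod (cip (g x) (g x))"
    by (simp add: cip_self norm_power)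
  also have "\<dots> = cmod (cip x (f (g x)))"
    by (simp add: adj)
  also have "\<dots> \<le> norm x * (K * norm (g x))"
    by (rule order_trans[OF norm_cip_le]) (intro mult_left_mono bound norm_ge_zero)
  finally have "norm (g x) * norm (g x) \<le> (K * norm x) * norm (g x)"
    by (simp add: power2_eq_square mult_ac)
  thus ?thesis
    using False by (simp add: mult_le_cancel_right)
qed

lemma cop_of_blin:
  fixes f g :: "'i ell2 \<Rightarrow> 'i ell2"
  assumes adj: "\<And>x y. cip (g x) y = cip x (f y)" and bound: "\<And>y. norm (f y) \<le> K * norm y"
  shows "blin (cop_of f) = Blinfun f" and "ap (cop_of f) = f"
proof -
  have f: "bounded_linear f"
    by (rule adjointable_bounded_linear[OF adj bound])
  have "cip (f x) y = cip x (g y)" for x y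
    by (metis adj cip_commute)
  hence g: "bounded_linear g"
    by (rule adjointable_bounded_linear) (rule adjoint_bound[OF adj bound])
  show "blin (cop_of f) = Blinfun f"
    unfolding cop_of_def
    by (rule Abs_cop_inverse) (use adj in \<open>auto intro!: exI[of _ "Blinfun g"] simp: bounded_linear_Blinfun_apply f g\<close>)
  thus "ap (cop_of f) = f"
    by (simp add: ap_def bounded_linear_Blinfun_apply f)
qed

text \<open>The adjoint of T has T as its own adjoint, so it belongs to the type as well.\<close>

lemma adjoint_ex: "\<exists>S. \<forall>x y. cip (ap S x) y = cip x (ap T y)"
proof -
  obtain S where S: "\<And>x y. cip (blinfun_apply S x) y = cip x (blinfun_apply (blin T) y)"
    using blin[of T] by blast
  have "cip (ap T x) y = cip x (blinfun_apply S y)" for x y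
    by (metis S ap_def cip_commute)
  hence "ap (cop_of (blinfun_apply S)) = blinfun_apply S"
    by (rule cop_of_blin(2)) (rule norm_blinfun)
  thus ?thesis
    using S by (intro exI[of _ "cop_of (blinfun_apply S)"]) (simp add: ap_def)
qed

definition adj :: "'i cop \<Rightarrow> 'i cop" where
  "adj T = (SOME S. \<forall>x y. cip (ap S x) y = cip x (ap T y))"

lemma cip_adj: "cip (ap (adj T) x) y = cip x (ap T y)"
  using someI_ex[OF adjoint_ex[of T]] by (simp add: adj_def)

lemma cip_adj': "cip x (ap (adj T) y) = cip (ap T x) y"
  by (metis cip_adj cip_commute)

lemma adj_unique:
  assumes "\<And>x y. cip (ap S x) y = cip x (ap T y)"
  shows "adj T = S"
  by (rule cop_eqI, rule cip_eqI) (metis assms cip_adj cip_commute)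

lemma adj_adj [simp]: "adj (adj T) = T"
  by (rule adj_unique) (simp add: cip_adj')

lemma ap_cscale: "ap T (c *\<^sub>C x) = c *\<^sub>C ap T x"
  by (rule cip_eqI) (simp add: cip_adj[symmetric] cip_cscale_right)

lemma ap_cop_of_adj:
  assumes "\<And>x y. cip (g x) y = cip x (f y)" "\<And>y. norm (f y) \<le> K * norm y"
  shows "ap (adj (cop_of f)) = g"
proof -
  have "ap (cop_of g) = g"
  proof (rule cop_of_blin(2))
    show "cip (f x) y = cip x (g y)" for x y
      by (metis assms(1) cip_commute)
  qed (rule adjoint_bound[OF assms])
  moreover have "adj (cop_of f) = cop_of g"
    by (rule adj_unique) (simp add: calculation cop_of_blin(2)[OF assms] assms(1))
  ultimately show ?thesis by simp
qed

section \<open>The C*-algebra of adjointable operators\<close>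

instantiation cop :: (type) real_normed_algebra_1
begin
lift_definition zero_cop :: "'a cop" is 0
  by (auto intro!: exI[of _ 0] simp: zero_blinfun.rep_eq)
lift_definition one_cop :: "'a cop" is id_blinfun
  by (auto intro!: exI[of _ id_blinfun])
lift_definition plus_cop :: "'a cop \<Rightarrow> 'a cop \<Rightarrow> 'a cop" is "(+)"
  by (auto simp: blinfun.add_left cip_add_left cip_add_right) (metis blinfun.add_left cip_add_left)
lift_definition uminus_cop :: "'a cop \<Rightarrow> 'a cop" is uminus
  by (auto simp: blinfun.minus_left cip_minus) (metis blinfun.minus_left cip_minus(1))
lift_definition minus_cop :: "'a cop \<Rightarrow> 'a cop \<Rightarrow> 'a cop" is "(-)"
  by (auto simp: blinfun.diff_left cip_diff) (metis blinfun.diff_left cip_diff(1))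
lift_definition scaleR_cop :: "real \<Rightarrow> 'a cop \<Rightarrow> 'a cop" is scaleR
proof -
  fix r and T :: "'a ell2 \<Rightarrow>\<^sub>L 'a ell2"
  assume "\<exists>S :: 'a ell2 \<Rightarrow>\<^sub>L 'a ell2. \<forall>x y. cip (blinfun_apply S x) y = cip x (blinfun_apply T y)"
  then obtain S :: "'a ell2 \<Rightarrow>\<^sub>L 'a ell2" where "\<forall>x y. cip (blinfun_apply S x) y = cip x (blinfun_apply T y)"
    by blast
  thus "\<exists>S :: 'a ell2 \<Rightarrow>\<^sub>L 'a ell2. \<forall>x y. cip (blinfun_apply S x) y = cip x (blinfun_apply (r *\<^sub>R T) y)"
    by (intro exI[of _ "r *\<^sub>R S"])
       (simp add: blinfun.scaleR_left bounded_bilinear.scaleR_left[OF bounded_bilinear_cip]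
          bounded_bilinear.scaleR_right[OF bounded_bilinear_cip])
qed
lift_definition times_cop :: "'a cop \<Rightarrow> 'a cop \<Rightarrow> 'a cop" is "blinfun_compose"
proof -
  fix T U :: "'a ell2 \<Rightarrow>\<^sub>L 'a ell2"
  assume "\<exists>S :: 'a ell2 \<Rightarrow>\<^sub>L 'a ell2. \<forall>x y. cip (blinfun_apply S x) y = cip x (blinfun_apply T y)"
    "\<exists>S :: 'a ell2 \<Rightarrow>\<^sub>L 'a ell2. \<forall>x y. cip (blinfun_apply S x) y = cip x (blinfun_apply U y)"
  then obtain S S' :: "'a ell2 \<Rightarrow>\<^sub>L 'a ell2"
    where "\<forall>x y. cip (blinfun_apply S x) y = cip x (blinfun_apply T y)"
      "\<forall>x y. cip (blinfun_apply S' x) y = cip x (blinfun_apply U y)"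
    by blast
  thus "\<exists>S :: 'a ell2 \<Rightarrow>\<^sub>L 'a ell2. \<forall>x y. cip (blinfun_apply S x) y = cip x (blinfun_apply (T o\<^sub>L U) y)"
    by (intro exI[of _ "S' o\<^sub>L S"]) simp
qed
lift_definition norm_cop :: "'a cop \<Rightarrow> real" is norm .
definition dist_cop :: "'a cop \<Rightarrow> 'a cop \<Rightarrow> real" where "dist_cop x y = norm (x - y)"
definition sgn_cop :: "'a cop \<Rightarrow> 'a cop" where "sgn_cop x = scaleR (inverse (norm x)) x"
definition uniformity_cop :: "('a cop \<times> 'a cop) filter" where
  "uniformity_cop = (INF e\<in>{0 <..}. principal {(x, y). dist x y < e})"
definition open_cop :: "'a cop set \<Rightarrow> bool" where
  "open_cop S = (\<forall>x\<in>S. \<forall>\<^sub>F (x', y) in uniformity. x' = x \<longrightarrow> y \<in> S)"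
instance
proof
  \<comment> \<open>Index types are nonempty, so there is a basis vector, and it has norm 1.\<close>
  show "(0 :: 'a cop) \<noteq> 1"
  proof
    assume "(0 :: 'a cop) = 1"
    hence "(0 :: 'a ell2 \<Rightarrow>\<^sub>L 'a ell2) = id_blinfun"
      by transfer
    note eq = this
    have "ket undefined = blinfun_apply (id_blinfun :: 'a ell2 \<Rightarrow>\<^sub>L 'a ell2) (ket undefined)"
      by simp
    also have "\<dots> = 0"
      by (simp only: eq[symmetric] blinfun.zero_left)
    finally have "ket undefined = (0 :: 'a ell2)" .
    thus False
      using norm_ket[of "undefined :: 'a"] by simp
  qed
  show "T * U * V = T * (U * V)" for T U V :: "'a cop"
    by transfer (simp add: blinfun_eqI)
  show "norm (1 :: 'a cop) = 1"
  proof (rule antisym)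
    show "norm (1 :: 'a cop) \<le> 1"
      by transfer (rule norm_blinfun_id_le)
    have "norm (blinfun_apply id_blinfun (ket undefined :: 'a ell2)) \<le>
        norm (id_blinfun :: 'a ell2 \<Rightarrow>\<^sub>L 'a ell2) * norm (ket undefined :: 'a ell2)"
      by (rule norm_blinfun)
    thus "1 \<le> norm (1 :: 'a cop)"
      by transfer simp
  qed
next
  fix a b c :: "'a cop" and r s :: real
  show "a + b + c = a + (b + c)" by transfer (rule add.assoc)
  show "a + b = b + a" by transfer (rule add.commute)
  show "0 + a = a" by transfer simp
  show "- a + a = 0" by transfer simp
  show "a - b = a + - b" by transfer simp
  show "r *\<^sub>R (a + b) = r *\<^sub>R a + r *\<^sub>R b" by transfer (rule scaleR_add_right)
  show "(r + s) *\<^sub>R a = r *\<^sub>R a + s *\<^sub>R a" by transfer (rule scaleR_add_left)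
  show "r *\<^sub>R s *\<^sub>R a = (r * s) *\<^sub>R a" by transfer (rule scaleR_scaleR)
  show "1 *\<^sub>R a = a" by transfer (rule scaleR_one)
  show "(a + b) * c = a * c + b * c" by transfer (rule blinfun_eqI, simp add: blinfun.add_left)
  show "a * (b + c) = a * b + a * c"
    by transfer (rule blinfun_eqI, simp add: blinfun.add_left blinfun.add_right)
  show "r *\<^sub>R a * b = r *\<^sub>R (a * b)" by transfer (rule blinfun_eqI, simp add: blinfun.scaleR_left)
  show "a * r *\<^sub>R b = r *\<^sub>R (a * b)"
    by transfer (rule blinfun_eqI, simp add: blinfun.scaleR_left blinfun.scaleR_right)
  show "1 * a = a" by transfer (rule blinfun_eqI, simp)
  show "a * 1 = a" by transfer (rule blinfun_eqI, simp)
  show "norm a = 0 \<longleftrightarrow> a = 0" by transfer (rule norm_eq_zero)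
  show "norm (a + b) \<le> norm a + norm b" by transfer (rule norm_triangle_ineq)
  show "norm (r *\<^sub>R a) = \<bar>r\<bar> * norm a" by transfer (rule norm_scaleR)
  show "norm (a * b) \<le> norm a * norm b" by transfer (rule norm_blinfun_compose)
qed (rule dist_cop_def sgn_cop_def uniformity_cop_def open_cop_def)+
end

lemma ap_arith [simp]:
  "ap 0 x = 0" "ap 1 x = x" "ap (T + U) x = ap T x + ap U x" "ap (T - U) x = ap T x - ap U x"
  "ap (- T) x = - ap T x" "ap (T * U) x = ap T (ap U x)"
  by (simp_all add: ap_def zero_cop.rep_eq one_cop.rep_eq plus_cop.rep_eq minus_cop.rep_eq uminus_cop.rep_eq
      times_cop.rep_eq blinfun.add_left blinfun.diff_left blinfun.minus_left)

lemma ap_scaleR: "ap (r *\<^sub>R T) x = r *\<^sub>R ap T x"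
  by (simp add: ap_def scaleR_cop.rep_eq blinfun.scaleR_left)

lemma ap_linear:
  "ap T 0 = 0" "ap T (x + y) = ap T x + ap T y" "ap T (x - y) = ap T x - ap T y"
  using ap_bounded_linear[of T] by (simp_all add: linear_simps bounded_linear.linear)

lemma ap_sum_left [simp]: "ap (\<Sum>a\<in>A. f a) x = (\<Sum>a\<in>A. ap (f a) x)"
  by (induction A rule: infinite_finite_induct) auto

lemma ap_sum_right: "ap T (\<Sum>a\<in>A. f a) = (\<Sum>a\<in>A. ap T (f a))"
  by (induction A rule: infinite_finite_induct) (auto simp: ap_linear)

lemma norm_ap: "norm (ap T x) \<le> norm T * norm x"
  by (simp add: ap_def norm_cop.rep_eq norm_blinfun)

lemma norm_cop_le: "0 \<le> B \<Longrightarrow> (\<And>x. norm (ap T x) \<le> B * norm x) \<Longrightarrow> norm T \<le> B"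
  by (simp add: ap_def norm_cop.rep_eq norm_blinfun_bound)

lemma norm_adj [simp]: "norm (adj T) = norm T"
proof -
  have "norm (adj U) \<le> norm U" for U :: "'a cop"
    by (rule norm_cop_le[OF norm_ge_zero]) (rule adjoint_bound[OF cip_adj norm_ap])
  from this[of T] this[of "adj T"] show ?thesis by simp
qed

lemma adj_arith [simp]:
  "adj 0 = 0" "adj 1 = 1" "adj (T + U) = adj T + adj U" "adj (T - U) = adj T - adj U"
  "adj (T * U) = adj U * adj T"
  by (rule adj_unique; simp add: cip_add_left cip_add_right cip_diff cip_adj)+

text \<open>The C*-identity. For the lower bound, the squared norm of T x is the inner product of x
  with \<open>adj T * T\<close> applied to x.\<close>

lemma norm_adj_mult: "norm (adj T * T) = (norm T)\<^sup>2"
proof (rule antisym)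
  show "norm (adj T * T) \<le> (norm T)\<^sup>2"
    using norm_mult_ineq[of "adj T" T] by (simp add: power2_eq_square)
  have "norm T \<le> sqrt (norm (adj T * T))"
  proof (rule norm_cop_le)
    fix x
    have "(norm (ap T x))\<^sup>2 = cmod (cip (ap T x) (ap T x))"
      by (simp add: cip_self norm_power)
    also have "\<dots> = cmod (cip x (ap (adj T * T) x))"
      by (simp add: cip_adj')
    also have "\<dots> \<le> norm x * (norm (adj T * T) * norm x)"
      by (rule order_trans[OF norm_cip_le]) (intro mult_left_mono norm_ap norm_ge_zero)
    also have "\<dots> = (sqrt (norm (adj T * T)) * norm x)\<^sup>2"
      by (simp add: power_mult_distrib power2_eq_square)
    finally show "norm (ap T x) \<le> sqrt (norm (adj T * T)) * norm x"
      by (rule power2_le_imp_le) auto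
  qed auto
  hence "(norm T)\<^sup>2 \<le> (sqrt (norm (adj T * T)))\<^sup>2"
    by (rule power_mono) auto
  thus "(norm T)\<^sup>2 \<le> norm (adj T * T)"
    by simp
qed

lemma bounded_linear_adj: "bounded_linear adj"
proof (rule bounded_linear_intro)
  show "adj (r *\<^sub>R T) = r *\<^sub>R adj T" for r and T :: "'a cop"
    by (rule adj_unique)
       (simp add: ap_scaleR cip_adj bounded_bilinear.scaleR_left[OF bounded_bilinear_cip]
          bounded_bilinear.scaleR_right[OF bounded_bilinear_cip])
  show "norm (adj T) \<le> norm T * 1" for T :: "'a cop"
    by simp
qed simp

lemmas tendsto_adj = bounded_linear.tendsto[OF bounded_linear_adj]

text \<open>Norm limits stay adjointable: \<open>adj\<close> is isometric, so the adjoints converge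
  too, and their limit is an adjoint of the limit.\<close>

instance cop :: (type) complete_space
proof
  fix X :: "nat \<Rightarrow> 'a cop"
  assume X: "Cauchy X"
  have lim: "\<exists>L. (\<lambda>n. blin (Y n)) \<longlonglongrightarrow> L" if "Cauchy Y" for Y :: "nat \<Rightarrow> 'a cop"
  proof -
    have "Cauchy (\<lambda>n. blin (Y n))"
      using that by (simp add: Cauchy_def dist_norm norm_cop.rep_eq minus_cop.rep_eq)
    thus ?thesis
      by (auto simp: Cauchy_convergent_iff convergent_def)
  qed
  obtain L where L: "(\<lambda>n. blin (X n)) \<longlonglongrightarrow> L"
    using lim[OF X] by blast
  obtain M where M: "(\<lambda>n. blin (adj (X n))) \<longlonglongrightarrow> M"
    using lim[OF bounded_linear.Cauchy[OF bounded_linear_adj X]] by blast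
  have "cip (blinfun_apply M x) y = cip x (blinfun_apply L y)" for x y
  proof (rule LIMSEQ_unique)
    show "(\<lambda>n. cip (ap (adj (X n)) x) y) \<longlonglongrightarrow> cip (blinfun_apply M x) y"
      unfolding ap_def by (rule tendsto_cip[OF blinfun.tendsto[OF M tendsto_const] tendsto_const])
    show "(\<lambda>n. cip (ap (adj (X n)) x) y) \<longlonglongrightarrow> cip x (blinfun_apply L y)"
      unfolding cip_adj unfolding ap_def by (rule tendsto_cip[OF tendsto_const blinfun.tendsto[OF L tendsto_const]])
  qed
  hence "blin (Abs_cop L) = L"
    by (intro Abs_cop_inverse) blast
  hence "X \<longlonglongrightarrow> Abs_cop L"
    using L by (simp add: tendsto_iff dist_norm norm_cop.rep_eq minus_cop.rep_eq)
  thus "convergent X"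
    unfolding convergent_def by blast
qed

instantiation cop :: (type) cbanach
begin
definition cscale_cop :: "complex \<Rightarrow> 'a cop \<Rightarrow> 'a cop" where
  "cscale_cop c T = cop_of (\<lambda>x. c *\<^sub>C ap T x)"

lemma ap_cscale_left: "ap (c *\<^sub>C T) x = c *\<^sub>C ap T x"
proof -
  have "ap (cop_of (\<lambda>x. c *\<^sub>C ap T x)) = (\<lambda>x. c *\<^sub>C ap T x)"
  proof (rule cop_of_blin(2))
    show "cip (cnj c *\<^sub>C ap (adj T) x) y = cip x (c *\<^sub>C ap T y)" for x y
      by (simp add: cip_cscale_left cip_cscale_right cip_adj)
    show "norm (c *\<^sub>C ap T x) \<le> (cmod c * norm T) * norm x" for x
      using norm_ap[of T x] by (simp add: mult.assoc mult_left_mono)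
  qed
  thus ?thesis
    by (simp add: cscale_cop_def)
qed

instance
proof
  fix c d :: complex and T U :: "'a cop" and r :: real
  show "c *\<^sub>C (T + U) = c *\<^sub>C T + c *\<^sub>C U" "(c + d) *\<^sub>C T = c *\<^sub>C T + d *\<^sub>C T" "c *\<^sub>C d *\<^sub>C T = (c * d) *\<^sub>C T"
    by (rule cop_eqI; simp add: ap_cscale_left cscale_add_left cscale_add_right)+
  show "complex_of_real r *\<^sub>C T = r *\<^sub>R T"
    by (rule cop_eqI) (simp add: ap_cscale_left cscale_of_real ap_scaleR)
  have le: "norm (c *\<^sub>C T) \<le> cmod c * norm T" for c and T :: "'a cop"
    by (rule norm_cop_le) (use norm_ap[of T] in \<open>auto simp: ap_cscale_left mult.assoc mult_left_mono\<close>)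
  show "norm (c *\<^sub>C T) = cmod c * norm T"
  proof (cases "c = 0")
    case True
    thus ?thesis using le[of c T] by simp
  next
    case False
    \<comment> \<open>The reverse inequality is the one already proved, applied to the inverse
      scalar.\<close>
    have "T = inverse c *\<^sub>C (c *\<^sub>C T)"
      by (rule cop_eqI) (simp add: ap_cscale_left False)
    hence "norm T \<le> inverse (cmod c) * norm (c *\<^sub>C T)"
      using le[of "inverse c" "c *\<^sub>C T"] by (simp add: norm_inverse)
    hence "cmod c * norm T \<le> norm (c *\<^sub>C T)"
      using False by (simp add: field_simps)
    thus ?thesis using le[of c T] by simp
  qed
qed
end

lemma adj_cscale [simp]: "adj (c *\<^sub>C T) = cnj c *\<^sub>C adj T"
  by (rule adj_unique) (simp add: ap_cscale_left cip_cscale_left cip_cscale_right cip_adj)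

lemma cscale_mult: "(c *\<^sub>C T) * U = c *\<^sub>C (T * U)" "T * (c *\<^sub>C U) = c *\<^sub>C (T * (U :: 'i cop))"
  by (rule cop_eqI; simp add: ap_cscale_left ap_cscale)+

lemma adj_sum [simp]: "adj (\<Sum>a\<in>A. f a) = (\<Sum>a\<in>A. adj (f a))"
  by (induction A rule: infinite_finite_induct) auto

text \<open>Equality is shown for the adjoints first: their coordinates are inner products with the
  images of basis vectors.\<close>

lemma cop_eqI_ket:
  assumes "\<And>i. ap T (ket i) = ap U (ket i)"
  shows "T = U"
proof -
  have "ap (adj T) x = ap (adj U) x" for x
    by (rule ell2_eqI) (metis assms cip_adj' cip_ket_left)
  hence "adj T = adj U"
    by (rule cop_eqI)
  thus ?thesis by (metis adj_adj)
qed

section \<open>Isometries induced by injections\<close>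

text \<open>For injective f this is the adjoint of \<open>push f\<close>, the isometry that takes
  the basis vector at i to the one at f i.\<close>

definition pull :: "('i \<Rightarrow> 'j) \<Rightarrow> 'j ell2 \<Rightarrow> 'i ell2" where
  "pull f y = Abs_ell2 (\<lambda>i. coord y (f i))"

definition push :: "('i \<Rightarrow> 'j) \<Rightarrow> 'i ell2 \<Rightarrow> 'j ell2" where
  "push f x = Abs_ell2 (\<lambda>j. if j \<in> range f then coord x (inv_into UNIV f j) else 0)"

lemma coord_Abs_ell2: "(\<lambda>i. (cmod (f i))\<^sup>2) summable_on UNIV \<Longrightarrow> coord (Abs_ell2 f) i = f i"
  by (simp add: Abs_ell2_inverse)

lemma coord_pull:
  assumes "inj f"
  shows "coord (pull f y) i = coord y (f i)"
proof -
  have "(\<lambda>j. (cmod (coord y j))\<^sup>2) summable_on range f"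
    by (rule summable_on_subset_banach[OF coord_summable]) auto
  hence "(\<lambda>i. (cmod (coord y (f i)))\<^sup>2) summable_on UNIV"
    by (subst (asm) summable_on_reindex[OF assms]) (simp add: o_def)
  thus ?thesis
    unfolding pull_def by (rule coord_Abs_ell2)
qed

lemma coord_push:
  assumes "inj f"
  shows "coord (push f x) j = (if j \<in> range f then coord x (inv_into UNIV f j) else 0)"
proof -
  have "(\<lambda>j. (cmod (coord x (inv_into UNIV f j)))\<^sup>2) summable_on range f"
    using coord_summable[of x] assms by (subst summable_on_reindex[OF assms]) (simp add: o_def)
  hence "(\<lambda>j. (cmod (if j \<in> range f then coord x (inv_into UNIV f j) else 0))\<^sup>2) summable_on UNIV"
    by (subst summable_on_cong_neutral[where T = "range f" and g = "\<lambda>j. (cmod (coord x (inv_into UNIV f j)))\<^sup>2"]) auto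
  thus ?thesis
    unfolding push_def by (rule coord_Abs_ell2)
qed

lemma inner_pull:
  assumes "inj f"
  shows "inner (pull f y) x = inner y (push f x)"
proof -
  have "inner y (push f x) = (\<Sum>\<^sub>\<infinity>j\<in>range f. inner (coord y j) (coord x (inv_into UNIV f j)))"
    unfolding inner_ell2_def by (rule infsum_cong_neutral) (auto simp: coord_push[OF assms])
  also have "\<dots> = (\<Sum>\<^sub>\<infinity>i. inner (coord y (f i)) (coord x i))"
    by (subst infsum_reindex[OF assms]) (simp add: o_def assms)
  finally show ?thesis
    unfolding inner_ell2_def by (simp add: coord_pull[OF assms])
qed

lemma cip_pull:
  assumes "inj f"
  shows "cip (pull f y) x = cip y (push f x)"
proof -
  have "\<i> *\<^sub>C pull f y = pull f (\<i> *\<^sub>C y)"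
    by (rule ell2_eqI) (simp add: coord_pull[OF assms])
  thus ?thesis
    by (simp add: cip_def inner_pull[OF assms])
qed

lemma pull_push: "inj f \<Longrightarrow> pull f (push f x) = x"
  by (rule ell2_eqI) (simp add: coord_pull coord_push)

lemma norm_push [simp]: "inj f \<Longrightarrow> norm (push f x) = norm x"
  by (rule power2_eq_imp_eq)
     (simp_all add: power2_norm_eq_inner inner_pull[symmetric] pull_push)

definition shift_op :: "('i \<Rightarrow> 'i) \<Rightarrow> 'i cop" where
  "shift_op f = cop_of (push f)"

lemma ap_shift_op: "inj f \<Longrightarrow> ap (shift_op f) = push f"
  unfolding shift_op_def by (rule cop_of_blin(2)[OF cip_pull, where K = 1]) auto

lemma ap_adj_shift_op: "inj f \<Longrightarrow> ap (adj (shift_op f)) = pull f"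
  unfolding shift_op_def by (rule ap_cop_of_adj[OF cip_pull, where K = 1]) auto

lemma push_ket: "inj f \<Longrightarrow> push f (ket i) = ket (f i)"
  by (rule ell2_eqI) (auto simp: coord_push coord_ket inj_eq)

lemma pull_ket: "inj f \<Longrightarrow> pull f (ket (f i)) = ket i"
  by (rule ell2_eqI) (simp add: coord_pull coord_ket inj_eq)

lemma pull_ket_notin: "inj f \<Longrightarrow> j \<notin> range f \<Longrightarrow> pull f (ket j) = 0"
  by (rule ell2_eqI) (auto simp: coord_pull coord_ket)

lemma shift_op_id [simp]: "shift_op id = 1"
  by (rule cop_eqI_ket; simp add: ap_shift_op push_ket)+

lemma shift_op_mult: "inj f \<Longrightarrow> inj g \<Longrightarrow> shift_op f * shift_op g = shift_op (f \<circ> g)"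
  by (rule cop_eqI_ket) (simp add: ap_shift_op push_ket inj_compose)

lemma adj_shift_op_same: "inj f \<Longrightarrow> adj (shift_op f) * shift_op f = 1"
  by (rule cop_eqI) (simp add: ap_shift_op ap_adj_shift_op pull_push)

lemma adj_shift_op_disjoint:
  assumes "inj f" "inj g" "range f \<inter> range g = {}"
  shows "adj (shift_op f) * shift_op g = 0"
proof (rule cop_eqI_ket)
  fix i
  have "g i \<notin> range f"
    using assms(3) by auto
  thus "ap (adj (shift_op f) * shift_op g) (ket i) = ap 0 (ket i)"
    using assms by (simp add: ap_shift_op ap_adj_shift_op push_ket pull_ket_notin)
qed

section \<open>Tensor products of vectors and operators\<close>

definition tv :: "'i ell2 \<Rightarrow> 'k ell2 \<Rightarrow> ('i \<times> 'k) ell2" where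
  "tv x y = Abs_ell2 (\<lambda>(i, k). coord x i * coord y k)"

text \<open>A vector over pairs is read as a matrix; an operator on the first factor acts on each
  column \<open>slice z k\<close> separately.\<close>

definition slice :: "('i \<times> 'k) ell2 \<Rightarrow> 'k \<Rightarrow> 'i ell2" where
  "slice z k = Abs_ell2 (\<lambda>i. coord z (i, k))"

definition amp_fun :: "'i cop \<Rightarrow> ('i \<times> 'k) ell2 \<Rightarrow> ('i \<times> 'k) ell2" where
  "amp_fun T z = Abs_ell2 (\<lambda>(i, k). coord (ap T (slice z k)) i)"

lemma summable_on_slices:
  assumes "\<And>k. (g k has_sum s k) UNIV" "s summable_on UNIV" "\<And>k i. 0 \<le> g k i"
  shows "(\<lambda>(i, k). g k i :: real) summable_on UNIV"
proof -
  have "(\<lambda>(k, i). g k i) summable_on (SIGMA k:UNIV. UNIV)"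
    by (rule summable_on_SigmaI[where g = s]) (use assms in auto)
  hence "(\<lambda>p. (\<lambda>(k, i). g k i) (prod.swap p)) summable_on UNIV"
    by (subst summable_on_reindex_bij_betw[where B = UNIV]) (auto simp: bij_swap)
  thus ?thesis
    by (simp add: case_prod_unfold)
qed

lemma coord_slice: "coord (slice z k) i = coord z (i, k)"
proof -
  have "(\<lambda>i. (cmod (coord z (i, k)))\<^sup>2) summable_on UNIV"
    using summable_on_subset_banach[OF coord_summable[of z] subset_UNIV, of "range (\<lambda>i. (i, k))"]
    by (subst (asm) summable_on_reindex) (auto simp: o_def inj_on_def)
  thus ?thesis
    unfolding slice_def by (rule coord_Abs_ell2)
qed

lemma inner_slice:
  fixes z w :: "('i \<times> 'k) ell2"
  shows "((\<lambda>k. inner (slice z k) (slice w k)) has_sum inner z w) UNIV"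
proof -
  have "((\<lambda>p. inner (coord z p) (coord w p)) has_sum inner z w) UNIV"
    unfolding inner_ell2_def by (rule has_sum_infsum[OF inner_summable])
  hence "((\<lambda>p. inner (coord z (prod.swap p)) (coord w (prod.swap p))) has_sum inner z w) (SIGMA k:UNIV. UNIV)"
    by (subst has_sum_reindex_bij_betw[where B = UNIV and g = prod.swap]) (auto simp: bij_swap)
  thus ?thesis
  proof (rule has_sum_SigmaD)
    show "((\<lambda>i. inner (coord z (prod.swap (k, i))) (coord w (prod.swap (k, i))))
        has_sum inner (slice z k) (slice w k)) UNIV" for k
      using has_sum_infsum[OF inner_summable[of "slice z k" "slice w k"]]
      by (simp add: coord_slice inner_ell2_def)
  qed
qed

lemma coord_amp_fun: "coord (amp_fun T z) (i, k) = coord (ap T (slice z k)) i"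
proof -
  have "(\<lambda>(i, k). (cmod (coord (ap T (slice z k)) i))\<^sup>2) summable_on UNIV"
  proof (rule summable_on_slices)
    show "((\<lambda>i. (cmod (coord (ap T (slice z k)) i))\<^sup>2) has_sum (norm (ap T (slice z k)))\<^sup>2) UNIV" for k
      unfolding norm_ell2_sq by (rule has_sum_infsum[OF coord_summable])
    show "(\<lambda>k. (norm (ap T (slice z k)))\<^sup>2) summable_on UNIV"
    proof (rule summable_on_comparison_test)
      show "(\<lambda>k. (norm T)\<^sup>2 * inner (slice z k) (slice z k)) summable_on UNIV"
        using inner_slice[of z z] by (intro summable_on_cmult_right) (auto simp: summable_on_def)
      show "(norm (ap T (slice z k)))\<^sup>2 \<le> (norm T)\<^sup>2 * inner (slice z k) (slice z k)" for k
        using norm_ap[of T "slice z k"]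
        by (simp add: power2_norm_eq_inner[symmetric] power_mult_distrib[symmetric] power_mono)
    qed auto
  qed auto
  hence "(\<lambda>p. (cmod (case p of (i, k) \<Rightarrow> coord (ap T (slice z k)) i))\<^sup>2) summable_on UNIV"
    by (simp add: case_prod_unfold)
  thus ?thesis
    unfolding amp_fun_def by (subst coord_Abs_ell2) auto
qed

lemma slice_amp_fun: "slice (amp_fun T z) k = ap T (slice z k)"
  by (rule ell2_eqI) (simp add: coord_slice coord_amp_fun)

lemma norm_amp_fun: "norm (amp_fun T z) \<le> norm T * norm z"
proof -
  have "(norm (amp_fun T z))\<^sup>2 \<le> (norm T)\<^sup>2 * (norm z)\<^sup>2"
  proof (rule has_sum_mono)
    show "((\<lambda>k. (norm (ap T (slice z k)))\<^sup>2) has_sum (norm (amp_fun T z))\<^sup>2) UNIV"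
      using inner_slice[of "amp_fun T z" "amp_fun T z"]
      by (simp add: slice_amp_fun power2_norm_eq_inner)
    show "((\<lambda>k. (norm T)\<^sup>2 * (norm (slice z k))\<^sup>2) has_sum (norm T)\<^sup>2 * (norm z)\<^sup>2) UNIV"
      using inner_slice[of z z] by (intro has_sum_cmult_right) (simp add: power2_norm_eq_inner)
    show "(norm (ap T (slice z k)))\<^sup>2 \<le> (norm T)\<^sup>2 * (norm (slice z k))\<^sup>2" for k
      using norm_ap[of T "slice z k"] by (simp add: power_mult_distrib[symmetric] power_mono)
  qed
  hence "(norm (amp_fun T z))\<^sup>2 \<le> (norm T * norm z)\<^sup>2"
    by (simp add: power_mult_distrib)
  thus ?thesis
    by (rule power2_le_imp_le) simp
qed

lemma cip_amp_fun: "cip (amp_fun (adj T) z) w = cip z (amp_fun T w)"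
proof -
  have *: "inner (amp_fun (adj T) z) w = inner z (amp_fun T w)" for z
  proof (rule has_sum_unique)
    show "((\<lambda>k. inner (slice (amp_fun (adj T) z) k) (slice w k)) has_sum inner (amp_fun (adj T) z) w) UNIV"
      by (rule inner_slice)
    show "((\<lambda>k. inner (slice (amp_fun (adj T) z) k) (slice w k)) has_sum inner z (amp_fun T w)) UNIV"
      using inner_slice[of z "amp_fun T w"] by (simp add: slice_amp_fun cip_adj flip: Re_cip)
  qed
  \<comment> \<open>The imaginary part of \<open>cip\<close> is a real inner product after scaling
    by \<i>, so commuting with \<i> settles it.\<close>
  have "\<i> *\<^sub>C amp_fun (adj T) z = amp_fun (adj T) (\<i> *\<^sub>C z)"
  proof (rule ell2_eqI)
    have sl: "slice (\<i> *\<^sub>C z) k = \<i> *\<^sub>C slice z k" for k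
      by (rule ell2_eqI) (simp add: coord_slice)
    show "coord (\<i> *\<^sub>C amp_fun (adj T) z) p = coord (amp_fun (adj T) (\<i> *\<^sub>C z)) p" for p
      by (cases p) (simp add: coord_amp_fun sl ap_cscale)
  qed
  thus ?thesis
    by (simp add: cip_def *)
qed

definition amp_left :: "'i cop \<Rightarrow> ('i \<times> 'k) cop" where
  "amp_left T = cop_of (amp_fun T)"

lemma ap_amp_left: "ap (amp_left T) = amp_fun T"
  unfolding amp_left_def by (rule cop_of_blin(2)[OF cip_amp_fun norm_amp_fun])

lemma adj_amp_left: "adj (amp_left T) = amp_left (adj T)"
  by (rule adj_unique) (simp add: ap_amp_left cip_amp_fun)

text \<open>Conjugation with the flip of the two factors reduces the right factor to the left
  one.\<close>

definition amp_right :: "'k cop \<Rightarrow> ('i \<times> 'k) cop" where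
  "amp_right U = cop_of (\<lambda>z. pull prod.swap (amp_fun U (pull prod.swap z)))"

lemma push_swap: "push prod.swap = pull prod.swap"
proof (intro ext ell2_eqI)
  fix x :: "('a \<times> 'b) ell2" and p
  have "inv_into UNIV prod.swap p = (prod.swap p :: 'a \<times> 'b)"
    by (rule inv_f_eq) auto
  thus "coord (push prod.swap x) p = coord (pull prod.swap x) p"
    by (simp add: coord_push coord_pull)
qed

lemma cip_amp_swap:
  fixes z w :: "('i \<times> 'k) ell2"
  shows "cip (pull prod.swap (amp_fun (adj U) (pull prod.swap z))) w =
    cip z (pull prod.swap (amp_fun U (pull prod.swap w)))"
  by (simp only: cip_pull[OF inj_swap] push_swap cip_amp_fun)

lemma norm_pull_swap: "norm (pull prod.swap z) = norm z"
  by (simp flip: push_swap)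

lemma norm_amp_swap: "norm (pull prod.swap (amp_fun U (pull prod.swap z))) \<le> norm U * norm z"
  using norm_amp_fun[of U "pull prod.swap z"] by (simp add: norm_pull_swap)

lemma ap_amp_right: "ap (amp_right U) = (\<lambda>z. pull prod.swap (amp_fun U (pull prod.swap z)))"
  unfolding amp_right_def by (rule cop_of_blin(2)[OF cip_amp_swap norm_amp_swap])

lemma adj_amp_right: "adj (amp_right U) = amp_right (adj U)"
  by (rule adj_unique) (simp add: ap_amp_right cip_amp_swap)

lemma norm_amp_left: "norm (amp_left T) \<le> norm T"
  by (rule norm_cop_le) (simp_all add: ap_amp_left norm_amp_fun)

lemma norm_amp_right: "norm (amp_right U) \<le> norm U"
  by (rule norm_cop_le) (simp_all add: ap_amp_right norm_amp_swap)

lemma coord_tv: "coord (tv x y) (i, k) = coord x i * coord y k"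
proof -
  have "(\<lambda>(i, k). (cmod (coord x i))\<^sup>2 * (cmod (coord y k))\<^sup>2) summable_on UNIV"
  proof (rule summable_on_slices)
    show "((\<lambda>i. (cmod (coord x i))\<^sup>2 * (cmod (coord y k))\<^sup>2) has_sum (norm x)\<^sup>2 * (cmod (coord y k))\<^sup>2) UNIV" for k
      unfolding norm_ell2_sq by (intro has_sum_cmult_left has_sum_infsum coord_summable)
    show "(\<lambda>k. (norm x)\<^sup>2 * (cmod (coord y k))\<^sup>2) summable_on UNIV"
      by (intro summable_on_cmult_right coord_summable)
  qed auto
  hence "(\<lambda>p. (cmod (case p of (i, k) \<Rightarrow> coord x i * coord y k))\<^sup>2) summable_on UNIV"
    by (simp add: case_prod_unfold norm_mult power_mult_distrib)
  thus ?thesis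
    unfolding tv_def by (subst coord_Abs_ell2) auto
qed

lemma tv_eqI: "(\<And>i k. coord z (i, k) = coord w (i, k)) \<Longrightarrow> z = w"
  by (rule ell2_eqI) auto

lemma tv_add: "tv (x + x') y = tv x y + tv x' y" "tv x (y + y') = tv x y + tv x y'"
  by (rule tv_eqI; simp add: coord_tv algebra_simps)+

lemma tv_cscale: "tv (c *\<^sub>C x) y = c *\<^sub>C tv x y" "tv x (c *\<^sub>C y) = c *\<^sub>C tv x y"
  by (rule tv_eqI; simp add: coord_tv)+

lemma tv_zero [simp]: "tv 0 y = 0" "tv x 0 = 0"
  by (rule tv_eqI; simp add: coord_tv)+

lemma tv_ket: "tv (ket i) (ket k) = ket (i, k)"
  by (rule tv_eqI) (auto simp: coord_tv coord_ket)

lemma cip_tv: "cip (tv x y) (tv x' y') = cip x x' * cip y y'"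
proof -
  have sl: "slice (tv x y) k = coord y k *\<^sub>C x" for x :: "'a ell2" and y :: "'b ell2" and k
    by (rule ell2_eqI) (simp add: coord_slice coord_tv)
  have *: "inner (tv x y) (tv x' y') = Re (cip x x' * cip y y')" for x
  proof -
    have "inner (slice (tv x y) k) (slice (tv x' y') k) = inner (coord y k) (coord (cip x x' *\<^sub>C y') k)" for k
      by (simp add: sl cip_cscale_left cip_cscale_right inner_complex_def algebra_simps flip: Re_cip)
    hence "inner (tv x y) (tv x' y') = inner y (cip x x' *\<^sub>C y')"
      using infsumI[OF inner_slice[of "tv x y" "tv x' y'"]] by (simp add: inner_ell2_def[of y])
    thus ?thesis
      by (simp only: cip_cscale_right flip: Re_cip)
  qed
  have "\<i> *\<^sub>C tv x y = tv (\<i> *\<^sub>C x) y"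
    by (simp add: tv_cscale)
  thus ?thesis
    using *[of x] *[of "\<i> *\<^sub>C x"] by (simp add: cip_def[of "tv x y"] complex_eq_iff cip_cscale_left)
qed

lemma norm_tv: "norm (tv x y) = norm x * norm y"
proof (rule power2_eq_imp_eq)
  have "complex_of_real ((norm (tv x y))\<^sup>2) = complex_of_real ((norm x * norm y)\<^sup>2)"
    by (simp only: cip_self[symmetric] cip_tv power_mult_distrib of_real_mult)
  thus "(norm (tv x y))\<^sup>2 = (norm x * norm y)\<^sup>2"
    by (simp only: of_real_eq_iff)
qed auto

text \<open>Defined as a product of amplifications, it is bounded and adjointable without further
  work. Its adjoint is again of this form because the two amplifications commute
  (\<open>amp_commute\<close>).\<close>

definition tens :: "'i cop \<Rightarrow> 'k cop \<Rightarrow> ('i \<times> 'k) cop" where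
  "tens T U = amp_left T * amp_right U"

lemma ap_tens_tv: "ap (tens T U) (tv x y) = tv (ap T x) (ap U y)"
proof -
  have amp: "amp_fun T (tv x y) = tv (ap T x) y" for T :: "'a cop" and x and y :: "'b ell2"
  proof (rule tv_eqI)
    have sl: "slice (tv x y) k = coord y k *\<^sub>C x" for k
      by (rule ell2_eqI) (simp add: coord_slice coord_tv)
    show "coord (amp_fun T (tv x y)) (i, k) = coord (tv (ap T x) y) (i, k)" for i k
      by (simp add: coord_amp_fun sl ap_cscale coord_tv)
  qed
  have amp': "amp_fun U (tv y x) = tv (ap U y) x" for x :: "'a ell2" and y
  proof (rule tv_eqI)
    have sl: "slice (tv y x) k = coord x k *\<^sub>C y" for k
      by (rule ell2_eqI) (simp add: coord_slice coord_tv)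
    show "coord (amp_fun U (tv y x)) (i, k) = coord (tv (ap U y) x) (i, k)" for i k
      by (simp add: coord_amp_fun sl ap_cscale coord_tv)
  qed
  have sw: "pull prod.swap (tv x y) = tv y x" for x :: "'a ell2" and y :: "'b ell2"
    by (rule tv_eqI) (simp add: coord_pull coord_tv)
  have sw': "pull prod.swap (tv y x) = tv x y" for x :: "'a ell2" and y :: "'b ell2"
    by (rule tv_eqI) (simp add: coord_pull coord_tv)
  show ?thesis
    by (simp add: tens_def ap_amp_left ap_amp_right amp amp' sw sw')
qed

lemma tens_eqI: "(\<And>i k. ap T (tv (ket i) (ket k)) = ap U (tv (ket i) (ket k))) \<Longrightarrow> T = U"
  by (rule cop_eqI_ket) (auto simp: tv_ket)

lemma tens_add: "tens (T + T') U = tens T U + tens T' U" "tens T (U + U') = tens T U + tens T U'"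
  by (rule tens_eqI; simp add: ap_tens_tv tv_add)+

lemma tens_cscale: "tens (c *\<^sub>C T) U = c *\<^sub>C tens T U" "tens T (c *\<^sub>C U) = c *\<^sub>C tens T U"
  by (rule tens_eqI; simp add: ap_tens_tv tv_cscale ap_cscale_left)+

lemma tens_zero [simp]: "tens 0 U = 0" "tens T 0 = 0"
  by (rule tens_eqI; simp add: ap_tens_tv)+

lemma tens_one [simp]: "tens 1 1 = 1"
  by (rule tens_eqI) (simp add: ap_tens_tv)

lemma tens_mult: "tens T U * tens T' U' = tens (T * T') (U * U')"
  by (rule tens_eqI) (simp add: ap_tens_tv)

lemma pull_swap_pull_swap: "pull prod.swap (pull prod.swap z) = z"
  by (rule tv_eqI) (simp add: coord_pull)

lemma amp_fun_one: "amp_fun 1 z = z"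
  by (rule tv_eqI) (simp add: coord_amp_fun coord_slice)

lemma amp_left_eq_tens: "amp_left T = tens T 1"
  by (rule cop_eqI) (simp add: tens_def ap_amp_right amp_fun_one pull_swap_pull_swap)

lemma amp_right_eq_tens: "amp_right U = tens 1 U"
  by (rule cop_eqI) (simp add: tens_def ap_amp_left amp_fun_one)

lemma amp_commute: "amp_right U * amp_left T = tens T U"
  by (rule tens_eqI) (simp add: amp_left_eq_tens amp_right_eq_tens ap_tens_tv)

lemma adj_tens: "adj (tens T U) = tens (adj T) (adj U)"
  by (simp add: tens_def[of T] adj_amp_left adj_amp_right amp_commute)

lemma norm_tens_le: "norm (tens T U) \<le> norm T * norm U"
  unfolding tens_def
  by (rule order_trans[OF norm_mult_ineq]) (intro mult_mono norm_amp_left norm_amp_right norm_ge_zero)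

lemma tens_sum: "tens (\<Sum>a\<in>A. f a) U = (\<Sum>a\<in>A. tens (f a) U)" "tens T (\<Sum>a\<in>A. g a) = (\<Sum>a\<in>A. tens T (g a))"
  by (induction A rule: infinite_finite_induct; simp add: tens_add)+

text \<open>This is why words over pairs of digits act as tensor products of words.\<close>

lemma tens_shift_op:
  assumes "inj f" "inj g"
  shows "tens (shift_op f) (shift_op g) = shift_op (map_prod f g)"
proof (rule tens_eqI)
  have "inj (map_prod f g)"
    using assms by (rule prod.inj_map)
  thus "ap (tens (shift_op f) (shift_op g)) (tv (ket i) (ket k)) = ap (shift_op (map_prod f g)) (tv (ket i) (ket k))" for i k
    using assms by (simp only: ap_tens_tv ap_shift_op push_ket) (simp add: tv_ket push_ket)
qed

lemma bounded_bilinear_tens: "bounded_bilinear tens"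
proof
  show "tens (r *\<^sub>R T) U = r *\<^sub>R tens T U" "tens T (r *\<^sub>R U) = r *\<^sub>R tens T U" for r and T :: "'i cop" and U :: "'k cop"
    by (simp_all add: tens_cscale flip: cscale_of_real)
  show "\<exists>K. \<forall>(T :: 'i cop) (U :: 'k cop). norm (tens T U) \<le> norm T * norm U * K"
    by (rule exI[of _ 1]) (simp add: norm_tens_le)
qed (rule tens_add)+

lemmas tendsto_tens = bounded_bilinear.tendsto[OF bounded_bilinear_tens]

section \<open>Models of completions\<close>

text \<open>A limit along the chosen representative. For additive and homogeneous maps bounded by
  the seminorm the choice does not matter (\<open>cpl_lift_limit\<close>).\<close>

definition cpl_lift :: "('a \<Rightarrow> 'v::cbanach) \<Rightarrow> (nat \<Rightarrow> 'a) set \<Rightarrow> 'v" where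
  "cpl_lift f S = lim (\<lambda>n. f (class_repr S n))"

text \<open>No vector space law is asked of \<open>M\<close>; the laws hold for the images under j,
  and j determines the seminorm.\<close>

locale norm_model =
  fixes M :: "(complex, 'a, 'm) module_scheme" and nrm :: "'a \<Rightarrow> real" and j :: "'a \<Rightarrow> 'v::cbanach"
  assumes add_closed: "x \<in> carrier M \<Longrightarrow> y \<in> carrier M \<Longrightarrow> x \<oplus>\<^bsub>M\<^esub> y \<in> carrier M"
    and smult_closed: "x \<in> carrier M \<Longrightarrow> c \<odot>\<^bsub>M\<^esub> x \<in> carrier M"
    and j_add: "x \<in> carrier M \<Longrightarrow> y \<in> carrier M \<Longrightarrow> j (x \<oplus>\<^bsub>M\<^esub> y) = j x + j y"
    and j_smult: "x \<in> carrier M \<Longrightarrow> j (c \<odot>\<^bsub>M\<^esub> x) = c *\<^sub>C j x"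
    and nrm_j: "x \<in> carrier M \<Longrightarrow> nrm x = norm (j x)"
begin

abbreviation "rel \<equiv> completion_rel M nrm"
abbreviation "cs \<equiv> cauchy_seqs M nrm"

lemma vdiff_closed: "x \<in> carrier M \<Longrightarrow> y \<in> carrier M \<Longrightarrow> vdiff M x y \<in> carrier M"
  by (simp add: vdiff_def add_closed smult_closed)

lemma nrm_vdiff: "x \<in> carrier M \<Longrightarrow> y \<in> carrier M \<Longrightarrow> nrm (vdiff M x y) = norm (j x - j y)"
  by (subst nrm_j) (simp_all add: vdiff_closed, simp add: vdiff_def j_add j_smult smult_closed)

lemma cauchy_seqs_iff: "X \<in> cs \<longleftrightarrow> (\<forall>n. X n \<in> carrier M) \<and> Cauchy (\<lambda>n. j (X n))"
  by (auto simp: cauchy_seqs_def Cauchy_def dist_norm nrm_vdiff)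

lemma cs_limit:
  assumes "X \<in> cs"
  shows "(\<lambda>n. j (X n)) \<longlonglongrightarrow> lim (\<lambda>n. j (X n))"
  using assms by (simp add: cauchy_seqs_iff Cauchy_convergent_iff convergent_LIMSEQ_iff)

text \<open>Seen through j, equivalence of Cauchy sequences is equality of limits, hence visibly an
  equivalence relation.\<close>

lemma rel_iff: "(X, Y) \<in> rel \<longleftrightarrow> X \<in> cs \<and> Y \<in> cs \<and> lim (\<lambda>n. j (X n)) = lim (\<lambda>n. j (Y n))"
proof (cases "X \<in> cs \<and> Y \<in> cs")
  case True
  hence "(\<lambda>n. nrm (vdiff M (X n) (Y n))) = (\<lambda>n. norm (j (X n) - j (Y n)))"
    by (auto simp: cauchy_seqs_iff nrm_vdiff)
  moreover have "(\<lambda>n. norm (j (X n) - j (Y n))) \<longlonglongrightarrow> norm (lim (\<lambda>n. j (X n)) - lim (\<lambda>n. j (Y n)))"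
    using True by (intro tendsto_norm tendsto_diff cs_limit) auto
  ultimately show ?thesis
    using True LIMSEQ_unique by (fastforce simp: completion_rel_def)
qed (auto simp: completion_rel_def)

lemma class_repr_in:
  assumes "X \<in> cs"
  shows "(X, class_repr (rel `` {X})) \<in> rel"
proof -
  have "X \<in> rel `` {X}"
    using assms by (simp add: rel_iff)
  hence "class_repr (rel `` {X}) \<in> rel `` {X}"
    unfolding class_repr_def by (rule someI[of "\<lambda>Y. Y \<in> rel `` {X}"])
  thus ?thesis by simp
qed

lemma class_in: "X \<in> cs \<Longrightarrow> rel `` {X} \<in> cs // rel"
  by (rule quotientI)

lemma class_eq: "(X, Y) \<in> rel \<Longrightarrow> rel `` {X} = rel `` {Y}"
  by (auto simp: rel_iff)

lemma class_elim:
  assumes "S \<in> cs // rel"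
  shows "class_repr S \<in> cs" "S = rel `` {class_repr S}"
proof -
  from assms obtain X where X: "X \<in> cs" "S = rel `` {X}"
    by (rule quotientE)
  show "class_repr S \<in> cs"
    using class_repr_in[OF X(1)] X(2) by (simp add: rel_iff)
  show "S = rel `` {class_repr S}"
    using class_eq[OF class_repr_in[OF X(1)]] X(2) by simp
qed

text \<open>These maps extend to the completion just as j does. Representations other than the one
  that models the algebra enter in this way.\<close>

definition contr_map :: "('a \<Rightarrow> 'w::cbanach) \<Rightarrow> bool" where
  "contr_map f \<longleftrightarrow> (\<forall>x\<in>carrier M. \<forall>y\<in>carrier M. f (x \<oplus>\<^bsub>M\<^esub> y) = f x + f y) \<and>
     (\<forall>c. \<forall>x\<in>carrier M. f (c \<odot>\<^bsub>M\<^esub> x) = c *\<^sub>C f x) \<and> (\<forall>x\<in>carrier M. norm (f x) \<le> nrm x)"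

lemma contr_map_j: "contr_map j"
  by (simp add: contr_map_def j_add j_smult nrm_j)

lemma contr_map_diff:
  assumes "contr_map f" "x \<in> carrier M" "y \<in> carrier M"
  shows "norm (f x - f y) \<le> norm (j x - j y)"
proof -
  have "f (vdiff M x y) = f x - f y"
    using assms by (simp add: vdiff_def contr_map_def smult_closed)
  moreover have "norm (f (vdiff M x y)) \<le> nrm (vdiff M x y)"
    using assms by (simp add: contr_map_def vdiff_closed)
  ultimately show ?thesis
    using assms by (simp add: nrm_vdiff)
qed

text \<open>A contractive map sends Cauchy sequences to Cauchy sequences and equivalent ones to
  sequences with the same limit.\<close>

lemma cpl_lift_limit:
  assumes f: "contr_map f" and X: "X \<in> cs"
  shows "(\<lambda>n. f (X n)) \<longlonglongrightarrow> cpl_lift f (rel `` {X})"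
proof -
  define Y where "Y = class_repr (rel `` {X})"
  have XY: "(X, Y) \<in> rel"
    unfolding Y_def by (rule class_repr_in[OF X])
  hence carr: "X n \<in> carrier M" "Y n \<in> carrier M" for n
    by (simp_all add: rel_iff cauchy_seqs_iff)
  have "Cauchy (\<lambda>n. f (Y n))"
    unfolding Cauchy_def dist_norm
  proof (intro allI impI)
    fix e :: real assume "e > 0"
    moreover have "Cauchy (\<lambda>n. j (Y n))"
      using XY by (simp add: rel_iff cauchy_seqs_iff)
    ultimately obtain N where "\<forall>m\<ge>N. \<forall>n\<ge>N. norm (j (Y m) - j (Y n)) < e"
      unfolding Cauchy_def dist_norm by blast
    thus "\<exists>N. \<forall>m\<ge>N. \<forall>n\<ge>N. norm (f (Y m) - f (Y n)) < e"
      using contr_map_diff[OF f] carr by (meson order_le_less_trans)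
  qed
  hence lim: "(\<lambda>n. f (Y n)) \<longlonglongrightarrow> cpl_lift f (rel `` {X})"
    by (simp add: cpl_lift_def Y_def Cauchy_convergent_iff convergent_LIMSEQ_iff)
  have "(\<lambda>n. j (X n) - j (Y n)) \<longlonglongrightarrow> lim (\<lambda>n. j (X n)) - lim (\<lambda>n. j (Y n))"
    using XY by (intro tendsto_diff cs_limit) (simp_all add: rel_iff)
  hence "(\<lambda>n. norm (j (X n) - j (Y n))) \<longlonglongrightarrow> 0"
    using XY by (simp add: rel_iff tendsto_norm_zero)
  hence "(\<lambda>n. f (X n) - f (Y n)) \<longlonglongrightarrow> 0"
    by (rule Lim_null_comparison[rotated]) (use contr_map_diff[OF f] carr in auto)
  from tendsto_add[OF this lim] show ?thesis
    by simp
qed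

lemma J_class: "X \<in> cs \<Longrightarrow> cpl_lift j (rel `` {X}) = lim (\<lambda>n. j (X n))"
  using cpl_lift_limit[OF contr_map_j] cs_limit LIMSEQ_unique by blast

lemma inj_on_J: "inj_on (cpl_lift j) (cs // rel)"
proof (rule inj_onI)
  fix S T assume ST: "S \<in> cs // rel" "T \<in> cs // rel" "cpl_lift j S = cpl_lift j T"
  hence "(class_repr S, class_repr T) \<in> rel"
    using class_elim[OF ST(1)] class_elim[OF ST(2)] by (simp add: rel_iff cpl_lift_def)
  thus "S = T"
    using class_eq class_elim(2)[OF ST(1)] class_elim(2)[OF ST(2)] by metis
qed

text \<open>A point of the closure is a limit of images of some sequence in \<open>M\<close>;
  convergence makes that sequence Cauchy, and its class is the preimage.\<close>

lemma image_J: "cpl_lift j ` (cs // rel) = closure (j ` carrier M)"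
proof (intro equalityI subsetI)
  fix v assume "v \<in> cpl_lift j ` (cs // rel)"
  then obtain S where S: "S \<in> cs // rel" "v = cpl_lift j S"
    by blast
  have "\<forall>n. j (class_repr S n) \<in> j ` carrier M" "(\<lambda>n. j (class_repr S n)) \<longlonglongrightarrow> v"
    using cs_limit[OF class_elim(1)[OF S(1)]] class_elim(1)[OF S(1)] S(2)
    by (auto simp: cpl_lift_def cauchy_seqs_iff)
  thus "v \<in> closure (j ` carrier M)"
    unfolding closure_sequential by (intro exI[of _ "\<lambda>n. j (class_repr S n)"]) blast
next
  fix v assume "v \<in> closure (j ` carrier M)"
  then obtain V where V: "\<forall>n. V n \<in> j ` carrier M" "V \<longlonglongrightarrow> v"
    unfolding closure_sequential by blast
  then obtain X where X: "\<And>n. X n \<in> carrier M" "\<And>n. V n = j (X n)"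
    unfolding image_iff by metis
  have conv: "(\<lambda>n. j (X n)) \<longlonglongrightarrow> v"
    using V(2) by (simp only: X(2)[symmetric])
  hence "X \<in> cs"
    using X(1) by (auto simp: cauchy_seqs_iff intro: LIMSEQ_imp_Cauchy)
  thus "v \<in> cpl_lift j ` (cs // rel)"
    using conv J_class class_in limI by (intro image_eqI[of _ _ "rel `` {X}"]) auto
qed

lemma const_cs: "x \<in> carrier M \<Longrightarrow> (\<lambda>_. x) \<in> cs"
  by (simp add: cauchy_seqs_iff LIMSEQ_imp_Cauchy[OF tendsto_const])

lemma cpl_lift_const:
  assumes "contr_map f" "x \<in> carrier M"
  shows "cpl_lift f (rel `` {\<lambda>_. x}) = f x"
  using cpl_lift_limit[OF assms(1) const_cs[OF assms(2)]] LIMSEQ_unique tendsto_const by blast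

text \<open>\<open>G\<close> is the operation seen through j and shows that the result is a Cauchy
  sequence; \<open>H\<close> is the operation seen through f and computes the value.\<close>

lemma lift_binary:
  assumes F: "\<And>x y. x \<in> carrier M \<Longrightarrow> y \<in> carrier M \<Longrightarrow> F x y \<in> carrier M"
    and G: "\<And>x y. x \<in> carrier M \<Longrightarrow> y \<in> carrier M \<Longrightarrow> j (F x y) = G (j x) (j y)"
    and G_cont: "\<And>V W v w. V \<longlonglongrightarrow> v \<Longrightarrow> W \<longlonglongrightarrow> w \<Longrightarrow> (\<lambda>n. G (V n) (W n)) \<longlonglongrightarrow> G v w"
    and f: "contr_map f"
    and H: "\<And>x y. x \<in> carrier M \<Longrightarrow> y \<in> carrier M \<Longrightarrow> f (F x y) = H (f x) (f y)"
    and H_cont: "\<And>V W v w. V \<longlonglongrightarrow> v \<Longrightarrow> W \<longlonglongrightarrow> w \<Longrightarrow> (\<lambda>n. H (V n) (W n)) \<longlonglongrightarrow> H v w"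
    and ST: "S \<in> cs // rel" "T \<in> cs // rel"
  shows "lift_binary rel F S T \<in> cs // rel" "cpl_lift f (lift_binary rel F S T) = H (cpl_lift f S) (cpl_lift f T)"
proof -
  define Z where "Z = (\<lambda>n. F (class_repr S n) (class_repr T n))"
  have carr: "class_repr S n \<in> carrier M" "class_repr T n \<in> carrier M" for n
    using class_elim(1)[OF ST(1)] class_elim(1)[OF ST(2)] by (auto simp: cauchy_seqs_iff)
  have "(\<lambda>n. j (Z n)) \<longlonglongrightarrow> G (lim (\<lambda>n. j (class_repr S n))) (lim (\<lambda>n. j (class_repr T n)))"
    unfolding Z_def G[OF carr] by (intro G_cont cs_limit class_elim ST)
  hence Z: "Z \<in> cs"
    using carr F by (auto simp: cauchy_seqs_iff Z_def intro: LIMSEQ_imp_Cauchy)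
  thus "lift_binary rel F S T \<in> cs // rel"
    unfolding lift_binary_def Z_def[symmetric] by (rule class_in)
  have "(\<lambda>n. f (Z n)) \<longlonglongrightarrow> H (cpl_lift f S) (cpl_lift f T)"
    unfolding Z_def H[OF carr]
    using cpl_lift_limit[OF f class_elim(1)[OF ST(1)]] cpl_lift_limit[OF f class_elim(1)[OF ST(2)]]
      class_elim(2)[OF ST(1)] class_elim(2)[OF ST(2)]
    by (intro H_cont) auto
  thus "cpl_lift f (lift_binary rel F S T) = H (cpl_lift f S) (cpl_lift f T)"
    unfolding lift_binary_def Z_def[symmetric]
    using cpl_lift_limit[OF f Z] LIMSEQ_unique by blast
qed

lemma lift_unary:
  assumes F: "\<And>x. x \<in> carrier M \<Longrightarrow> F x \<in> carrier M"
    and G: "\<And>x. x \<in> carrier M \<Longrightarrow> j (F x) = G (j x)"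
    and G_cont: "\<And>V v. V \<longlonglongrightarrow> v \<Longrightarrow> (\<lambda>n. G (V n)) \<longlonglongrightarrow> G v"
    and f: "contr_map f"
    and H: "\<And>x. x \<in> carrier M \<Longrightarrow> f (F x) = H (f x)"
    and H_cont: "\<And>V v. V \<longlonglongrightarrow> v \<Longrightarrow> (\<lambda>n. H (V n)) \<longlonglongrightarrow> H v"
    and S: "S \<in> cs // rel"
  shows "lift_unary rel F S \<in> cs // rel" "cpl_lift f (lift_unary rel F S) = H (cpl_lift f S)"
proof -
  have eq: "lift_unary rel F S = lift_binary rel (\<lambda>x _. F x) S S"
    by (simp add: lift_unary_def lift_binary_def)
  show "lift_unary rel F S \<in> cs // rel"
    unfolding eq
    by (rule lift_binary(1)[where G = "\<lambda>x _. G x" and f = f and H = "\<lambda>x _. H x"]) (use assms in auto)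
  show "cpl_lift f (lift_unary rel F S) = H (cpl_lift f S)"
    unfolding eq
    by (rule lift_binary(2)[where G = "\<lambda>x _. G x" and f = f and H = "\<lambda>x _. H x"]) (use assms in auto)
qed

lemma cpl_add:
  assumes "contr_map f" "S \<in> cs // rel" "T \<in> cs // rel"
  shows "lift_binary rel (add M) S T \<in> cs // rel"
    "cpl_lift f (lift_binary rel (add M) S T) = cpl_lift f S + cpl_lift f T"
  by (rule lift_binary[where G = "(+)" and H = "(+)" and f = f];
      use assms in \<open>auto simp: add_closed j_add contr_map_def intro: tendsto_add\<close>)+

lemma cpl_smult:
  assumes "contr_map f" "S \<in> cs // rel"
  shows "lift_unary rel (smult M c) S \<in> cs // rel"
    "cpl_lift f (lift_unary rel (smult M c) S) = c *\<^sub>C cpl_lift f S"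
  by (rule lift_unary[where G = "cscale c" and H = "cscale c" and f = f];
      use assms in \<open>auto simp: smult_closed j_smult contr_map_def intro: tendsto_cscale\<close>)+

lemma cpl_norm:
  assumes "S \<in> cs // rel"
  shows "lim (\<lambda>n. nrm (class_repr S n)) = norm (cpl_lift j S)"
proof -
  have "(\<lambda>n. nrm (class_repr S n)) = (\<lambda>n. norm (j (class_repr S n)))"
    using class_elim(1)[OF assms] by (auto simp: cauchy_seqs_iff nrm_j)
  moreover have "\<dots> \<longlonglongrightarrow> norm (cpl_lift j S)"
    unfolding cpl_lift_def by (intro tendsto_norm cs_limit class_elim(1) assms)
  ultimately show ?thesis
    by (simp add: limI)
qed

lemma norm_cpl_lift_le:
  assumes "contr_map f" "S \<in> cs // rel"
  shows "norm (cpl_lift f S) \<le> norm (cpl_lift j S)"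
proof (rule LIMSEQ_le)
  show "(\<lambda>n. norm (f (class_repr S n))) \<longlonglongrightarrow> norm (cpl_lift f S)"
    "(\<lambda>n. norm (j (class_repr S n))) \<longlonglongrightarrow> norm (cpl_lift j S)"
    using cpl_lift_limit[OF assms(1) class_elim(1)[OF assms(2)]]
      cpl_lift_limit[OF contr_map_j class_elim(1)[OF assms(2)]] class_elim(2)[OF assms(2)]
    by (auto intro: tendsto_norm)
  have "norm (f (class_repr S n)) \<le> norm (j (class_repr S n))" for n
    using assms(1) class_elim(1)[OF assms(2)] by (auto simp: contr_map_def cauchy_seqs_iff nrm_j)
  thus "\<exists>N. \<forall>n\<ge>N. norm (f (class_repr S n)) \<le> norm (j (class_repr S n))"
    by blast
qed

lemma csubspace_range:
  assumes "x\<^sub>0 \<in> carrier M"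
  shows "csubspace (j ` carrier M)"
  unfolding csubspace_def
proof (intro conjI ballI allI)
  \<comment> \<open>The model does not constrain the zero of \<open>M\<close>, so a zero multiple of
    an arbitrary element takes its place.\<close>
  show "0 \<in> j ` carrier M"
    using j_smult[OF assms, of 0] by (intro image_eqI[of _ _ "0 \<odot>\<^bsub>M\<^esub> x\<^sub>0"]) (simp_all add: smult_closed assms)
  show "u + v \<in> j ` carrier M" if uv: "u \<in> j ` carrier M" "v \<in> j ` carrier M" for u v
  proof -
    obtain x y where "x \<in> carrier M" "y \<in> carrier M" "u = j x" "v = j y"
      using uv by blast
    thus ?thesis
      by (intro image_eqI[of _ _ "x \<oplus>\<^bsub>M\<^esub> y"]) (simp_all add: j_add add_closed)
  qed
  show "c *\<^sub>C u \<in> j ` carrier M" if u: "u \<in> j ` carrier M" for c u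
  proof -
    obtain x where "x \<in> carrier M" "u = j x"
      using u by blast
    thus ?thesis
      by (intro image_eqI[of _ _ "c \<odot>\<^bsub>M\<^esub> x"]) (simp_all add: j_smult smult_closed)
  qed
qed

end

section \<open>Star-algebras of operators and their completions\<close>

definition contr_hom :: "'a star_alg \<Rightarrow> ('a \<Rightarrow> 'i cop) \<Rightarrow> bool" where
  "contr_hom A f \<longleftrightarrow>
     (\<forall>x\<in>carrier A. \<forall>y\<in>carrier A. f (x \<oplus>\<^bsub>A\<^esub> y) = f x + f y \<and> f (x \<otimes>\<^bsub>A\<^esub> y) = f x * f y) \<and>
     (\<forall>c. \<forall>x\<in>carrier A. f (c \<odot>\<^bsub>A\<^esub> x) = c *\<^sub>C f x) \<and>
     (\<forall>x\<in>carrier A. f (invol A x) = adj (f x) \<and> norm (f x) \<le> anorm A x) \<and>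
     f \<one>\<^bsub>A\<^esub> = 1"

locale star_model =
  fixes A :: "'a star_alg" and j :: "'a \<Rightarrow> 'i cop"
  assumes plus_closed: "x \<in> carrier A \<Longrightarrow> y \<in> carrier A \<Longrightarrow> x \<oplus>\<^bsub>A\<^esub> y \<in> carrier A"
    and scale_closed: "x \<in> carrier A \<Longrightarrow> c \<odot>\<^bsub>A\<^esub> x \<in> carrier A"
    and mult_closed: "x \<in> carrier A \<Longrightarrow> y \<in> carrier A \<Longrightarrow> x \<otimes>\<^bsub>A\<^esub> y \<in> carrier A"
    and invol_closed: "x \<in> carrier A \<Longrightarrow> invol A x \<in> carrier A"
    and one_closed: "\<one>\<^bsub>A\<^esub> \<in> carrier A"
    and hom: "contr_hom A j"
    and norm: "x \<in> carrier A \<Longrightarrow> anorm A x = norm (j x)"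
begin

sublocale norm_model A "anorm A" j
  using hom by unfold_locales (auto simp: plus_closed scale_closed norm contr_hom_def)

lemma contr_hom_map: "contr_hom A f \<Longrightarrow> contr_map f"
  by (simp add: contr_hom_def contr_map_def)

lemma completion_sel:
  "carrier (alg_completion A) = cs // rel"
  "mult (alg_completion A) = lift_binary rel (mult A)"
  "one (alg_completion A) = rel `` {\<lambda>_. \<one>\<^bsub>A\<^esub>}"
  "add (alg_completion A) = lift_binary rel (add A)"
  "smult (alg_completion A) c = lift_unary rel (smult A c)"
  "invol (alg_completion A) = lift_unary rel (invol A)"
  "anorm (alg_completion A) S = lim (\<lambda>n. anorm A (class_repr S n))"
  by (simp_all add: alg_completion_def Let_def)

lemma cls_in: "x \<in> carrier A \<Longrightarrow> rel `` {\<lambda>_. x} \<in> carrier (alg_completion A)"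
  by (simp add: completion_sel class_in const_cs)

lemma cpl_lift_cls: "contr_hom A f \<Longrightarrow> x \<in> carrier A \<Longrightarrow> cpl_lift f (rel `` {\<lambda>_. x}) = f x"
  by (rule cpl_lift_const[OF contr_hom_map])

lemma ops:
  assumes f: "contr_hom A f" and S: "S \<in> cs // rel" "T \<in> cs // rel"
  shows "lift_binary rel (add A) S T \<in> cs // rel"
    "cpl_lift f (lift_binary rel (add A) S T) = cpl_lift f S + cpl_lift f T"
    "lift_binary rel (mult A) S T \<in> cs // rel"
    "cpl_lift f (lift_binary rel (mult A) S T) = cpl_lift f S * cpl_lift f T"
    "lift_unary rel (smult A c) S \<in> cs // rel"
    "cpl_lift f (lift_unary rel (smult A c) S) = c *\<^sub>C cpl_lift f S"
    "lift_unary rel (invol A) S \<in> cs // rel"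
    "cpl_lift f (lift_unary rel (invol A) S) = adj (cpl_lift f S)"
proof -
  note h = f[unfolded contr_hom_def] hom[unfolded contr_hom_def]
  show "lift_binary rel (add A) S T \<in> cs // rel"
    "cpl_lift f (lift_binary rel (add A) S T) = cpl_lift f S + cpl_lift f T"
    by (rule cpl_add[OF contr_hom_map[OF f] S])+
  show "lift_binary rel (mult A) S T \<in> cs // rel"
    "cpl_lift f (lift_binary rel (mult A) S T) = cpl_lift f S * cpl_lift f T"
    by (rule lift_binary[where G = "(*)" and H = "(*)" and f = f];
        use h S contr_hom_map[OF f] mult_closed in \<open>auto intro: tendsto_mult\<close>)+
  show "lift_unary rel (smult A c) S \<in> cs // rel"
    "cpl_lift f (lift_unary rel (smult A c) S) = c *\<^sub>C cpl_lift f S"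
    by (rule cpl_smult[OF contr_hom_map[OF f] S(1)])+
  show "lift_unary rel (invol A) S \<in> cs // rel"
    "cpl_lift f (lift_unary rel (invol A) S) = adj (cpl_lift f S)"
    by (rule lift_unary[where G = adj and H = adj and f = f];
        use h S contr_hom_map[OF f] invol_closed in \<open>auto intro: tendsto_adj\<close>)+
qed

lemma contr_hom_completion:
  assumes f: "contr_hom A f"
  shows "contr_hom (alg_completion A) (cpl_lift f)"
  using f unfolding contr_hom_def completion_sel
  by (auto simp: ops[OF f] cpl_norm norm_cpl_lift_le[OF contr_hom_map[OF f]]
      cpl_lift_const[OF contr_hom_map[OF f]] one_closed)

text \<open>The completion satisfies the same locale, so models can be stacked: matrices lead to a
  UHF algebra, and formal tensors over two of these to the C*-tensor product.\<close>

lemma star_model_completion: "star_model (alg_completion A) (cpl_lift j)"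
  by unfold_locales
    (simp_all add: contr_hom_completion[OF hom], simp_all add: completion_sel ops[OF hom] cpl_norm class_in const_cs one_closed)

lemma inj_on_completion: "inj_on (cpl_lift j) (carrier (alg_completion A))"
  by (simp add: completion_sel inj_on_J)

lemma image_completion: "cpl_lift j ` carrier (alg_completion A) = closure (j ` carrier A)"
  by (simp add: completion_sel image_J)

end

section \<open>Representations of UHF algebras of constant type\<close>

text \<open>Division with remainder by q; on matrix indices it splits off the last tensor
  factor.\<close>

lemma sum_digits: "(\<Sum>i<N * q. f i) = (\<Sum>i<N. \<Sum>r<q. f (i * q + r))" for f :: "nat \<Rightarrow> 'a::comm_monoid_add"
proof -
  have "sum f {m * q..<m * q + q} = (\<Sum>r<q. f (m * q + r))" for m
    by (rule sum.reindex_bij_witness[of _ "\<lambda>r. m * q + r" "\<lambda>i. i - m * q"]) auto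
  thus ?thesis
    by (simp flip: sum.nat_group)
qed

lemma has_sum_sum:
  fixes f :: "'a \<Rightarrow> 'b \<Rightarrow> 'c::topological_comm_monoid_add"
  assumes "\<And>a. a \<in> A \<Longrightarrow> (f a has_sum s a) B"
  shows "((\<lambda>x. \<Sum>a\<in>A. f a x) has_sum (\<Sum>a\<in>A. s a)) B"
  using assms by (induction A rule: infinite_finite_induct) (auto intro!: has_sum_add)

text \<open>A base q numeral with the most significant digit first, in agreement with the index
  order of \<open>kron\<close>.\<close>

primrec digit_index :: "nat \<Rightarrow> (nat \<Rightarrow> nat) \<Rightarrow> nat \<Rightarrow> nat" where
  "digit_index q \<delta> 0 = 0"
| "digit_index q \<delta> (Suc n) = digit_index q \<delta> n * q + \<delta> n"

lemma digit_index_less: "(\<And>i. i < n \<Longrightarrow> \<delta> i < q) \<Longrightarrow> digit_index q \<delta> n < q ^ n"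
proof (induction n)
  case (Suc n)
  hence "digit_index q \<delta> n + 1 \<le> q ^ n" "\<delta> n < q"
    by (simp_all add: Suc_leI)
  hence "(digit_index q \<delta> n + 1) * q \<le> q ^ n * q"
    by (intro mult_right_mono) auto
  thus ?case
    using \<open>\<delta> n < q\<close> by (simp add: algebra_simps)
qed simp

lemma digit_index_cong: "(\<And>i. i < n \<Longrightarrow> \<delta> i = \<epsilon> i) \<Longrightarrow> digit_index q \<delta> n = digit_index q \<epsilon> n"
  by (induction n) auto

lemma digit_index_surj:
  assumes "k < q ^ n"
  shows "\<exists>\<delta>. (\<forall>i<n. \<delta> i < q) \<and> digit_index q \<delta> n = k"
  using assms
proof (induction n arbitrary: k)
  case (Suc n)
  from Suc.prems have "q > 0"
    by (cases q) auto
  from Suc.prems have "k div q < q ^ n"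
    by (simp add: less_mult_imp_div_less mult.commute)
  then obtain \<delta> where \<delta>: "\<forall>i<n. \<delta> i < q" "digit_index q \<delta> n = k div q"
    using Suc.IH by blast
  \<comment> \<open>Only the digits before position n matter here, so digit n is free to be the
    remainder.\<close>
  have "digit_index q (\<delta>(n := k mod q)) n = k div q"
    using \<delta>(2) by (subst digit_index_cong[of n _ \<delta>]) auto
  thus ?case
    using \<delta>(1) \<open>q > 0\<close>
    by (intro exI[of _ "\<delta>(n := k mod q)"]) (auto simp: less_Suc_eq simp del: fun_upd_apply, auto)
qed simp

lemma uhf_size_const: "uhf_size (\<lambda>_. q) n = q ^ n"
  by (simp add: uhf_size_def)

lemma kron_matrix_unit:
  assumes "r < q" "s < q"
  shows "kron (matrix_unit m i k) (matrix_unit q r s) = matrix_unit (m * q) (i * q + r) (k * q + s)"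
proof (rule eq_matI)
  fix a b assume "a < dim_row (matrix_unit (m * q) (i * q + r) (k * q + s))"
    "b < dim_col (matrix_unit (m * q) (i * q + r) (k * q + s))"
  hence ab: "a < m * q" "b < m * q"
    by (simp_all add: matrix_unit_def)
  have eq: "(a = i * q + r) \<longleftrightarrow> a div q = i \<and> a mod q = r" if "r < q" for a i r
    using that by (metis add.commute div_mult_mod_eq div_mult_self1_is_m div_mult_self3 mod_less mod_mult_self3
        div_less add_0 less_nat_zero_code not_gr_zero mod_mult_self1)
  show "kron (matrix_unit m i k) (matrix_unit q r s) $$ (a, b) = matrix_unit (m * q) (i * q + r) (k * q + s) $$ (a, b)"
    using ab assms by (auto simp: kron_def matrix_unit_def less_mult_imp_div_less eq)
qed (simp_all add: kron_def matrix_unit_def)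

lemma unit_tensor_const:
  assumes "\<And>i. i < n \<Longrightarrow> \<delta> i < q" "\<And>i. i < n \<Longrightarrow> \<epsilon> i < q"
  shows "unit_tensor (\<lambda>_. q) \<delta> \<epsilon> n = matrix_unit (q ^ n) (digit_index q \<delta> n) (digit_index q \<epsilon> n)"
  using assms
proof (induction n)
  case 0
  show ?case
    by (rule eq_matI) (auto simp: matrix_unit_def)
next
  case (Suc n)
  thus ?case
    by (simp add: kron_matrix_unit mult.commute)
qed

lemma mat_adjoint_index:
  "X \<in> carrier_mat m m \<Longrightarrow> i < m \<Longrightarrow> k < m \<Longrightarrow> mat_adjoint X $$ (i, k) = cnj (X $$ (k, i))"
  by (auto simp: mat_adjoint_def mat_of_rows_index conjugate_complex_def)

lemma mat_adjoint_carrier: "X \<in> carrier_mat m m \<Longrightarrow> mat_adjoint X \<in> carrier_mat m m"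
  by (auto simp: mat_adjoint_def)

text \<open>
  The maps \<open>d 0, \<dots>, d (q - 1)\<close> play the role of the isometries of the Cuntz algebra: the algebra
  of the \<open>n\<close>-th level is spanned by the products of a word of length \<open>n\<close> and an adjoint of such a word.
\<close>

locale digit_maps =
  fixes q :: nat and d :: "nat \<Rightarrow> 'i \<Rightarrow> 'i"
  assumes d_inj: "r < q \<Longrightarrow> inj (d r)"
    and d_disj: "r < q \<Longrightarrow> s < q \<Longrightarrow> r \<noteq> s \<Longrightarrow> range (d r) \<inter> range (d s) = {}"
    and d_cover: "\<exists>r<q. u \<in> range (d r)"
begin

lemma q_pos: "0 < q"
  using d_cover by (metis gr_zeroI less_nat_zero_code)

text \<open>The last digit acts first; appending a digit to k is therefore composition on the
  inside, which shrinks the range.\<close>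

primrec wmap :: "nat \<Rightarrow> nat \<Rightarrow> 'i \<Rightarrow> 'i" where
  "wmap 0 k = id"
| "wmap (Suc n) k = wmap n (k div q) \<circ> d (k mod q)"

abbreviation "V n k \<equiv> shift_op (wmap n k)"

definition mu :: "nat \<Rightarrow> nat \<Rightarrow> nat \<Rightarrow> 'i cop" where
  "mu n i k = V n i * adj (V n k)"

lemma wmap_inj: "inj (wmap n k)"
  by (induction n arbitrary: k) (auto intro!: inj_compose d_inj simp: q_pos)

lemma wmap_digit: "r < q \<Longrightarrow> wmap (Suc n) (k * q + r) = wmap n k \<circ> d r"
  using q_pos by simp

lemma V_digit: "r < q \<Longrightarrow> V (Suc n) (k * q + r) = V n k * shift_op (d r)"
  by (simp only: wmap_digit shift_op_mult wmap_inj d_inj)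

text \<open>Different words of equal length have disjoint ranges: either their prefixes differ and
  the induction hypothesis applies, or the last digits differ and the common prefix is
  injective.\<close>

lemma V_adj_V:
  assumes "i < q ^ n" "k < q ^ n"
  shows "adj (V n i) * V n k = (if i = k then 1 else 0)"
proof -
  have "range (wmap n i) \<inter> range (wmap n k) = {}" if "i \<noteq> k"
    using that assms
  proof (induction n arbitrary: i k)
    case (Suc n)
    show ?case
    proof (cases "i div q = k div q")
      case True
      hence "i mod q \<noteq> k mod q"
        using Suc.prems(1) by (metis div_mult_mod_eq)
      hence "range (d (i mod q)) \<inter> range (d (k mod q)) = {}"
        using q_pos by (intro d_disj) auto
      thus ?thesis
        using True wmap_inj[of n "k div q"] by (auto simp: inj_eq)
    next
      case False
      hence "range (wmap n (i div q)) \<inter> range (wmap n (k div q)) = {}"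
        using Suc.prems by (intro Suc.IH) (auto simp: less_mult_imp_div_less mult.commute)
      thus ?thesis by auto
    qed
  qed simp
  thus ?thesis
    by (auto simp: adj_shift_op_same adj_shift_op_disjoint wmap_inj)
qed

text \<open>Each index lies in the range of exactly one \<open>d r\<close>, so exactly one summand
  keeps its basis vector and the others kill it.\<close>

lemma sum_digit_projections: "(\<Sum>r<q. shift_op (d r) * adj (shift_op (d r))) = 1"
proof (rule cop_eqI_ket)
  fix u
  obtain s t where s: "s < q" "u = d s t"
    using d_cover[of u] by blast
  have "ap (shift_op (d r) * adj (shift_op (d r))) (ket u) = (if r = s then ket u else 0)" if "r < q" for r
  proof (cases "r = s")
    case False
    hence "u \<notin> range (d r)"
      using d_disj[OF that s(1)] s(2) by auto
    hence "ap (adj (shift_op (d r))) (ket u) = 0"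
      using that by (simp add: ap_adj_shift_op d_inj pull_ket_notin)
    thus ?thesis
      using False by (simp add: ap_linear)
  qed (simp add: ap_shift_op ap_adj_shift_op d_inj s pull_ket push_ket)
  thus "ap (\<Sum>r<q. shift_op (d r) * adj (shift_op (d r))) (ket u) = ap 1 (ket u)"
    using s(1) by (simp del: ap_arith(6))
qed

lemma mu_mult: "k < q ^ n \<Longrightarrow> l < q ^ n \<Longrightarrow> mu n i k * mu n l m = (if k = l then mu n i m else 0)"
  using V_adj_V[of k n l] unfolding mu_def
  by (metis (no_types, lifting) mult.assoc mult_zero_left mult_zero_right mult_1_right)

lemma adj_mu: "adj (mu n i k) = mu n k i"
  by (simp add: mu_def)

text \<open>The operator form of tensoring a matrix unit with an identity matrix: inserting the
  resolution of the identity between the word and the adjoint word lengthens both by the same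
  digit.\<close>

lemma sum_mu_refine: "(\<Sum>r<q. mu (Suc n) (i * q + r) (k * q + r)) = mu n i k"
proof -
  have "(\<Sum>r<q. mu (Suc n) (i * q + r) (k * q + r)) =
      (\<Sum>r<q. V n i * (shift_op (d r) * adj (shift_op (d r))) * adj (V n k))"
    by (rule sum.cong) (simp_all only: mu_def V_digit lessThan_iff adj_arith mult.assoc)
  also have "\<dots> = V n i * 1 * adj (V n k)"
    by (simp only: sum_digit_projections flip: sum_distrib_left sum_distrib_right)
  finally show ?thesis
    by (simp add: mu_def)
qed

lemma sum_mu: "(\<Sum>i<q ^ n. mu n i i) = 1"
proof (induction n)
  case (Suc n)
  have "(\<Sum>i<q ^ Suc n. mu (Suc n) i i) = (\<Sum>i<q ^ n. \<Sum>r<q. mu (Suc n) (i * q + r) (i * q + r))"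
    unfolding power_Suc2 sum_digits ..
  thus ?case
    by (simp only: sum_mu_refine Suc.IH)
qed (simp add: mu_def)

section \<open>Matrices of a fixed level as operators\<close>

definition rep :: "nat \<Rightarrow> complex mat \<Rightarrow> 'i cop" where
  "rep n X = (\<Sum>i<q ^ n. \<Sum>k<q ^ n. X $$ (i, k) *\<^sub>C mu n i k)"

definition lrep :: "nat \<times> complex mat \<Rightarrow> 'i cop" where
  "lrep = (\<lambda>(n, X). rep n X)"

abbreviation "M n \<equiv> carrier_mat (q ^ n) (q ^ n)"

lemma rep_add: "X \<in> M n \<Longrightarrow> Y \<in> M n \<Longrightarrow> rep n (X + Y) = rep n X + rep n Y"
  by (simp add: rep_def cscale_add_left sum.distrib)

lemma rep_smult: "X \<in> M n \<Longrightarrow> rep n (c \<cdot>\<^sub>m X) = c *\<^sub>C rep n X"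
  by (simp add: rep_def cscale_sum_right)

lemma rep_matrix_unit: "i < q ^ n \<Longrightarrow> k < q ^ n \<Longrightarrow> rep n (matrix_unit (q ^ n) i k) = mu n i k"
proof -
  assume ik: "i < q ^ n" "k < q ^ n"
  have "rep n (matrix_unit (q ^ n) i k) = (\<Sum>a<q ^ n. \<Sum>b<q ^ n. if b = k then if a = i then mu n i k else 0 else 0)"
    unfolding rep_def by (intro sum.cong refl) (auto simp: matrix_unit_def)
  thus ?thesis
    using ik by simp
qed

lemma rep_mult:
  assumes X: "X \<in> M n" and Y: "Y \<in> M n"
  shows "rep n (X * Y) = rep n X * rep n Y"
proof -
  have "rep n X * rep n Y =
    (\<Sum>i<q ^ n. \<Sum>k<q ^ n. \<Sum>l<q ^ n. \<Sum>m<q ^ n. (X $$ (i, k) * Y $$ (l, m)) *\<^sub>C (mu n i k * mu n l m))"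
    unfolding rep_def sum_distrib_right unfolding sum_distrib_left cscale_mult cscale_cscale
    by (simp only: mult.commute)
  also have "\<dots> = (\<Sum>i<q ^ n. \<Sum>k<q ^ n. \<Sum>m<q ^ n. (X $$ (i, k) * Y $$ (k, m)) *\<^sub>C mu n i m)"
  proof (rule sum.cong[OF refl], rule sum.cong[OF refl])
    fix i k assume "i \<in> {..<q ^ n}" "k \<in> {..<q ^ n}"
    hence "(\<Sum>l<q ^ n. \<Sum>m<q ^ n. (X $$ (i, k) * Y $$ (l, m)) *\<^sub>C (mu n i k * mu n l m)) =
      (\<Sum>l<q ^ n. if l = k then \<Sum>m<q ^ n. (X $$ (i, k) * Y $$ (k, m)) *\<^sub>C mu n i m else 0)"
      by (intro sum.cong refl) (simp add: mu_mult)
    thus "(\<Sum>l<q ^ n. \<Sum>m<q ^ n. (X $$ (i, k) * Y $$ (l, m)) *\<^sub>C (mu n i k * mu n l m)) =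
      (\<Sum>m<q ^ n. (X $$ (i, k) * Y $$ (k, m)) *\<^sub>C mu n i m)"
      using \<open>k \<in> _\<close> by simp
  qed
  also have "\<dots> = (\<Sum>i<q ^ n. \<Sum>m<q ^ n. (\<Sum>k<q ^ n. X $$ (i, k) * Y $$ (k, m)) *\<^sub>C mu n i m)"
    unfolding cscale_sum_left by (rule sum.cong[OF refl]) (rule sum.swap)
  also have "\<dots> = rep n (X * Y)"
    unfolding rep_def
    by (intro sum.cong refl)
       (use X Y in \<open>auto simp: scalar_prod_def atLeast0LessThan intro!: arg_cong[where f = "\<lambda>c. c *\<^sub>C _"] sum.cong\<close>)
  finally show ?thesis ..
qed

lemma rep_adjoint: "X \<in> M n \<Longrightarrow> rep n (mat_adjoint X) = adj (rep n X)"
  unfolding rep_def adj_sum adj_cscale adj_mu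
  by (subst sum.swap) (simp add: mat_adjoint_index)

lemma kron_one_carrier: "X \<in> M n \<Longrightarrow> kron X (1\<^sub>m q) \<in> M (Suc n)"
  by (auto simp: kron_def mult.commute)

text \<open>By \<open>sum_mu_refine\<close> the operator does not change along the embeddings; hence
  \<open>lrep\<close> respects the identification of a matrix with its images at higher
  levels.\<close>

lemma rep_kron_one:
  assumes "X \<in> M n"
  shows "rep (Suc n) (kron X (1\<^sub>m q)) = rep n X"
proof -
  have lt: "i * q + r < q ^ n * q" if "i < q ^ n" "r < q" for i r
  proof -
    have "(i + 1) * q \<le> q ^ n * q"
      using that by (intro mult_right_mono) auto
    thus ?thesis using that by simp
  qed
  have "rep (Suc n) (kron X (1\<^sub>m q)) = (\<Sum>i<q ^ n. \<Sum>r<q. \<Sum>k<q ^ n. \<Sum>s<q.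
      kron X (1\<^sub>m q) $$ (i * q + r, k * q + s) *\<^sub>C mu (Suc n) (i * q + r) (k * q + s))"
    unfolding rep_def power_Suc2 sum_digits ..
  also have "\<dots> = (\<Sum>i<q ^ n. \<Sum>r<q. \<Sum>k<q ^ n. \<Sum>s<q.
      if s = r then X $$ (i, k) *\<^sub>C mu (Suc n) (i * q + r) (k * q + r) else 0)"
    by (intro sum.cong refl) (use assms in \<open>auto simp: kron_def lt\<close>)
  also have "\<dots> = (\<Sum>i<q ^ n. \<Sum>r<q. \<Sum>k<q ^ n. X $$ (i, k) *\<^sub>C mu (Suc n) (i * q + r) (k * q + r))"
    by (intro sum.cong refl) simp
  also have "\<dots> = (\<Sum>i<q ^ n. \<Sum>k<q ^ n. X $$ (i, k) *\<^sub>C (\<Sum>r<q. mu (Suc n) (i * q + r) (k * q + r)))"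
    unfolding cscale_sum_right by (rule sum.cong[OF refl]) (rule sum.swap)
  also have "\<dots> = rep n X"
    by (simp only: sum_mu_refine rep_def)
  finally show ?thesis .
qed

lemma embed_carrier: "X \<in> M n \<Longrightarrow> uhf_embed (\<lambda>_. q) n k X \<in> M (n + k)"
proof (induction k)
  case (Suc k)
  thus ?case
    using kron_one_carrier[of _ "n + k"] by simp
qed simp

lemma rep_embed: "X \<in> M n \<Longrightarrow> rep (n + k) (uhf_embed (\<lambda>_. q) n k X) = rep n X"
  by (induction k) (auto simp: rep_kron_one embed_carrier)

text \<open>Stated for both orders of the maximum because \<open>uhf_lift2\<close> embeds the left
  and the right argument into a common level.\<close>

lemma embed_max:
  assumes "X \<in> M m"
  shows "uhf_embed (\<lambda>_. q) m (max m n - m) X \<in> M (max m n)" "rep (max m n) (uhf_embed (\<lambda>_. q) m (max m n - m) X) = rep m X"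
    "uhf_embed (\<lambda>_. q) m (max n m - m) X \<in> M (max n m)" "rep (max n m) (uhf_embed (\<lambda>_. q) m (max n m - m) X) = rep m X"
  using embed_carrier[OF assms, of "max m n - m"] rep_embed[OF assms, of "max m n - m"] by (simp_all add: max.commute)

section \<open>The operator norm of a matrix\<close>

lemma ap_adj_V_ap_V:
  assumes "i < q ^ n" "k < q ^ n"
  shows "ap (adj (V n i)) (ap (V n k) x) = (if i = k then x else 0)"
  using V_adj_V[OF assms] by (metis ap_arith(1,2,6))

lemma ap_rep: "ap (rep n X) x = (\<Sum>i<q ^ n. ap (V n i) (\<Sum>k<q ^ n. X $$ (i, k) *\<^sub>C ap (adj (V n k)) x))"
  by (simp add: rep_def mu_def ap_cscale_left ap_sum_right ap_cscale)

lemma adj_V_sum: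
  "i < q ^ n \<Longrightarrow> ap (adj (V n i)) (\<Sum>k<q ^ n. ap (V n k) (y k)) = y i"
  by (simp add: ap_sum_right ap_adj_V_ap_V)

text \<open>The ranges of the isometries \<open>V n i\<close> decompose the space orthogonally. It
  is thus a sum of \<open>q ^ n\<close> copies of itself, on which \<open>rep n X\<close> acts as
  the scalar matrix X.\<close>

lemma norm_sq_components: "(norm x)\<^sup>2 = (\<Sum>i<q ^ n. (norm (ap (adj (V n i)) x))\<^sup>2)"
proof -
  have "complex_of_real ((norm x)\<^sup>2) = cip x (ap (\<Sum>i<q ^ n. mu n i i) x)"
    by (simp only: sum_mu ap_arith cip_self)
  also have "\<dots> = (\<Sum>i<q ^ n. cip (ap (adj (V n i)) x) (ap (adj (V n i)) x))"
    unfolding ap_sum_left cip_sum_right by (rule sum.cong) (simp_all add: mu_def cip_adj)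
  also have "\<dots> = complex_of_real (\<Sum>i<q ^ n. (norm (ap (adj (V n i)) x))\<^sup>2)"
    by (simp add: cip_self)
  finally show ?thesis
    by (simp only: of_real_eq_iff)
qed

lemma vec_l2norm_sq: "(vec_l2norm v)\<^sup>2 = (\<Sum>i<dim_vec v. (cmod (v $ i))\<^sup>2)"
  by (simp add: vec_l2norm_def L2_set_def sum_nonneg)

lemma vec_l2norm_nonneg: "0 \<le> vec_l2norm v"
  by (simp add: vec_l2norm_def L2_set_nonneg)

lemma mult_mat_vec_index: "X \<in> M n \<Longrightarrow> v \<in> carrier_vec (q ^ n) \<Longrightarrow> i < q ^ n \<Longrightarrow> (X *\<^sub>v v) $ i = (\<Sum>k<q ^ n. X $$ (i, k) * v $ k)"
  by (auto simp: scalar_prod_def atLeast0LessThan intro!: sum.cong)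

lemma vec_l2norm_mult_le:
  assumes X: "X \<in> M n" and v: "v \<in> carrier_vec (q ^ n)"
  shows "vec_l2norm (X *\<^sub>v v) \<le> norm (rep n X) * vec_l2norm v"
proof -
  \<comment> \<open>The numerical vector v is placed along one basis vector in each of the
    copies.\<close>
  define x where "x = (\<Sum>k<q ^ n. ap (V n k) ((v $ k) *\<^sub>C ket undefined))"
  have adj_x: "ap (adj (V n i)) x = (v $ i) *\<^sub>C ket undefined" if "i < q ^ n" for i
    unfolding x_def using that by (rule adj_V_sum)
  have "(norm x)\<^sup>2 = (vec_l2norm v)\<^sup>2"
    unfolding norm_sq_components[of x n] vec_l2norm_sq using v by (intro sum.cong) (auto simp: adj_x)
  hence norm_x: "norm x = vec_l2norm v"
    by (rule power2_eq_imp_eq) (auto simp: vec_l2norm_nonneg)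
  have "ap (adj (V n i)) (ap (rep n X) x) = ((X *\<^sub>v v) $ i) *\<^sub>C ket undefined" if "i < q ^ n" for i
  proof -
    have "ap (adj (V n i)) (ap (rep n X) x) = (\<Sum>k<q ^ n. X $$ (i, k) *\<^sub>C ap (adj (V n k)) x)"
      unfolding ap_rep using that by (rule adj_V_sum)
    also have "\<dots> = (\<Sum>k<q ^ n. (X $$ (i, k) * v $ k) *\<^sub>C ket undefined)"
      by (intro sum.cong) (auto simp: adj_x)
    finally show ?thesis
      by (simp only: mult_mat_vec_index[OF X v that] cscale_sum_left)
  qed
  hence "(norm (ap (rep n X) x))\<^sup>2 = (vec_l2norm (X *\<^sub>v v))\<^sup>2"
    unfolding norm_sq_components[of "ap (rep n X) x" n] vec_l2norm_sq using X by (intro sum.cong) auto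
  hence "norm (ap (rep n X) x) = vec_l2norm (X *\<^sub>v v)"
    by (rule power2_eq_imp_eq) (auto simp: vec_l2norm_nonneg)
  thus ?thesis
    using norm_ap[of "rep n X" x] by (simp add: norm_x)
qed

text \<open>\<open>mat_opnorm\<close> is a bare supremum; the estimate by
  \<open>norm (rep n X)\<close> shows that it is taken over a bounded set. The rest is scaling v to
  length 1.\<close>

lemma mat_opnorm_bound:
  assumes X: "X \<in> M n" and v: "v \<in> carrier_vec (q ^ n)"
  shows "vec_l2norm (X *\<^sub>v v) \<le> mat_opnorm X * vec_l2norm v"
proof -
  have bdd: "bdd_above {vec_l2norm (X *\<^sub>v v) | v. v \<in> carrier_vec (dim_col X) \<and> vec_l2norm v \<le> 1}"
  proof (rule bdd_aboveI, safe)
    fix v :: "complex vec" assume v: "v \<in> carrier_vec (dim_col X)" "vec_l2norm v \<le> 1"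
    have "norm (rep n X) * vec_l2norm v \<le> norm (rep n X) * 1"
      using v(2) by (intro mult_left_mono) auto
    thus "vec_l2norm (X *\<^sub>v v) \<le> norm (rep n X)"
      using vec_l2norm_mult_le[OF X, of v] v X by auto
  qed
  show ?thesis
  proof (cases "vec_l2norm v = 0")
    case True
    thus ?thesis
      using vec_l2norm_mult_le[OF X v] by simp
  next
    case False
    hence pos: "vec_l2norm v > 0"
      using vec_l2norm_nonneg[of v] by simp
    define w where "w = complex_of_real (1 / vec_l2norm v) \<cdot>\<^sub>v v"
    have scale: "vec_l2norm (complex_of_real c \<cdot>\<^sub>v u) = c * vec_l2norm u" if "c \<ge> 0" for c u
    proof (rule power2_eq_imp_eq)
      show "(vec_l2norm (complex_of_real c \<cdot>\<^sub>v u))\<^sup>2 = (c * vec_l2norm u)\<^sup>2"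
        unfolding power_mult_distrib vec_l2norm_sq sum_distrib_left
        by (rule sum.cong) (simp_all add: norm_mult power_mult_distrib)
    qed (use that in \<open>simp_all add: vec_l2norm_nonneg\<close>)
    have w: "w \<in> carrier_vec (dim_col X)" "vec_l2norm w \<le> 1"
      unfolding w_def using v X pos scale[of "1 / vec_l2norm v" v] by (auto simp del: of_real_divide)
    have "vec_l2norm (X *\<^sub>v w) \<le> mat_opnorm X"
      unfolding mat_opnorm_def by (rule cSup_upper[OF _ bdd]) (use w in blast)
    moreover have "X *\<^sub>v w = complex_of_real (1 / vec_l2norm v) \<cdot>\<^sub>v (X *\<^sub>v v)"
      unfolding w_def using X v by (rule mult_mat_vec)
    ultimately have "1 / vec_l2norm v * vec_l2norm (X *\<^sub>v v) \<le> mat_opnorm X"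
      using scale[of "1 / vec_l2norm v" "X *\<^sub>v v"] pos by simp
    thus ?thesis
      using pos by (simp add: field_simps)
  qed
qed

lemma mat_opnorm_nonneg:
  assumes X: "X \<in> M n"
  shows "0 \<le> mat_opnorm X"
proof -
  have "0 < q ^ n"
    using q_pos by simp
  define v :: "complex vec" where "v = unit_vec (q ^ n) 0"
  have v: "v \<in> carrier_vec (q ^ n)"
    by (simp add: v_def)
  have "(vec_l2norm v)\<^sup>2 = (\<Sum>i<q ^ n. if i = 0 then 1 else 0)"
    unfolding vec_l2norm_sq using \<open>0 < q ^ n\<close> by (intro sum.cong) (auto simp: v_def index_unit_vec(1))
  hence "(vec_l2norm v)\<^sup>2 = 1\<^sup>2"
    using \<open>0 < q ^ n\<close> by simp
  hence "vec_l2norm v = 1"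
    by (rule power2_eq_imp_eq) (auto simp: vec_l2norm_nonneg)
  thus ?thesis
    using mat_opnorm_bound[OF X v] vec_l2norm_nonneg[of "X *\<^sub>v v"] by simp
qed

text \<open>For the upper bound, the coordinates at t of the components of x form one numerical
  vector for each t. The matrix estimate applies to each of them, and the squares are summed over
  t.\<close>

lemma norm_rep:
  assumes X: "X \<in> M n"
  shows "norm (rep n X) = mat_opnorm X"
proof (rule antisym)
  show "norm (rep n X) \<le> mat_opnorm X"
  proof (rule norm_cop_le[OF mat_opnorm_nonneg[OF X]])
    fix x
    define y where "y k = ap (adj (V n k)) x" for k
    define v where "v t = vec (q ^ n) (\<lambda>k. coord (y k) t)" for t
    define z where "z i = (\<Sum>k<q ^ n. X $$ (i, k) *\<^sub>C y k)" for i
    have v: "v t \<in> carrier_vec (q ^ n)" for t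
      by (simp add: v_def)
    have sq: "((\<lambda>t. (cmod (coord u t))\<^sup>2) has_sum (norm u)\<^sup>2) UNIV" for u :: "'i ell2"
      unfolding norm_ell2_sq by (rule has_sum_infsum[OF coord_summable])
    have comp: "ap (adj (V n i)) (ap (rep n X) x) = z i" if "i < q ^ n" for i
      unfolding ap_rep z_def y_def using that by (rule adj_V_sum)
    have "(norm (ap (rep n X) x))\<^sup>2 = (\<Sum>i<q ^ n. (norm (z i))\<^sup>2)"
      unfolding norm_sq_components[of "ap (rep n X) x" n] by (simp add: comp)
    also have "\<dots> \<le> (mat_opnorm X)\<^sup>2 * (\<Sum>k<q ^ n. (norm (y k))\<^sup>2)"
    proof (rule has_sum_mono)
      show "((\<lambda>t. \<Sum>i<q ^ n. (cmod (coord (z i) t))\<^sup>2) has_sum (\<Sum>i<q ^ n. (norm (z i))\<^sup>2)) UNIV"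
        by (intro has_sum_sum sq)
      show "((\<lambda>t. (mat_opnorm X)\<^sup>2 * (\<Sum>k<q ^ n. (cmod (coord (y k) t))\<^sup>2)) has_sum
          (mat_opnorm X)\<^sup>2 * (\<Sum>k<q ^ n. (norm (y k))\<^sup>2)) UNIV"
        by (intro has_sum_cmult_right has_sum_sum sq)
      fix t
      have "(X *\<^sub>v v t) $ i = coord (z i) t" if "i < q ^ n" for i
        unfolding mult_mat_vec_index[OF X v that] by (simp add: z_def v_def)
      hence "(\<Sum>i<q ^ n. (cmod (coord (z i) t))\<^sup>2) = (vec_l2norm (X *\<^sub>v v t))\<^sup>2"
        unfolding vec_l2norm_sq using X by (intro sum.cong) (auto simp del: index_mult_mat_vec)
      also have "\<dots> \<le> (mat_opnorm X * vec_l2norm (v t))\<^sup>2"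
        by (intro power_mono mat_opnorm_bound[OF X v] vec_l2norm_nonneg)
      also have "\<dots> = (mat_opnorm X)\<^sup>2 * (\<Sum>k<q ^ n. (cmod (coord (y k) t))\<^sup>2)"
        unfolding power_mult_distrib vec_l2norm_sq by (simp add: v_def)
      finally show "(\<Sum>i<q ^ n. (cmod (coord (z i) t))\<^sup>2) \<le> (mat_opnorm X)\<^sup>2 * (\<Sum>k<q ^ n. (cmod (coord (y k) t))\<^sup>2)" .
    qed
    also have "\<dots> = (mat_opnorm X * norm x)\<^sup>2"
      unfolding power_mult_distrib norm_sq_components[of x n] y_def ..
    finally show "norm (ap (rep n X) x) \<le> mat_opnorm X * norm x"
      by (rule power2_le_imp_le) (simp add: mat_opnorm_nonneg[OF X])
  qed
  show "mat_opnorm X \<le> norm (rep n X)"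
    unfolding mat_opnorm_def
  proof (rule cSup_least, safe)
    \<comment> \<open>The zero vector shows that the supremum is over a nonempty set.\<close>
    have "vec_l2norm (0\<^sub>v (dim_col X)) \<le> 1"
      using vec_l2norm_sq[of "0\<^sub>v (dim_col X)"] by simp
    thus "{vec_l2norm (X *\<^sub>v v) |v. v \<in> carrier_vec (dim_col X) \<and> vec_l2norm v \<le> 1} = {} \<Longrightarrow> False"
      by auto
    fix v :: "complex vec" assume v: "v \<in> carrier_vec (dim_col X)" "vec_l2norm v \<le> 1"
    have "norm (rep n X) * vec_l2norm v \<le> norm (rep n X) * 1"
      using v(2) by (intro mult_left_mono) auto
    thus "vec_l2norm (X *\<^sub>v v) \<le> norm (rep n X)"
      using vec_l2norm_mult_le[OF X, of v] v X by auto
  qed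
qed

lemma rep_one: "rep 0 (1\<^sub>m 1) = 1"
  by (simp add: rep_def mu_def)

lemma local_carrier: "(n, X) \<in> carrier (uhf_local (\<lambda>_. q)) \<longleftrightarrow> X \<in> M n"
  by (simp add: uhf_local_def uhf_size_const)

lemma star_model_local: "star_model (uhf_local (\<lambda>_. q)) lrep"
proof
  show "contr_hom (uhf_local (\<lambda>_. q)) lrep"
    unfolding contr_hom_def
    by (auto simp: local_carrier lrep_def)
       (auto simp: uhf_local_def lrep_def uhf_lift2_def Let_def embed_max rep_add rep_mult rep_smult rep_adjoint norm_rep rep_one[simplified])
next
  fix x y c assume "x \<in> carrier (uhf_local (\<lambda>_. q))" "y \<in> carrier (uhf_local (\<lambda>_. q))"
  then obtain m n X Y where xy: "x = (m, X)" "X \<in> M m" "y = (n, Y)" "Y \<in> M n"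
    by (metis local_carrier prod.exhaust)
  note c = embed_max(1)[OF xy(2), of n] embed_max(3)[OF xy(4), of m]
  show "x \<oplus>\<^bsub>uhf_local (\<lambda>_. q)\<^esub> y \<in> carrier (uhf_local (\<lambda>_. q))"
    "x \<otimes>\<^bsub>uhf_local (\<lambda>_. q)\<^esub> y \<in> carrier (uhf_local (\<lambda>_. q))"
    using c by (auto simp: uhf_local_def uhf_size_const uhf_lift2_def Let_def xy)
next
  fix x c assume "x \<in> carrier (uhf_local (\<lambda>_. q))"
  then obtain m X where xy: "x = (m, X)" "X \<in> M m"
    by (metis local_carrier prod.exhaust)
  show "c \<odot>\<^bsub>uhf_local (\<lambda>_. q)\<^esub> x \<in> carrier (uhf_local (\<lambda>_. q))"
    "invol (uhf_local (\<lambda>_. q)) x \<in> carrier (uhf_local (\<lambda>_. q))"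
    "anorm (uhf_local (\<lambda>_. q)) x = norm (lrep x)"
    using xy(2) by (auto simp: uhf_local_def uhf_size_const xy mat_adjoint_carrier lrep_def norm_rep)
qed (simp_all add: uhf_local_def uhf_size_const)

section \<open>The completed algebra and its levels\<close>

definition urep :: "(nat \<Rightarrow> nat \<times> complex mat) set \<Rightarrow> 'i cop" where
  "urep = cpl_lift lrep"

lemma star_model_uhf: "star_model (uhf (\<lambda>_. q)) urep"
  unfolding uhf_def urep_def by (rule star_model.star_model_completion[OF star_model_local])

lemma inj_on_urep: "inj_on urep (carrier (uhf (\<lambda>_. q)))"
  unfolding uhf_def urep_def by (rule star_model.inj_on_completion[OF star_model_local])

definition level :: "nat \<Rightarrow> 'i cop set" where
  "level n = rep n ` M n"

lemma image_urep: "urep ` carrier (uhf (\<lambda>_. q)) = closure (\<Union>n. level n)"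
proof -
  have "lrep ` carrier (uhf_local (\<lambda>_. q)) = (\<Union>n. level n)"
  proof (intro equalityI subsetI)
    fix T assume "T \<in> lrep ` carrier (uhf_local (\<lambda>_. q))"
    then obtain n X where "X \<in> M n" "T = rep n X"
      by (auto simp: local_carrier lrep_def)
    thus "T \<in> (\<Union>n. level n)"
      unfolding level_def by blast
  next
    fix T assume "T \<in> (\<Union>n. level n)"
    then obtain n X where "X \<in> M n" "T = rep n X"
      by (auto simp: level_def)
    thus "T \<in> lrep ` carrier (uhf_local (\<lambda>_. q))"
      by (intro image_eqI[of _ _ "(n, X)"]) (auto simp: local_carrier lrep_def)
  qed
  thus ?thesis
    unfolding uhf_def urep_def star_model.image_completion[OF star_model_local] by simp
qed

lemma uhf_incl_in: "X \<in> M n \<Longrightarrow> uhf_incl (\<lambda>_. q) n X \<in> carrier (uhf (\<lambda>_. q))"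
  unfolding uhf_def uhf_incl_def by (rule star_model.cls_in[OF star_model_local]) (simp add: local_carrier)

lemma urep_incl: "X \<in> M n \<Longrightarrow> urep (uhf_incl (\<lambda>_. q) n X) = rep n X"
  unfolding urep_def uhf_incl_def
  by (subst star_model.cpl_lift_cls[OF star_model_local star_model.hom[OF star_model_local]])
     (simp_all add: local_carrier lrep_def)

lemma matrix_unit_carrier: "matrix_unit (q ^ n) i k \<in> M n"
  by (simp add: matrix_unit_def)

lemma mu_level: "i < q ^ n \<Longrightarrow> k < q ^ n \<Longrightarrow> mu n i k \<in> level n"
  unfolding level_def
  by (rule image_eqI[of _ _ "matrix_unit (q ^ n) i k"]) (simp_all add: rep_matrix_unit matrix_unit_carrier)

lemma level_mono: "m \<le> n \<Longrightarrow> level m \<subseteq> level n"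
proof
  fix T assume mn: "m \<le> n" and "T \<in> level m"
  then obtain X where X: "X \<in> M m" "T = rep m X"
    by (auto simp: level_def)
  show "T \<in> level n"
    unfolding level_def
    using rep_embed[OF X(1), of "n - m"] embed_carrier[OF X(1), of "n - m"] mn X(2)
    by (intro image_eqI[of _ _ "uhf_embed (\<lambda>_. q) m (n - m) X"]) auto
qed

lemma level_closed:
  assumes "S \<in> level n" "T \<in> level n"
  shows "S * T \<in> level n" "adj S \<in> level n"
  using assms unfolding level_def
  by (auto simp: rep_mult[symmetric] rep_adjoint[symmetric] mat_adjoint_carrier intro!: imageI mult_carrier_mat)

end

section \<open>The greatest C*-seminorm on the algebraic tensor product\<close>

text \<open>Otherwise the quotient of a and b exceeds 1 and its powers outgrow
  \<open>C\<close>.\<close>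

lemma power_dominate:
  assumes "\<And>k::nat. a ^ (2 ^ k) \<le> C * b ^ (2 ^ k)" "0 \<le> a" "0 \<le> (b::real)"
  shows "a \<le> b"
proof (cases "b = 0")
  case True
  thus ?thesis
    using assms(1)[of 0] by simp
next
  case False
  hence b: "b > 0"
    using assms(3) by simp
  show ?thesis
  proof (rule ccontr)
    assume "\<not> a \<le> b"
    hence "a / b > 1"
      using b by simp
    then obtain n where n: "C < (a / b) ^ n"
      using real_arch_pow by blast
    have "n \<le> 2 ^ n"
      by (simp add: less_imp_le)
    hence "(a / b) ^ n \<le> (a / b) ^ (2 ^ n)"
      using \<open>a / b > 1\<close> by (intro power_increasing) auto
    hence "C < a ^ (2 ^ n) / b ^ (2 ^ n)"
      using n by (simp add: power_divide)
    hence "C * b ^ (2 ^ n) < a ^ (2 ^ n)"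
      using b by (simp add: pos_less_divide_eq)
    thus False
      using assms(1)[of n] by simp
  qed
qed

text \<open>Iterating \<open>x \<mapsto> x\<^sup>* x\<close> squares both seminorms at each step, so the constant is absorbed.\<close>

lemma cstar_dominate:
  fixes p r :: "'a \<Rightarrow> real"
  assumes closed: "\<And>x. x \<in> D \<Longrightarrow> sq x \<in> D"
    and p_sq: "\<And>x. x \<in> D \<Longrightarrow> p (sq x) = (p x)\<^sup>2" and r_sq: "\<And>x. x \<in> D \<Longrightarrow> r (sq x) = (r x)\<^sup>2"
    and le: "\<And>x. x \<in> D \<Longrightarrow> p x \<le> C * r x"
    and nonneg: "\<And>x. x \<in> D \<Longrightarrow> 0 \<le> p x" "\<And>x. x \<in> D \<Longrightarrow> 0 \<le> r x"
    and x: "x \<in> D"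
  shows "p x \<le> r x"
proof (rule power_dominate)
  fix k
  have "(sq ^^ k) x \<in> D \<and> p ((sq ^^ k) x) = p x ^ (2 ^ k) \<and> r ((sq ^^ k) x) = r x ^ (2 ^ k)"
    by (induction k) (auto simp: x closed p_sq r_sq power_mult[symmetric] mult.commute)
  thus "p x ^ (2 ^ k) \<le> C * r x ^ (2 ^ k)"
    using le by metis
qed (use nonneg x in auto)

definition tlift :: "('a \<Rightarrow> 'i cop) \<Rightarrow> ('b \<Rightarrow> 'k cop) \<Rightarrow> ('a \<times> 'b) list \<Rightarrow> ('i \<times> 'k) cop" where
  "tlift f g t = (\<Sum>(x, y)\<leftarrow>t. tens (f x) (g y))"

lemma tlift_simps [simp]:
  "tlift f g [] = 0" "tlift f g ((x, y) # t) = tens (f x) (g y) + tlift f g t"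
  "tlift f g (s @ t) = tlift f g s + tlift f g t"
  by (simp_all add: tlift_def)

locale inj_model = star_model +
  assumes inj: "inj_on j (carrier A)"
begin

text \<open>Linear relations are at hand only among the images under j. Injectivity carries them
  back to \<open>A\<close>: summands are removed one at a time, and an element with image 0 equals
  its own zero multiple.\<close>

lemma linear_expand:
  fixes g :: "'a \<Rightarrow> complex"
  assumes add: "\<And>x y. x \<in> carrier A \<Longrightarrow> y \<in> carrier A \<Longrightarrow> g (x \<oplus>\<^bsub>A\<^esub> y) = g x + g y"
    and smult: "\<And>c x. x \<in> carrier A \<Longrightarrow> g (c \<odot>\<^bsub>A\<^esub> x) = c * g x"
    and "finite I" "\<And>a. a \<in> I \<Longrightarrow> e a \<in> carrier A" "x \<in> carrier A" "j x = (\<Sum>a\<in>I. c a *\<^sub>C j (e a))"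
  shows "g x = (\<Sum>a\<in>I. c a * g (e a))"
  using assms(3-)
proof (induction I arbitrary: x rule: finite_induct)
  case empty
  hence "j x = j (0 \<odot>\<^bsub>A\<^esub> x)"
    by (simp add: j_smult)
  hence "x = 0 \<odot>\<^bsub>A\<^esub> x"
    using inj empty by (auto simp: inj_on_def smult_closed)
  thus ?case
    using smult[of x 0] empty by simp
next
  case (insert a I)
  define y where "y = x \<oplus>\<^bsub>A\<^esub> ((- c a) \<odot>\<^bsub>A\<^esub> e a)"
  have e: "e a \<in> carrier A" "x \<in> carrier A"
    using insert by auto
  have "j y = j x - c a *\<^sub>C j (e a)"
    using e cscale_cscale[of "-1" "c a" "j (e a)"] by (simp add: y_def j_add j_smult smult_closed del: cscale_cscale)
  hence "j y = (\<Sum>a\<in>I. c a *\<^sub>C j (e a))"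
    using insert by simp
  moreover have "y \<in> carrier A"
    by (simp add: y_def e add_closed smult_closed)
  ultimately have "g y = (\<Sum>a\<in>I. c a * g (e a))"
    using insert by auto
  moreover have "g y = g x - c a * g (e a)"
    using e by (simp add: y_def add smult smult_closed)
  ultimately have "g x = c a * g (e a) + (\<Sum>a\<in>I. c a * g (e a))"
    by (simp add: algebra_simps)
  thus ?case
    using insert.hyps by simp
qed

end

lemma (in digit_maps) inj_model_uhf: "inj_model (uhf (\<lambda>_. q)) urep"
  unfolding inj_model_def inj_model_axioms_def by (simp add: star_model_uhf inj_on_urep)

text \<open>On level n this is the matrix entry at (i, k). As an inner product with unit vectors it
  is bounded by the norm of \<open>T\<close> and multiplicative on tensor products.\<close>

definition (in digit_maps) coef :: "nat \<Rightarrow> nat \<times> nat \<Rightarrow> 'i cop \<Rightarrow> complex" where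
  "coef n = (\<lambda>(i, k) T. cip (ap (V n i) (ket undefined)) (ap T (ap (V n k) (ket undefined))))"

definition (in digit_maps) unit_elem :: "nat \<Rightarrow> nat \<times> nat \<Rightarrow> (nat \<Rightarrow> nat \<times> complex mat) set" where
  "unit_elem n = (\<lambda>(i, k). uhf_incl (\<lambda>_. q) n (matrix_unit (q ^ n) i k))"

lemma (in digit_maps) unit_elem_in: "unit_elem n a \<in> carrier (uhf (\<lambda>_. q))"
  by (cases a) (simp add: unit_elem_def uhf_incl_in matrix_unit_carrier)

lemma (in digit_maps) level_expand:
  assumes "T \<in> level n"
  shows "T = (\<Sum>a\<in>{..<q ^ n} \<times> {..<q ^ n}. coef n a T *\<^sub>C urep (unit_elem n a))"
proof -
  from assms obtain X where X: "X \<in> M n" "T = rep n X"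
    by (auto simp: level_def)
  have "coef n (i, k) T = X $$ (i, k)" if ik: "i < q ^ n" "k < q ^ n" for i k
  proof -
    have "coef n (i, k) T = cip (ket undefined) (ap (adj (V n i)) (ap T (ap (V n k) (ket undefined))))"
      by (simp add: coef_def cip_adj')
    also have "ap (adj (V n i)) (ap T (ap (V n k) (ket undefined))) =
        (\<Sum>m<q ^ n. X $$ (i, m) *\<^sub>C ap (adj (V n m)) (ap (V n k) (ket undefined)))"
      unfolding X(2) ap_rep using ik(1) by (rule adj_V_sum)
    also have "\<dots> = (\<Sum>m<q ^ n. if m = k then X $$ (i, k) *\<^sub>C ket undefined else 0)"
      using ik by (intro sum.cong) (auto simp: ap_adj_V_ap_V)
    finally show ?thesis
      using ik by (simp add: cip_cscale_right cip_self)
  qed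
  hence "rep n X = (\<Sum>i<q ^ n. \<Sum>k<q ^ n. coef n (i, k) T *\<^sub>C mu n i k)"
    by (simp add: rep_def)
  also have "\<dots> = (\<Sum>a\<in>{..<q ^ n} \<times> {..<q ^ n}. coef n a T *\<^sub>C urep (unit_elem n a))"
    unfolding sum.cartesian_product
    by (rule sum.cong) (auto simp: unit_elem_def urep_incl matrix_unit_carrier rep_matrix_unit)
  finally show ?thesis
    using X by simp
qed

section \<open>C*-seminorms on formal tensors\<close>

locale star_pair = A: star_model A jA + B: star_model B jB
  for A :: "'a star_alg" and jA :: "'a \<Rightarrow> 'i cop" and B :: "'b star_alg" and jB :: "'b \<Rightarrow> 'k cop"
begin

abbreviation "T \<equiv> lists (carrier A \<times> carrier B)"

lemma tensor_closed:
  assumes "s \<in> T" "t \<in> T"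
  shows "s @ t \<in> T" "tensor_smult A c t \<in> T" "tensor_mult A B s t \<in> T" "tensor_invol A B t \<in> T"
proof -
  have s: "(x, y) \<in> set s \<Longrightarrow> x \<in> carrier A \<and> y \<in> carrier B" for x y
    using assms(1) by (auto simp: in_lists_conv_set)
  have t: "(x, y) \<in> set t \<Longrightarrow> x \<in> carrier A \<and> y \<in> carrier B" for x y
    using assms(2) by (auto simp: in_lists_conv_set)
  show "s @ t \<in> T" "tensor_smult A c t \<in> T" "tensor_mult A B s t \<in> T" "tensor_invol A B t \<in> T"
    by (auto simp: in_lists_conv_set tensor_smult_def tensor_mult_def tensor_invol_def
        A.smult_closed A.mult_closed B.mult_closed A.invol_closed B.invol_closed dest!: s t)
qed

lemma tlift_tensor:
  assumes f: "contr_hom A f" and g: "contr_hom B g" and s: "s \<in> T" and t: "t \<in> T"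
  shows "tlift f g (tensor_smult A c t) = c *\<^sub>C tlift f g t"
    "tlift f g (tensor_mult A B s t) = tlift f g s * tlift f g t"
    "tlift f g (tensor_invol A B t) = adj (tlift f g t)"
proof -
  note h = f[unfolded contr_hom_def] g[unfolded contr_hom_def]
  show "tlift f g (tensor_smult A c t) = c *\<^sub>C tlift f g t"
    using t by (induction t) (auto simp: tensor_smult_def h tens_cscale cscale_add_right)
  show "tlift f g (tensor_invol A B t) = adj (tlift f g t)"
    using t by (induction t) (auto simp: tensor_invol_def h adj_tens)
  have 1: "tlift f g (map (\<lambda>(x', y'). (x \<otimes>\<^bsub>A\<^esub> x', y \<otimes>\<^bsub>B\<^esub> y')) t) = tens (f x) (g y) * tlift f g t"
    if "x \<in> carrier A" "y \<in> carrier B" for x y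
    using t by (induction t) (auto simp: h tens_mult distrib_left that)
  show "tlift f g (tensor_mult A B s t) = tlift f g s * tlift f g t"
    using s by (induction s) (auto simp: tensor_mult_def 1 distrib_right)
qed

text \<open>Inner products with fixed vectors turn the operators into bilinear forms in x and y, and
  such inner products separate operators.\<close>

lemma tlift_tensor_eq:
  assumes f: "contr_hom A f" and g: "contr_hom B g" and eq: "tensor_eq A B s t"
  shows "tlift f g s = tlift f g t"
proof (rule cop_eqI, rule cip_eqI)
  fix u v
  define F where "F x y = cip u (ap (tens (f x) (g y)) v)" for x y
  note h = f[unfolded contr_hom_def] g[unfolded contr_hom_def]
  have "bilinear_form A B F"
    by (simp add: bilinear_form_def F_def h tens_add tens_cscale cip_add_right ap_cscale_left cip_cscale_right)
  hence "(\<Sum>(x, y)\<leftarrow>s. F x y) = (\<Sum>(x, y)\<leftarrow>t. F x y)"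
    using eq by (simp add: tensor_eq_def)
  moreover have "cip u (ap (tlift f g r) v) = (\<Sum>(x, y)\<leftarrow>r. F x y)" for r
    by (induction r) (auto simp: F_def cip_add_right)
  ultimately show "cip u (ap (tlift f g s) v) = cip u (ap (tlift f g t) v)"
    by simp
qed

text \<open>Each pair of contractive representations contributes a member to the family whose
  supremum is the tensor norm; the C*-identity is inherited from operators.\<close>

lemma tlift_seminorm:
  assumes f: "contr_hom A f" and g: "contr_hom B g"
  shows "tensor_cstar_seminorm A B (\<lambda>t. norm (tlift f g t))"
proof -
  have "norm (tens (f x) (g y)) \<le> anorm A x * anorm B y" if "x \<in> carrier A" "y \<in> carrier B" for x y
  proof -
    have "norm (f x) * norm (g y) \<le> anorm A x * anorm B y"
      using f g that by (intro mult_mono) (auto simp: contr_hom_def A.norm)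
    thus ?thesis
      using norm_tens_le[of "f x" "g y"] by simp
  qed
  thus ?thesis
    unfolding tensor_cstar_seminorm_def Let_def
    using tlift_tensor_eq[OF f g]
    by (auto simp: tlift_tensor[OF f g] tensor_closed norm_triangle_ineq norm_mult_ineq norm_adj_mult)
qed

lemma seminormD:
  assumes "tensor_cstar_seminorm A B p"
  shows "\<And>t. t \<in> T \<Longrightarrow> 0 \<le> p t"
    "\<And>s t. s \<in> T \<Longrightarrow> t \<in> T \<Longrightarrow> tensor_eq A B s t \<Longrightarrow> p s = p t"
    "\<And>s t. s \<in> T \<Longrightarrow> t \<in> T \<Longrightarrow> p (s @ t) \<le> p s + p t"
    "\<And>c t. t \<in> T \<Longrightarrow> p (tensor_smult A c t) = cmod c * p t"
    "\<And>t. t \<in> T \<Longrightarrow> p (tensor_mult A B (tensor_invol A B t) t) = (p t)\<^sup>2"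
    "\<And>x y. x \<in> carrier A \<Longrightarrow> y \<in> carrier B \<Longrightarrow> p [(x, y)] \<le> anorm A x * anorm B y"
  using assms unfolding tensor_cstar_seminorm_def Let_def by blast+

lemma seminorm_le_sum:
  assumes p: "tensor_cstar_seminorm A B p" and t: "t \<in> T"
  shows "p t \<le> (\<Sum>(x, y)\<leftarrow>t. p [(x, y)])"
  using t
proof (induction t)
  case Nil
  \<comment> \<open>The empty sum is its own zero multiple, whence its seminorm is 0.\<close>
  have "p (tensor_smult A 0 []) = 0"
    using seminormD(4)[OF p, of "[]" 0] by simp
  thus ?case
    by (simp add: tensor_smult_def)
next
  case (Cons z t)
  thus ?case
    using seminormD(3)[OF p, of "[z]" t] by (cases z) auto
qed

text \<open>A formal difference: of a list with itself it is zero only up to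
  \<open>tensor_eq\<close>, so triangle inequalities must pass through that relation.\<close>

definition tdiff :: "('a \<times> 'b) list \<Rightarrow> ('a \<times> 'b) list \<Rightarrow> ('a \<times> 'b) list" where
  "tdiff s t = s @ tensor_smult A (-1) t"

lemma tdiff_closed: "s \<in> T \<Longrightarrow> t \<in> T \<Longrightarrow> tdiff s t \<in> T"
  unfolding tdiff_def by (rule tensor_closed(1)[OF _ tensor_closed(2)])

lemma bilinear_sum_smult:
  assumes "bilinear_form A B F" "t \<in> T"
  shows "(\<Sum>(x, y)\<leftarrow>tensor_smult A c t. F x y) = c * (\<Sum>(x, y)\<leftarrow>t. F x y)"
  using assms(2) by (induction t) (use assms(1) in \<open>auto simp: tensor_smult_def bilinear_form_def algebra_simps\<close>)

lemma seminorm_tdiff: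
  assumes p: "tensor_cstar_seminorm A B p" and st: "s \<in> T" "t \<in> T"
  shows "p s \<le> p t + p (tdiff s t)" "p t \<le> p s + p (tdiff s t)"
proof -
  have cl: "tdiff s t \<in> T" "tensor_smult A (-1) (tdiff s t) \<in> T"
    using st unfolding tdiff_def by (intro tensor_closed; simp)+
  have "tensor_eq A B s (t @ tdiff s t)" and "tensor_eq A B t (s @ tensor_smult A (-1) (tdiff s t))"
    using st cl by (auto simp: tensor_eq_def bilinear_sum_smult tdiff_def tensor_closed)
  note seminormD(2)[OF p st(1) tensor_closed(1)[OF st(2) cl(1)] this(1)]
    seminormD(2)[OF p st(2) tensor_closed(1)[OF st(1) cl(2)] this(2)]
  thus "p s \<le> p t + p (tdiff s t)" "p t \<le> p s + p (tdiff s t)"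
    using seminormD(3)[OF p st(2) cl(1)] seminormD(3)[OF p st(1) cl(2)] seminormD(4)[OF p cl(1), of "-1"] by auto
qed

text \<open>The difference splits as x - x' tensored with y plus x' tensored with y - y', and the
  cross-norm clause bounds both terms.\<close>

lemma seminorm_elem_diff:
  assumes p: "tensor_cstar_seminorm A B p"
    and c: "x \<in> carrier A" "x' \<in> carrier A" "y \<in> carrier B" "y' \<in> carrier B"
  shows "p (tdiff [(x, y)] [(x', y')]) \<le> norm (jA x - jA x') * norm (jB y) + norm (jA x') * norm (jB y - jB y')"
proof -
  define u where "u = x \<oplus>\<^bsub>A\<^esub> ((-1) \<odot>\<^bsub>A\<^esub> x')"
  define v where "v = y \<oplus>\<^bsub>B\<^esub> ((-1) \<odot>\<^bsub>B\<^esub> y')"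
  have uv: "u \<in> carrier A" "v \<in> carrier B" "jA u = jA x - jA x'" "jB v = jB y - jB y'"
    using c by (simp_all add: u_def v_def A.add_closed A.smult_closed B.add_closed B.smult_closed
        A.j_add A.j_smult B.j_add B.j_smult)
  have "tensor_eq A B (tdiff [(x, y)] [(x', y')]) [(u, y), (x', v)]"
    using c by (auto simp: tensor_eq_def bilinear_form_def tdiff_def tensor_smult_def u_def v_def A.smult_closed B.smult_closed)
  hence "p (tdiff [(x, y)] [(x', y')]) = p [(u, y), (x', v)]"
    using c uv by (intro seminormD(2)[OF p]) (auto simp: tdiff_def tensor_smult_def A.smult_closed)
  also have "\<dots> \<le> p [(u, y)] + p [(x', v)]"
    using seminorm_le_sum[OF p, of "[(u, y), (x', v)]"] c uv by simp
  also have "\<dots> \<le> anorm A u * anorm B y + anorm A x' * anorm B v"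
    using c uv by (intro add_mono seminormD(6)[OF p])
  finally show ?thesis
    using c uv by (simp add: A.norm B.norm)
qed

end

section \<open>Comparison of seminorms for two UHF algebras\<close>

locale digit_pair = D: digit_maps q d + E: digit_maps q' d'
  for q q' :: nat and d :: "nat \<Rightarrow> 'i \<Rightarrow> 'i" and d' :: "nat \<Rightarrow> 'k \<Rightarrow> 'k"
begin

abbreviation "A \<equiv> uhf (\<lambda>_. q)"
abbreviation "B \<equiv> uhf (\<lambda>_. q')"

sublocale A: inj_model A D.urep
  by (rule D.inj_model_uhf)

sublocale B: inj_model B E.urep
  by (rule E.inj_model_uhf)

sublocale star_pair A D.urep B E.urep ..

abbreviation "tr \<equiv> tlift D.urep E.urep"

text \<open>Up to \<open>tensor_eq\<close> this is a finite-dimensional algebra. It is closed under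
  the squaring step of \<open>cstar_dominate\<close>, which is why the level is kept fixed.\<close>

definition fin :: "nat \<Rightarrow> (_ \<times> _) list set" where
  "fin n = lists ({x \<in> carrier A. D.urep x \<in> D.level n} \<times> {y \<in> carrier B. E.urep y \<in> E.level n})"

lemma fin_subset: "t \<in> fin n \<Longrightarrow> t \<in> T"
  by (auto simp: fin_def in_lists_conv_set)

lemma fin_mono: "m \<le> n \<Longrightarrow> fin m \<subseteq> fin n"
  using D.level_mono[of m n] E.level_mono[of m n] by (auto simp: fin_def in_lists_conv_set)

lemma fin_closed:
  assumes "t \<in> fin n"
  shows "tensor_mult A B (tensor_invol A B t) t \<in> fin n"
proof -
  have t: "(x, y) \<in> set t \<Longrightarrow> (x \<in> carrier A \<and> D.urep x \<in> D.level n) \<and> y \<in> carrier B \<and> E.urep y \<in> E.level n" for x y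
    using assms by (auto simp: fin_def in_lists_conv_set)
  note h = A.hom[unfolded contr_hom_def] B.hom[unfolded contr_hom_def]
  show ?thesis
    by (auto simp: fin_def in_lists_conv_set tensor_mult_def tensor_invol_def h
        A.mult_closed B.mult_closed A.invol_closed B.invol_closed D.level_closed E.level_closed dest!: t)
qed

text \<open>Up to \<open>tensor_eq\<close>, t is a combination of products of matrix units. Each
  coefficient is an inner product of \<open>tr t\<close> between unit vectors, hence at most its
  norm.\<close>

lemma fin_dominate:
  assumes p: "tensor_cstar_seminorm A B p"
  shows "\<exists>C. \<forall>t\<in>fin n. p t \<le> C * norm (tr t)"
proof -
  define I where "I = {..<q ^ n} \<times> {..<q ^ n}"
  define I' where "I' = {..<q' ^ n} \<times> {..<q' ^ n}"
  define e where "e = D.unit_elem n"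
  define e' where "e' = E.unit_elem n"
  define cf where "cf = D.coef n"
  define cf' where "cf' = E.coef n"
  have e: "e a \<in> carrier A" for a
    unfolding e_def by (rule D.unit_elem_in)
  have e': "e' a \<in> carrier B" for a
    unfolding e'_def by (rule E.unit_elem_in)
  have fin: "finite I" "finite I'"
    by (simp_all add: I_def I'_def)
  have exp: "D.urep x = (\<Sum>a\<in>I. cf a (D.urep x) *\<^sub>C D.urep (e a))"
    if "D.urep x \<in> D.level n" for x
    unfolding cf_def e_def I_def by (rule D.level_expand[OF that])
  have exp': "E.urep x = (\<Sum>a\<in>I'. cf' a (E.urep x) *\<^sub>C E.urep (e' a))"
    if "E.urep x \<in> E.level n" for x
    unfolding cf'_def e'_def I'_def by (rule E.level_expand[OF that])
  define C where "C = (\<lambda>(a, b) t. \<Sum>(x, y)\<leftarrow>t. cf a (D.urep x) * cf' b (E.urep y))"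
  have C: "cmod (C z t) \<le> norm (tr t)" for z t
  proof -
    obtain i k l m where z: "z = ((i, k), (l, m))"
      by (metis surj_pair)
    let ?u = "tv (ap (D.V n i) (ket undefined)) (ap (E.V n l) (ket undefined))"
    let ?v = "tv (ap (D.V n k) (ket undefined)) (ap (E.V n m) (ket undefined))"
    have "C z t = cip ?u (ap (tr t) ?v)"
      by (induction t) (auto simp: z C_def cf_def cf'_def D.coef_def E.coef_def cip_add_right ap_tens_tv cip_tv)
    moreover have "norm ?u = 1" "norm ?v = 1"
      by (simp_all add: ap_shift_op D.wmap_inj E.wmap_inj push_ket tv_ket)
    ultimately show ?thesis
      using norm_cip_le[of ?u "ap (tr t) ?v"] norm_ap[of "tr t" ?v] by simp
  qed
  \<comment> \<open>Formal sums are lists, so an order of the index pairs has to be fixed.\<close>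
  obtain L where L: "set L = I \<times> I'" "distinct L"
    using finite_distinct_list fin by (metis finite_cartesian_product)
  have "p t \<le> (\<Sum>(a, b)\<in>I \<times> I'. anorm A (e a) * anorm B (e' b)) * norm (tr t)" if t: "t \<in> fin n" for t
  proof -
    define t' where "t' = map (\<lambda>(a, b). (C (a, b) t \<odot>\<^bsub>A\<^esub> e a, e' b)) L"
    have t': "t' \<in> T"
      using L(1) e e' by (auto simp: t'_def in_lists_conv_set A.smult_closed)
    have "tensor_eq A B t t'"
      unfolding tensor_eq_def
    proof (intro allI impI)
      fix F assume F: "bilinear_form A B F"
      have F1: "F x y = (\<Sum>a\<in>I. \<Sum>b\<in>I'. cf a (D.urep x) * cf' b (E.urep y) * F (e a) (e' b))"
        if x: "x \<in> carrier A" "D.urep x \<in> D.level n" and y: "y \<in> carrier B" "E.urep y \<in> E.level n" for x y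
      proof -
        have "F x y = (\<Sum>a\<in>I. cf a (D.urep x) * F (e a) y)"
          by (rule A.linear_expand[OF _ _ fin(1) e x(1) exp[OF x(2)]])
             (use F y in \<open>auto simp: bilinear_form_def\<close>)
        also have "\<dots> = (\<Sum>a\<in>I. cf a (D.urep x) * (\<Sum>b\<in>I'. cf' b (E.urep y) * F (e a) (e' b)))"
        proof (intro sum.cong refl arg_cong[where f = "\<lambda>u. _ * u"])
          fix a assume "a \<in> I"
          thus "F (e a) y = (\<Sum>b\<in>I'. cf' b (E.urep y) * F (e a) (e' b))"
            by (intro B.linear_expand[OF _ _ fin(2) e' y(1) exp'[OF y(2)]])
               (use F e in \<open>auto simp: bilinear_form_def\<close>)
        qed
        finally show ?thesis
          by (simp add: sum_distrib_left mult.assoc)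
      qed
      have "(\<Sum>(x, y)\<leftarrow>t. F x y) = (\<Sum>a\<in>I. \<Sum>b\<in>I'. C (a, b) t * F (e a) (e' b))"
        using t unfolding fin_def
      proof (induction t)
        case (Cons z t)
        obtain x y where "z = (x, y)" by (cases z)
        thus ?case
          using Cons F1[of x y] by (auto simp: C_def distrib_right sum.distrib)
      qed (simp add: C_def)
      also have "\<dots> = (\<Sum>(a, b)\<leftarrow>L. C (a, b) t * F (e a) (e' b))"
        by (simp add: sum.cartesian_product L sum_list_distinct_conv_sum_set)
      also have "\<dots> = (\<Sum>(x, y)\<leftarrow>t'. F x y)"
        unfolding t'_def map_map using L(1) F e e'
        by (intro arg_cong[where f = sum_list] map_cong) (auto simp: bilinear_form_def)
      finally show "(\<Sum>(x, y)\<leftarrow>t. F x y) = (\<Sum>(x, y)\<leftarrow>t'. F x y)" .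
    qed
    hence "p t = p t'"
      using fin_subset[OF t] t' by (intro seminormD(2)[OF p])
    also have "\<dots> \<le> (\<Sum>(x, y)\<leftarrow>t'. p [(x, y)])"
      by (rule seminorm_le_sum[OF p t'])
    also have "\<dots> = (\<Sum>(a, b)\<leftarrow>L. cmod (C (a, b) t) * p [(e a, e' b)])"
    proof -
      have "p [(c \<odot>\<^bsub>A\<^esub> x, y)] = cmod c * p [(x, y)]" if "x \<in> carrier A" "y \<in> carrier B" for c x y
        using seminormD(4)[OF p, of "[(x, y)]" c] that by (simp add: tensor_smult_def)
      thus ?thesis
        unfolding t'_def map_map using L(1) e e'
        by (intro arg_cong[where f = sum_list] map_cong) auto
    qed
    also have "\<dots> = (\<Sum>(a, b)\<in>I \<times> I'. cmod (C (a, b) t) * p [(e a, e' b)])"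
      by (simp add: L sum_list_distinct_conv_sum_set)
    also have "\<dots> \<le> (\<Sum>(a, b)\<in>I \<times> I'. norm (tr t) * (anorm A (e a) * anorm B (e' b)))"
      using e e' by (intro sum_mono) (auto intro!: mult_mono C seminormD(6)[OF p] seminormD(1)[OF p])
    finally show ?thesis
      by (simp add: sum_distrib_left sum_distrib_right case_prod_unfold mult.commute)
  qed
  thus ?thesis by blast
qed

lemma seminorm_le_fin:
  assumes p: "tensor_cstar_seminorm A B p" and t: "t \<in> fin n"
  shows "p t \<le> norm (tr t)"
proof -
  obtain C where "\<And>t. t \<in> fin n \<Longrightarrow> p t \<le> C * norm (tr t)"
    using fin_dominate[OF p] by blast
  thus ?thesis
    by (rule cstar_dominate[where sq = "\<lambda>t. tensor_mult A B (tensor_invol A B t) t" and D = "fin n", rotated 3])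
       (simp_all add: fin_closed fin_subset t seminormD(1,5)[OF p] seminormD(5)[OF tlift_seminorm[OF A.hom B.hom]])
qed

text \<open>One approximant serves all seminorms at once, since \<open>seminorm_le\<close> uses it
  for p and for the operator norm together. This is possible because each summand is controlled by
  norms in the factors alone.\<close>

lemma approx:
  assumes "t \<in> T" "e > 0"
  shows "\<exists>n. \<exists>t'\<in>fin n. \<forall>p. tensor_cstar_seminorm A B p \<longrightarrow> p (tdiff t t') \<le> e"
  using assms
proof (induction t arbitrary: e)
  case Nil
  have "p (tdiff [] []) \<le> e" if "tensor_cstar_seminorm A B p" for p
    using seminorm_le_sum[OF that, of "[]"] Nil by (simp add: tdiff_def tensor_smult_def)
  thus ?case
    by (intro exI[of _ 0] bexI[of _ "[]"]) (auto simp: fin_def)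
next
  case (Cons z t)
  have t: "t \<in> T" and "z \<in> carrier A \<times> carrier B"
    using Cons.hyps by simp_all
  then obtain x y where z: "z = (x, y)" "x \<in> carrier A" "y \<in> carrier B"
    by (elim SigmaE)
  obtain n t' where t': "t' \<in> fin n" "\<And>p. tensor_cstar_seminorm A B p \<Longrightarrow> p (tdiff t t') \<le> e / 2"
    using Cons.IH[of "e / 2"] Cons.prems t by auto
  \<comment> \<open>The 1 allows for the approximant of x, whose norm exceeds that of x by at most
    \<open>\<delta> \<le> 1\<close>.\<close>
  define K where "K = norm (D.urep x) + norm (E.urep y) + 1"
  have K: "K > 0"
    by (simp add: K_def add_nonneg_pos)
  define \<delta> where "\<delta> = min 1 (e / 2 / K)"
  have \<delta>: "\<delta> > 0" "\<delta> \<le> 1" "\<delta> * K \<le> e / 2"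
    using K Cons.prems by (auto simp: \<delta>_def min_def field_simps)
  have "D.urep x \<in> closure (\<Union>n. D.level n)" "E.urep y \<in> closure (\<Union>n. E.level n)"
    using z by (auto simp flip: D.image_urep E.image_urep)
  hence "\<exists>S\<in>\<Union>n. D.level n. dist S (D.urep x) < \<delta>" "\<exists>R\<in>\<Union>n. E.level n. dist R (E.urep y) < \<delta>"
    using \<delta>(1) unfolding closure_approachable by simp_all
  then obtain S R k l where S: "S \<in> D.level k" "dist S (D.urep x) < \<delta>" and R: "R \<in> E.level l" "dist R (E.urep y) < \<delta>"
    by (elim bexE UN_E)
  have "S \<in> (\<Union>n. D.level n)" "R \<in> (\<Union>n. E.level n)"
    using S(1) R(1) by auto
  hence "S \<in> D.urep ` carrier A" "R \<in> E.urep ` carrier B"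
    by (simp_all only: D.image_urep E.image_urep closure_subset[THEN subsetD])
  then obtain x' y' where x': "x' \<in> carrier A" "S = D.urep x'" and y': "y' \<in> carrier B" "R = E.urep y'"
    by (elim imageE)
  define N where "N = max n (max k l)"
  have "n \<le> N" "k \<le> N" "l \<le> N"
    by (auto simp: N_def)
  hence "t' \<in> fin N" "D.urep x' \<in> D.level N" "E.urep y' \<in> E.level N"
    using subsetD[OF fin_mono t'(1)] subsetD[OF D.level_mono S(1)] subsetD[OF E.level_mono R(1)] x' y' by auto
  hence fin: "(x', y') # t' \<in> fin N"
    using x' y' by (simp add: fin_def)
  have "p (tdiff (z # t) ((x', y') # t')) \<le> e" if p: "tensor_cstar_seminorm A B p" for p
  proof -
    have "t' \<in> T"
      by (rule fin_subset[OF t'(1)])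
    moreover have "[(x, y)] \<in> T" "[(x', y')] \<in> T" "z # t \<in> T" "(x', y') # t' \<in> T"
      using t \<open>t' \<in> T\<close> z x' y' by simp_all
    ultimately have T: "t' \<in> T" "tdiff t t' \<in> T" "tdiff [(x, y)] [(x', y')] \<in> T" "tdiff (z # t) ((x', y') # t') \<in> T"
      using t tdiff_closed by blast+
    have "p (tdiff (z # t) ((x', y') # t')) = p (tdiff [(x, y)] [(x', y')] @ tdiff t t')"
      using T tensor_closed(1)[OF T(3) T(2)]
      by (intro seminormD(2)[OF p]) (auto simp: tensor_eq_def tdiff_def tensor_smult_def z)
    also have "\<dots> \<le> p (tdiff [(x, y)] [(x', y')]) + p (tdiff t t')"
      by (rule seminormD(3)[OF p T(3) T(2)])
    also have "p (tdiff t t') \<le> e / 2"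
      by (rule t'(2)[OF p])
    also have "p (tdiff [(x, y)] [(x', y')]) \<le>
        norm (D.urep x - D.urep x') * norm (E.urep y) + norm (D.urep x') * norm (E.urep y - E.urep y')"
      by (rule seminorm_elem_diff[OF p z(2) x'(1) z(3) y'(1)])
    also have "\<dots> \<le> \<delta> * norm (E.urep y) + (norm (D.urep x) + 1) * \<delta>"
    proof (intro add_mono mult_mono)
      show "norm (D.urep x - D.urep x') \<le> \<delta>" "norm (E.urep y - E.urep y') \<le> \<delta>"
        using S(2) R(2) x'(2) y'(2) by (simp_all add: dist_norm norm_minus_commute)
      thus "norm (D.urep x') \<le> norm (D.urep x) + 1"
        using norm_triangle_ineq2[of "D.urep x'" "D.urep x"] \<delta>(2) by (simp add: norm_minus_commute)
    qed (use \<delta>(1) in auto)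
    also have "\<dots> = \<delta> * K"
      by (simp add: K_def algebra_simps)
    finally show ?thesis
      using \<delta>(3) by linarith
  qed
  thus ?case
    using fin by blast
qed

text \<open>On an approximant of fixed level p is at most the operator norm, and passing between t
  and the approximant costs e / 2 for each of the two seminorms.\<close>

lemma seminorm_le:
  assumes p: "tensor_cstar_seminorm A B p" and t: "t \<in> T"
  shows "p t \<le> norm (tr t)"
proof (rule field_le_epsilon)
  fix e :: real assume "e > 0"
  then obtain n t' where t': "t' \<in> fin n" "\<And>p. tensor_cstar_seminorm A B p \<Longrightarrow> p (tdiff t t') \<le> e / 2"
    using approx[OF t, of "e / 2"] by auto
  note p0 = tlift_seminorm[OF A.hom B.hom]
  have "p t \<le> p t' + e / 2"
    using seminorm_tdiff(1)[OF p t fin_subset[OF t'(1)]] t'(2)[OF p] by linarith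
  also have "p t' \<le> norm (tr t')"
    by (rule seminorm_le_fin[OF p t'(1)])
  also have "\<dots> \<le> norm (tr t) + e / 2"
    using seminorm_tdiff(2)[OF p0 t fin_subset[OF t'(1)]] t'(2)[OF p0] by linarith
  finally show "p t \<le> norm (tr t) + e"
    by simp
qed

text \<open>The supremum is a maximum, because the operator norm is itself one of the
  seminorms.\<close>

lemma tensor_norm: "t \<in> T \<Longrightarrow> anorm (alg_tensor A B) t = norm (tr t)"
  unfolding alg_tensor_def
  by (simp, rule cSup_eq_maximum) (use seminorm_le tlift_seminorm[OF A.hom B.hom] in auto)

text \<open>Contractivity follows from maximality of the norm, for any pair of representations and
  not only for the modelling pair. The reversed product depends on this.\<close>

lemma contr_hom_tlift:
  assumes f: "contr_hom A f" and g: "contr_hom B g"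
  shows "contr_hom (alg_tensor A B) (tlift f g)"
proof -
  have "norm (tlift f g t) \<le> anorm (alg_tensor A B) t" if "t \<in> T" for t
    using seminorm_le[OF tlift_seminorm[OF f g] that] tensor_norm[OF that] by simp
  thus ?thesis
    using f g unfolding contr_hom_def[of "alg_tensor A B"]
    by (auto simp: alg_tensor_def tlift_tensor[OF f g] contr_hom_def)
qed

lemma star_model_tensor: "star_model (alg_tensor A B) tr"
proof
  show "contr_hom (alg_tensor A B) tr"
    by (rule contr_hom_tlift[OF A.hom B.hom])
  have c: "carrier (alg_tensor A B) = T"
    by (simp add: alg_tensor_def)
  show "x \<oplus>\<^bsub>alg_tensor A B\<^esub> y \<in> carrier (alg_tensor A B)"
    "x \<otimes>\<^bsub>alg_tensor A B\<^esub> y \<in> carrier (alg_tensor A B)"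
    if "x \<in> carrier (alg_tensor A B)" "y \<in> carrier (alg_tensor A B)" for x y
    using that tensor_closed(1,3)[of x y] unfolding c by (simp_all add: alg_tensor_def del: append_in_lists_conv)
  show "k \<odot>\<^bsub>alg_tensor A B\<^esub> x \<in> carrier (alg_tensor A B)" "invol (alg_tensor A B) x \<in> carrier (alg_tensor A B)"
    "anorm (alg_tensor A B) x = norm (tr x)"
    if "x \<in> carrier (alg_tensor A B)" for x k
    using that tensor_closed(2,4)[of x x] unfolding c by (simp_all add: tensor_norm) (simp_all add: alg_tensor_def)
  show "\<one>\<^bsub>alg_tensor A B\<^esub> \<in> carrier (alg_tensor A B)"
    unfolding c by (simp add: alg_tensor_def A.one_closed B.one_closed)
qed

end

section \<open>Models of Hilbert spaces and representations\<close>

text \<open>Transport of structure: the Hilbert space axioms and equalities of vectors are verified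
  among square summable families.\<close>

locale hilbert_model =
  fixes H :: "'h inner_module" and W :: "'h \<Rightarrow> 'i ell2"
  assumes bij: "bij_betw W (carrier H) UNIV"
    and add: "x \<in> carrier H \<Longrightarrow> y \<in> carrier H \<Longrightarrow> x \<oplus>\<^bsub>H\<^esub> y \<in> carrier H \<and> W (x \<oplus>\<^bsub>H\<^esub> y) = W x + W y"
    and smult: "x \<in> carrier H \<Longrightarrow> c \<odot>\<^bsub>H\<^esub> x \<in> carrier H \<and> W (c \<odot>\<^bsub>H\<^esub> x) = c *\<^sub>C W x"
    and zero: "\<zero>\<^bsub>H\<^esub> \<in> carrier H" "W \<zero>\<^bsub>H\<^esub> = 0"
    and inner: "x \<in> carrier H \<Longrightarrow> y \<in> carrier H \<Longrightarrow> cinner H x y = cip (W x) (W y)"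
begin

definition Wi :: "'i ell2 \<Rightarrow> 'h" where
  "Wi = inv_into (carrier H) W"

lemma Wi_in [simp]: "Wi v \<in> carrier H"
  unfolding Wi_def by (rule inv_into_into) (use bij in \<open>simp add: bij_betw_def\<close>)

lemma W_Wi [simp]: "W (Wi v) = v"
  unfolding Wi_def by (rule f_inv_into_f) (use bij in \<open>simp add: bij_betw_def\<close>)

lemma Wi_W [simp]: "x \<in> carrier H \<Longrightarrow> Wi (W x) = x"
  unfolding Wi_def by (rule inv_into_f_f) (use bij in \<open>simp_all add: bij_betw_def\<close>)

lemma W_eqD: "W x = W y \<Longrightarrow> x \<in> carrier H \<Longrightarrow> y \<in> carrier H \<Longrightarrow> x = y"
  by (metis Wi_W)

lemma hnorm_W: "x \<in> carrier H \<Longrightarrow> hnorm H x = norm (W x)"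
  by (simp add: hnorm_def inner cip_self)

sublocale norm_model H "hnorm H" W
  by unfold_locales (auto simp: add smult hnorm_W)

lemma hilbert_space: "hilbert_space H"
proof -
  have "abelian_group H"
  proof (rule abelian_groupI)
    fix x assume x: "x \<in> carrier H"
    show "\<exists>y\<in>carrier H. y \<oplus>\<^bsub>H\<^esub> x = \<zero>\<^bsub>H\<^esub>"
      by (rule bexI[of _ "(-1) \<odot>\<^bsub>H\<^esub> x"]) (auto intro!: W_eqD simp: x add smult zero)
  qed (auto intro!: W_eqD simp: add smult zero add_ac)
  hence "Module.module (class_ring :: complex ring) H"
    unfolding module_def module_axioms_def
    by (auto simp: class_ring_simps class_cring.is_cring smult
        intro!: W_eqD simp: add cscale_add_left cscale_add_right)
  moreover have "\<exists>x\<in>carrier H. (\<lambda>n. hnorm H (vdiff H (X n) x)) \<longlonglongrightarrow> 0" if X: "X \<in> cauchy_seqs H (hnorm H)" for X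
  proof -
    obtain v where v: "(\<lambda>n. W (X n)) \<longlonglongrightarrow> v"
      using cs_limit[OF X] by blast
    have "hnorm H (vdiff H (X n) (Wi v)) = norm (W (X n) - v)" for n
      using X by (subst nrm_vdiff) (simp_all add: cauchy_seqs_iff)
    moreover have "(\<lambda>n. norm (W (X n) - v)) \<longlonglongrightarrow> 0"
      using v by (simp add: LIM_zero tendsto_norm_zero)
    ultimately show ?thesis
      by (intro bexI[of _ "Wi v"]) auto
  qed
  moreover have "cip v v \<in> \<real>\<^sub>\<ge>\<^sub>0" for v :: "'i ell2"
    by (simp add: cip_self)
  moreover have "x = \<zero>\<^bsub>H\<^esub>" if "x \<in> carrier H" "cip (W x) (W x) = 0" for x
    using that by (intro W_eqD) (simp_all add: cip_self zero)
  ultimately show ?thesis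
    unfolding hilbert_space_def
    by (auto simp: add smult inner cip_add_right cip_cscale_right simp flip: cip_commute)
qed

text \<open>The restriction matches the extensionality in \<open>bounded_ops\<close>, without which
  the description in \<open>rep_tensor\<close> would have no unique solution.\<close>

definition hop :: "'i cop \<Rightarrow> 'h \<Rightarrow> 'h" where
  "hop T = restrict (\<lambda>\<xi>. Wi (ap T (W \<xi>))) (carrier H)"

definition hrep :: "'a star_alg \<Rightarrow> ('a \<Rightarrow> 'i cop) \<Rightarrow> 'a \<Rightarrow> 'h \<Rightarrow> 'h" where
  "hrep A f = restrict (\<lambda>x. hop (f x)) (carrier A)"

lemma hop_in: "\<xi> \<in> carrier H \<Longrightarrow> hop T \<xi> \<in> carrier H"
  by (simp add: hop_def)

lemma W_hop: "\<xi> \<in> carrier H \<Longrightarrow> W (hop T \<xi>) = ap T (W \<xi>)"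
  by (simp add: hop_def)

lemma hop_bounded: "hop T \<in> bounded_ops H"
proof -
  have "hnorm H (hop T x) \<le> norm T * hnorm H x" if "x \<in> carrier H" for x
    using that norm_ap[of T "W x"] by (simp add: hnorm_W hop_in W_hop)
  moreover have "hop T (x \<oplus>\<^bsub>H\<^esub> y) = hop T x \<oplus>\<^bsub>H\<^esub> hop T y" if "x \<in> carrier H" "y \<in> carrier H" for x y
    using that by (intro W_eqD) (auto simp: hop_in W_hop add ap_linear)
  moreover have "hop T (c \<odot>\<^bsub>H\<^esub> x) = c \<odot>\<^bsub>H\<^esub> hop T x" if "x \<in> carrier H" for c x
    using that by (intro W_eqD) (auto simp: hop_in W_hop smult ap_cscale)
  moreover have "hop T \<in> carrier H \<rightarrow>\<^sub>E carrier H"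
    by (auto simp: hop_def)
  ultimately show ?thesis
    unfolding bounded_ops_def by blast
qed

lemma hrep_representation:
  assumes A: "star_model A j" and f: "contr_hom A f"
  shows "star_representation A H (hrep A f)"
proof -
  interpret A: star_model A j by (rule A)
  note h = f[unfolded contr_hom_def]
  have le: "hnorm H (hop (f x) \<xi>) \<le> anorm A x * hnorm H \<xi>" if "x \<in> carrier A" "\<xi> \<in> carrier H" for x \<xi>
  proof -
    have "norm (ap (f x) (W \<xi>)) \<le> norm (f x) * norm (W \<xi>)"
      by (rule norm_ap)
    also have "\<dots> \<le> anorm A x * norm (W \<xi>)"
      using h that by (intro mult_right_mono) auto
    finally show ?thesis
      using that by (simp add: hnorm_W hop_in W_hop)
  qed
  have "hrep A f \<in> carrier A \<rightarrow>\<^sub>E bounded_ops H"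
    by (auto simp: hrep_def hop_bounded)
  thus ?thesis
    unfolding star_representation_def
    by (auto simp: hilbert_space hrep_def A.add_closed A.mult_closed A.smult_closed A.invol_closed A.one_closed
        h inner hop_in W_hop ap_cscale_left cip_adj add smult le intro!: W_eqD)
qed

end

text \<open>The theorem takes Hilbert spaces whose vectors are complex sequences, so the square
  summable ones are made into a carrier inside that type.\<close>

definition ell2_module :: "(nat \<Rightarrow> complex) inner_module" where
  "ell2_module = \<lparr> carrier = range coord, mult = undefined, one = undefined, zero = coord 0,
     add = (\<lambda>x y. coord (Abs_ell2 x + Abs_ell2 y)), smult = (\<lambda>c x. coord (c *\<^sub>C Abs_ell2 x)),
     cinner = (\<lambda>x y. cip (Abs_ell2 x) (Abs_ell2 y)) \<rparr>"

lemma hilbert_model_ell2: "hilbert_model ell2_module Abs_ell2"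
proof
  show "bij_betw Abs_ell2 (carrier ell2_module) (UNIV :: nat ell2 set)"
    by (rule bij_betw_byWitness[where f' = coord]) (auto simp: ell2_module_def coord_inverse)
qed (auto simp: ell2_module_def coord_inverse)

lemma tv_dense:
  assumes "csubspace S" "closed S" "\<And>x y. tv x y \<in> S"
  shows "v \<in> S"
  by (rule closed_csubspace_kets[OF assms(1,2)]) (use assms(3) in \<open>auto simp flip: tv_ket\<close>)

section \<open>Hilbert tensor products\<close>

locale hilbert_pair = H: hilbert_model H W + K: hilbert_model K W'
  for H :: "'h inner_module" and W :: "'h \<Rightarrow> 'i ell2" and K :: "'k inner_module" and W' :: "'k \<Rightarrow> 'l ell2"
begin

abbreviation "P \<equiv> pre_hilbert_tensor H K"

definition jt :: "('h \<times> 'k) list \<Rightarrow> ('i \<times> 'l) ell2" where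
  "jt t = (\<Sum>(x, y)\<leftarrow>t. tv (W x) (W' y))"

definition Wt :: "(nat \<Rightarrow> ('h \<times> 'k) list) set \<Rightarrow> ('i \<times> 'l) ell2" where
  "Wt = cpl_lift jt"

lemma jt_simps [simp]: "jt [] = 0" "jt ((x, y) # t) = tv (W x) (W' y) + jt t" "jt (s @ t) = jt s + jt t"
  by (simp_all add: jt_def)

lemma P_inner:
  assumes "s \<in> carrier P" "t \<in> carrier P"
  shows "cinner P s t = cip (jt s) (jt t)"
proof -
  have 1: "(\<Sum>(x', y')\<leftarrow>t. cinner H x x' * cinner K y y') = cip (tv (W x) (W' y)) (jt t)"
    if "x \<in> carrier H" "y \<in> carrier K" "t \<in> lists (carrier H \<times> carrier K)" for x y t
    using that(3) by (induction t) (auto simp: cip_add_right cip_tv H.inner K.inner that)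
  have "(\<Sum>(x, y)\<leftarrow>s. \<Sum>(x', y')\<leftarrow>t. cinner H x x' * cinner K y y') = cip (jt s) (jt t)"
    if "s \<in> lists (carrier H \<times> carrier K)" "t \<in> lists (carrier H \<times> carrier K)"
    using that(1) by (induction s) (auto simp: cip_add_left 1[OF _ _ that(2)])
  thus ?thesis
    using assms by (simp add: pre_hilbert_tensor_def)
qed

sublocale P: norm_model P "hnorm P" jt
proof
  fix x y c assume x: "x \<in> carrier P"
  show "jt (c \<odot>\<^bsub>P\<^esub> x) = c *\<^sub>C jt x"
    using x unfolding pre_hilbert_tensor_def
    by (simp, induction x) (auto simp: tensor_smult_def H.smult tv_cscale cscale_add_right)
  show "c \<odot>\<^bsub>P\<^esub> x \<in> carrier P"
    using x by (auto simp: pre_hilbert_tensor_def tensor_smult_def H.smult in_lists_conv_set)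
  show "hnorm P x = norm (jt x)"
    by (simp add: hnorm_def P_inner x cip_self)
qed (auto simp: pre_hilbert_tensor_def)

lemma tensor_sel:
  "carrier (hilbert_tensor H K) = P.cs // P.rel"
  "zero (hilbert_tensor H K) = P.rel `` {\<lambda>_. \<zero>\<^bsub>P\<^esub>}"
  "add (hilbert_tensor H K) = lift_binary P.rel (add P)"
  "smult (hilbert_tensor H K) c = lift_unary P.rel (smult P c)"
  "cinner (hilbert_tensor H K) S T = lim (\<lambda>n. cinner P (class_repr S n) (class_repr T n))"
  by (simp_all add: hilbert_tensor_def Let_def)

lemma P_zero: "\<zero>\<^bsub>P\<^esub> = []" "[] \<in> carrier P"
  by (simp_all add: pre_hilbert_tensor_def)

lemma P_single: "x \<in> carrier H \<Longrightarrow> y \<in> carrier K \<Longrightarrow> [(x, y)] \<in> carrier P"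
  by (simp add: pre_hilbert_tensor_def)

lemma elem_in: "x \<in> carrier H \<Longrightarrow> y \<in> carrier K \<Longrightarrow> hilbert_elem_tensor H K x y \<in> carrier (hilbert_tensor H K)"
  unfolding hilbert_elem_tensor_def tensor_sel by (intro P.class_in P.const_cs P_single)

lemma Wt_elem: "x \<in> carrier H \<Longrightarrow> y \<in> carrier K \<Longrightarrow> Wt (hilbert_elem_tensor H K x y) = tv (W x) (W' y)"
  unfolding hilbert_elem_tensor_def Wt_def
  by (subst P.cpl_lift_const[OF P.contr_map_j P_single]) simp_all

text \<open>Injectivity is that of every completion model; surjectivity holds because the elementary
  tensors span a dense subspace.\<close>

sublocale HT: hilbert_model "hilbert_tensor H K" Wt
proof
  have cs: "csubspace (jt ` carrier P)"
    by (rule P.csubspace_range[OF P_zero(2)])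
  have "tv u v \<in> jt ` carrier P" for u v
    by (rule image_eqI[OF _ P_single[of "H.Wi u" "K.Wi v"]]) simp_all
  hence "tv u v \<in> closure (jt ` carrier P)" for u v
    by (rule closure_subset[THEN subsetD])
  hence "v \<in> closure (jt ` carrier P)" for v
    by (rule tv_dense[OF csubspace_closure[OF cs] closed_closure])
  hence "Wt ` carrier (hilbert_tensor H K) = UNIV"
    unfolding tensor_sel Wt_def P.image_J by (rule UNIV_eq_I[symmetric])
  thus "bij_betw Wt (carrier (hilbert_tensor H K)) UNIV"
    using P.inj_on_J by (simp add: bij_betw_def tensor_sel Wt_def)
next
  fix x y assume xy: "x \<in> carrier (hilbert_tensor H K)" "y \<in> carrier (hilbert_tensor H K)"
  show "x \<oplus>\<^bsub>hilbert_tensor H K\<^esub> y \<in> carrier (hilbert_tensor H K) \<and> Wt (x \<oplus>\<^bsub>hilbert_tensor H K\<^esub> y) = Wt x + Wt y"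
    using P.cpl_add[OF P.contr_map_j, of x y] xy by (simp add: tensor_sel Wt_def)
  have c: "class_repr x \<in> P.cs" "class_repr y \<in> P.cs"
    using xy P.class_elim(1) by (auto simp: tensor_sel)
  hence "(\<lambda>n. cinner P (class_repr x n) (class_repr y n)) = (\<lambda>n. cip (jt (class_repr x n)) (jt (class_repr y n)))"
    by (auto simp: P.cauchy_seqs_iff P_inner)
  moreover have "\<dots> \<longlonglongrightarrow> cip (Wt x) (Wt y)"
    unfolding Wt_def cpl_lift_def by (intro tendsto_cip P.cs_limit c)
  ultimately show "cinner (hilbert_tensor H K) x y = cip (Wt x) (Wt y)"
    by (simp add: tensor_sel limI)
next
  fix x c assume x: "x \<in> carrier (hilbert_tensor H K)"
  show "c \<odot>\<^bsub>hilbert_tensor H K\<^esub> x \<in> carrier (hilbert_tensor H K) \<and> Wt (c \<odot>\<^bsub>hilbert_tensor H K\<^esub> x) = c *\<^sub>C Wt x"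
    using P.cpl_smult[OF P.contr_map_j, of x] x by (simp add: tensor_sel Wt_def)
next
  show "\<zero>\<^bsub>hilbert_tensor H K\<^esub> \<in> carrier (hilbert_tensor H K)"
    unfolding tensor_sel P_zero(1) by (intro P.class_in P.const_cs P_zero(2))
  show "Wt \<zero>\<^bsub>hilbert_tensor H K\<^esub> = 0"
    unfolding tensor_sel P_zero(1) Wt_def by (subst P.cpl_lift_const[OF P.contr_map_j P_zero(2)]) simp
qed

end

section \<open>Vector states and uniqueness of continuous extensions\<close>

definition vector_state :: "'a star_alg \<Rightarrow> ('a \<Rightarrow> 'i cop) \<Rightarrow> 'i ell2 \<Rightarrow> 'a \<Rightarrow> complex" where
  "vector_state A f e = restrict (\<lambda>x. cip e (ap (f x) e)) (carrier A)"

lemma (in star_model) state_vector_state: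
  assumes f: "contr_hom A f" and e: "norm e = 1"
  shows "state A (vector_state A f e)"
proof -
  note h = f[unfolded contr_hom_def]
  have "cmod (cip e (ap (f x) e)) \<le> anorm A x" if "x \<in> carrier A" for x
    using norm_cip_le[of e "ap (f x) e"] norm_ap[of "f x" e] h that e by fastforce
  thus ?thesis
    unfolding state_def
    by (simp add: vector_state_def add_closed mult_closed smult_closed invol_closed one_closed h
        cip_add_right ap_cscale_left cip_cscale_right cip_adj' cip_self e)
qed

text \<open>The common form of the maps whose uniqueness is at stake: states, orbits of a fixed
  vector under a representation, and candidates for \<phi>.\<close>

definition bounded_additive :: "'a star_alg \<Rightarrow> ('a \<Rightarrow> 'v::cbanach) \<Rightarrow> bool" where
  "bounded_additive A g \<longleftrightarrow>
     (\<forall>x\<in>carrier A. \<forall>y\<in>carrier A. g (x \<oplus>\<^bsub>A\<^esub> y) = g x + g y) \<and>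
     (\<forall>c. \<forall>x\<in>carrier A. g (c \<odot>\<^bsub>A\<^esub> x) = c *\<^sub>C g x) \<and>
     (\<exists>C. \<forall>x\<in>carrier A. norm (g x) \<le> C * anorm A x)"

context inj_model
begin

lemma bounded_additive_diff:
  assumes "bounded_additive A g"
  shows "\<exists>C. \<forall>x\<in>carrier A. \<forall>y\<in>carrier A. norm (g x - g y) \<le> C * norm (j x - j y)"
proof -
  obtain C where C: "\<forall>x\<in>carrier A. norm (g x) \<le> C * anorm A x"
    using assms by (auto simp: bounded_additive_def)
  have "norm (g x - g y) \<le> C * norm (j x - j y)" if xy: "x \<in> carrier A" "y \<in> carrier A" for x y
  proof -
    have "g (vdiff A x y) = g x - g y"
      using assms xy by (simp add: vdiff_def bounded_additive_def smult_closed)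
    thus ?thesis
      using C vdiff_closed[OF xy] nrm_vdiff[OF xy] by metis
  qed
  thus ?thesis by blast
qed

text \<open>Agreement is expressed as a set of operators so that density of spans can be applied to
  it. Closedness of the whole image guarantees that a limit of such operators again comes from an
  element.\<close>

lemma agreement_set:
  assumes cl: "closed (j ` carrier A)" and g: "bounded_additive A g" and g': "bounded_additive A g'"
  defines "S \<equiv> j ` {x \<in> carrier A. g x = g' x}"
  shows "csubspace S" "closed S"
proof -
  show "csubspace S"
    unfolding csubspace_def
  proof (intro conjI ballI allI)
    have "0 = j (0 \<odot>\<^bsub>A\<^esub> \<one>\<^bsub>A\<^esub>)"
      by (simp add: j_smult one_closed)
    moreover have "g (0 \<odot>\<^bsub>A\<^esub> \<one>\<^bsub>A\<^esub>) = g' (0 \<odot>\<^bsub>A\<^esub> \<one>\<^bsub>A\<^esub>)"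
      using g g' by (simp add: bounded_additive_def one_closed)
    ultimately show "0 \<in> S"
      unfolding S_def by (intro image_eqI[of _ _ "0 \<odot>\<^bsub>A\<^esub> \<one>\<^bsub>A\<^esub>"]) (simp_all add: smult_closed one_closed)
    show "u + v \<in> S" if uv: "u \<in> S" "v \<in> S" for u v
    proof -
      obtain x y where "u = j x" "v = j y" "x \<in> carrier A" "y \<in> carrier A" "g x = g' x" "g y = g' y"
        using uv by (auto simp: S_def)
      thus ?thesis
        unfolding S_def using g g'
        by (intro image_eqI[of _ _ "x \<oplus>\<^bsub>A\<^esub> y"]) (auto simp: j_add add_closed bounded_additive_def)
    qed
    show "c *\<^sub>C u \<in> S" if u: "u \<in> S" for c u
    proof -
      obtain x where "u = j x" "x \<in> carrier A" "g x = g' x"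
        using u by (auto simp: S_def)
      thus ?thesis
        unfolding S_def using g g'
        by (intro image_eqI[of _ _ "c \<odot>\<^bsub>A\<^esub> x"]) (auto simp: j_smult smult_closed bounded_additive_def)
    qed
  qed
  obtain C C' where C: "\<And>x y. x \<in> carrier A \<Longrightarrow> y \<in> carrier A \<Longrightarrow> norm (g x - g y) \<le> C * norm (j x - j y)"
    "\<And>x y. x \<in> carrier A \<Longrightarrow> y \<in> carrier A \<Longrightarrow> norm (g' x - g' y) \<le> C' * norm (j x - j y)"
    using bounded_additive_diff[OF g] bounded_additive_diff[OF g'] by blast
  show "closed S"
    unfolding closed_sequential_limits
  proof (intro allI impI, elim conjE)
    fix X l assume X: "\<forall>n. X n \<in> S" "X \<longlonglongrightarrow> l"
    have "\<forall>n. X n \<in> j ` carrier A"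
      using X(1) by (auto simp: S_def)
    hence "l \<in> j ` carrier A"
      using cl X(2) unfolding closed_sequential_limits by blast
    then obtain x where x: "x \<in> carrier A" "l = j x"
      by blast
    have "\<exists>y. y \<in> carrier A \<and> g y = g' y \<and> X n = j y" for n
      using X(1) by (auto simp: S_def)
    then obtain Y where Y: "\<And>n. Y n \<in> carrier A" "\<And>n. g (Y n) = g' (Y n)" "\<And>n. X n = j (Y n)"
      by metis
    have lim: "(\<lambda>n. norm (j (Y n) - j x)) \<longlonglongrightarrow> 0"
      using X(2) by (simp add: Y(3)[symmetric] x(2)[symmetric] LIM_zero tendsto_norm_zero)
    have conv: "(\<lambda>n. f (Y n)) \<longlonglongrightarrow> f x"
      if "\<And>n. norm (f (Y n) - f x) \<le> K * norm (j (Y n) - j x)" for f :: "'a \<Rightarrow> 'v::cbanach" and K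
    proof (rule LIM_zero_cancel, rule Lim_null_comparison)
      show "\<forall>\<^sub>F n in sequentially. norm (f (Y n) - f x) \<le> K * norm (j (Y n) - j x)"
        using that by simp
      show "(\<lambda>n. K * norm (j (Y n) - j x)) \<longlonglongrightarrow> 0"
        using tendsto_mult_left[OF lim, of K] by simp
    qed
    have "(\<lambda>n. g (Y n)) \<longlonglongrightarrow> g x" "(\<lambda>n. g' (Y n)) \<longlonglongrightarrow> g' x"
      by (rule conv, rule C, (rule Y x)+)+
    hence "g x = g' x"
      unfolding Y(2) by (rule LIMSEQ_unique)
    thus "l \<in> S"
      using x by (auto simp: S_def)
  qed
qed

lemma agreementD:
  assumes "j ` carrier A \<subseteq> j ` {x \<in> carrier A. g x = g' x}" "x \<in> carrier A"
  shows "g x = g' x"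
proof -
  obtain y where "y \<in> carrier A" "g y = g' y" "j x = j y"
    using assms by auto
  thus ?thesis
    using inj_onD[OF inj, of x y] assms(2) by simp
qed

end

text \<open>The map goes through the common image, and every required identity is checked after
  applying the injective isometric \<open>jB\<close>.\<close>

lemma star_iso_models:
  assumes "inj_model A jA" "inj_model B jB" and eq: "jA ` carrier A = jB ` carrier B"
  defines "f \<equiv> restrict (\<lambda>x. inv_into (carrier B) jB (jA x)) (carrier A)"
  shows "star_iso A B f" "\<And>x. x \<in> carrier A \<Longrightarrow> jB (f x) = jA x"
proof -
  interpret A: inj_model A jA by (rule assms)
  interpret B: inj_model B jB by (rule assms)
  note hA = A.hom[unfolded contr_hom_def] and hB = B.hom[unfolded contr_hom_def]
  show f: "jB (f x) = jA x" if "x \<in> carrier A" for x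
    unfolding f_def using that by (simp add: f_inv_into_f flip: eq)
  have f_in: "f x \<in> carrier B" if "x \<in> carrier A" for x
    unfolding f_def using that by (simp add: inv_into_into flip: eq)
  have eqI: "u = v" if "jB u = jB v" "u \<in> carrier B" "v \<in> carrier B" for u v
    using inj_onD[OF B.inj] that by blast
  have "bij_betw f (carrier A) (carrier B)"
  proof (rule bij_betwI')
    show "(f x = f y) = (x = y)" if "x \<in> carrier A" "y \<in> carrier A" for x y
      using f that inj_onD[OF A.inj] by metis
    show "\<exists>x\<in>carrier A. y = f x" if y: "y \<in> carrier B" for y
    proof -
      obtain x where "x \<in> carrier A" "jA x = jB y"
        using eq y by (metis imageE imageI)
      thus ?thesis
        using f f_in y by (intro bexI[of _ x] eqI) auto
    qed
  qed (rule f_in)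
  moreover have "f \<in> extensional (carrier A)"
    by (simp add: f_def)
  ultimately show "star_iso A B f"
    unfolding star_iso_def
    by (auto intro!: eqI simp: f f_in hA hB A.add_closed A.mult_closed A.smult_closed A.invol_closed A.one_closed
        B.add_closed B.mult_closed B.smult_closed B.invol_closed B.one_closed A.norm B.norm)
qed

section \<open>The tensor product of two UHF algebras\<close>

context digit_pair
begin

abbreviation "CT \<equiv> cstar_tensor A B"

definition "JT = cpl_lift tr"

sublocale TM: star_model "alg_tensor A B" tr
  by (rule star_model_tensor)

sublocale CT: inj_model CT JT
  unfolding inj_model_def inj_model_axioms_def cstar_tensor_def JT_def
  using TM.star_model_completion TM.inj_on_completion by blast

lemma image_JT: "JT ` carrier CT = closure (tr ` T)"
  unfolding cstar_tensor_def JT_def TM.image_completion by (simp add: alg_tensor_def)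

lemma closed_JT: "closed (JT ` carrier CT)"
  by (simp add: image_JT)

lemma elem_in: "x \<in> carrier A \<Longrightarrow> y \<in> carrier B \<Longrightarrow> cstar_elem_tensor A B x y \<in> carrier CT"
  unfolding cstar_elem_tensor_def cstar_tensor_def by (rule TM.cls_in) (simp add: alg_tensor_def)

lemma contr_hom_lift: "contr_hom A f \<Longrightarrow> contr_hom B g \<Longrightarrow> contr_hom CT (cpl_lift (tlift f g))"
  unfolding cstar_tensor_def by (intro TM.contr_hom_completion contr_hom_tlift)

lemma lift_elem:
  assumes "contr_hom A f" "contr_hom B g" "x \<in> carrier A" "y \<in> carrier B"
  shows "cpl_lift (tlift f g) (cstar_elem_tensor A B x y) = tens (f x) (g y)"
  unfolding cstar_elem_tensor_def
  by (subst TM.cpl_lift_cls[OF contr_hom_tlift]) (use assms in \<open>simp_all add: alg_tensor_def\<close>)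

lemma JT_elem: "x \<in> carrier A \<Longrightarrow> y \<in> carrier B \<Longrightarrow> JT (cstar_elem_tensor A B x y) = tens (D.urep x) (E.urep y)"
  unfolding JT_def by (rule lift_elem[OF A.hom B.hom])

lemma tensor_span:
  assumes S: "csubspace S" "closed S" and el: "\<And>x y. x \<in> carrier A \<Longrightarrow> y \<in> carrier B \<Longrightarrow> tens (D.urep x) (E.urep y) \<in> S"
  shows "JT ` carrier CT \<subseteq> S"
proof -
  have "tr t \<in> S" if "t \<in> T" for t
    using that by (induction t) (use S el in \<open>auto simp: csubspace_def\<close>)
  thus ?thesis
    unfolding image_JT by (intro closure_minimal S) auto
qed

lemma tensor_agree:
  assumes g: "bounded_additive CT g" "bounded_additive CT g'"
    and eq: "\<And>x y. x \<in> carrier A \<Longrightarrow> y \<in> carrier B \<Longrightarrow> g (cstar_elem_tensor A B x y) = g' (cstar_elem_tensor A B x y)"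
    and x: "x \<in> carrier CT"
  shows "g x = g' x"
proof (rule CT.agreementD[OF _ x], rule tensor_span)
  show "csubspace (JT ` {x \<in> carrier CT. g x = g' x})" "closed (JT ` {x \<in> carrier CT. g x = g' x})"
    by (rule CT.agreement_set[OF closed_JT g])+
  show "tens (D.urep x) (E.urep y) \<in> JT ` {x \<in> carrier CT. g x = g' x}" if "x \<in> carrier A" "y \<in> carrier B" for x y
    using that by (intro image_eqI[of _ _ "cstar_elem_tensor A B x y"]) (simp_all add: JT_elem elem_in eq)
qed

lemma state_bounded_additive: "state X h \<Longrightarrow> bounded_additive X h"
  by (auto simp: state_def bounded_additive_def cscale_complex_def intro!: exI[of _ 1])

text \<open>The vector state at \<open>tv e e'\<close> has the prescribed values because
  \<open>cip\<close> factors on elementary tensors; uniqueness is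
  \<open>tensor_agree\<close>.\<close>

lemma state_tensor_vector_state:
  assumes f: "contr_hom A f" and g: "contr_hom B g" and e: "norm e = 1" "norm e' = 1"
  shows "state_tensor A B (vector_state A f e) (vector_state B g e') =
    vector_state CT (cpl_lift (tlift f g)) (tv e e')"
  unfolding state_tensor_def
proof (rule the_equality)
  have "norm (tv e e') = 1"
    by (simp add: norm_tv e)
  hence st: "state CT (vector_state CT (cpl_lift (tlift f g)) (tv e e'))"
    by (rule CT.state_vector_state[OF contr_hom_lift[OF f g]])
  have el: "vector_state CT (cpl_lift (tlift f g)) (tv e e') (cstar_elem_tensor A B x y) =
      vector_state A f e x * vector_state B g e' y" if "x \<in> carrier A" "y \<in> carrier B" for x y
    using that by (simp add: vector_state_def elem_in lift_elem f g ap_tens_tv cip_tv)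
  show "state CT (vector_state CT (cpl_lift (tlift f g)) (tv e e')) \<and> (\<forall>x\<in>carrier A. \<forall>y\<in>carrier B.
      vector_state CT (cpl_lift (tlift f g)) (tv e e') (cstar_elem_tensor A B x y) =
      vector_state A f e x * vector_state B g e' y)"
    using st el by blast
  fix h assume h: "state CT h \<and> (\<forall>x\<in>carrier A. \<forall>y\<in>carrier B.
      h (cstar_elem_tensor A B x y) = vector_state A f e x * vector_state B g e' y)"
  show "h = vector_state CT (cpl_lift (tlift f g)) (tv e e')"
  proof (rule extensionalityI)
    show "h \<in> extensional (carrier CT)"
      using h by (simp add: state_def)
    show "vector_state CT (cpl_lift (tlift f g)) (tv e e') \<in> extensional (carrier CT)"
      by (simp add: vector_state_def)
    show "h x = vector_state CT (cpl_lift (tlift f g)) (tv e e') x" if "x \<in> carrier CT" for x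
      by (rule tensor_agree[OF _ _ _ that]) (use h st el state_bounded_additive in auto)
  qed
qed

text \<open>Uniqueness uses density twice: in the Hilbert space, for the operators of elementary
  tensors, and then in the algebra, for a fixed vector.\<close>

lemma rep_tensor_hrep:
  fixes H :: "'h inner_module" and K :: "'g inner_module"
  assumes f: "contr_hom A f" and g: "contr_hom B g" and HK: "hilbert_pair H W K W'"
  shows "rep_tensor A B H K (hilbert_model.hrep H W A f) (hilbert_model.hrep K W' B g) =
    hilbert_model.hrep (hilbert_tensor H K) (hilbert_pair.Wt W W') CT (cpl_lift (tlift f g))"
  unfolding rep_tensor_def
proof (rule the_equality)
  interpret HK: hilbert_pair H W K W' by (rule HK)
  let ?HT = "hilbert_tensor H K" and ?F = "cpl_lift (tlift f g)"
  have rep: "star_representation CT ?HT (HK.HT.hrep CT ?F)"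
    by (rule HK.HT.hrep_representation[OF CT.star_model_axioms contr_hom_lift[OF f g]])
  have el: "HK.HT.hrep CT ?F (cstar_elem_tensor A B x y) (hilbert_elem_tensor H K \<xi> \<eta>) =
      hilbert_elem_tensor H K (HK.H.hrep A f x \<xi>) (HK.K.hrep B g y \<eta>)"
    if "x \<in> carrier A" "y \<in> carrier B" "\<xi> \<in> carrier H" "\<eta> \<in> carrier K" for x y \<xi> \<eta>
    using that
    by (intro HK.HT.W_eqD)
       (simp_all add: HK.HT.hrep_def HK.H.hrep_def HK.K.hrep_def elem_in HK.elem_in HK.HT.hop_in HK.HT.W_hop
          HK.H.hop_in HK.H.W_hop HK.K.hop_in HK.K.W_hop HK.Wt_elem lift_elem f g ap_tens_tv)
  show "star_representation CT ?HT (HK.HT.hrep CT ?F) \<and>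
    (\<forall>x\<in>carrier A. \<forall>y\<in>carrier B. \<forall>\<xi>\<in>carrier H. \<forall>\<eta>\<in>carrier K.
      HK.HT.hrep CT ?F (cstar_elem_tensor A B x y) (hilbert_elem_tensor H K \<xi> \<eta>) =
      hilbert_elem_tensor H K (HK.H.hrep A f x \<xi>) (HK.K.hrep B g y \<eta>))"
    using rep el by blast
  fix \<sigma> assume \<sigma>: "star_representation CT ?HT \<sigma> \<and>
    (\<forall>x\<in>carrier A. \<forall>y\<in>carrier B. \<forall>\<xi>\<in>carrier H. \<forall>\<eta>\<in>carrier K.
      \<sigma> (cstar_elem_tensor A B x y) (hilbert_elem_tensor H K \<xi> \<eta>) =
      hilbert_elem_tensor H K (HK.H.hrep A f x \<xi>) (HK.K.hrep B g y \<eta>))"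
  have bop: "\<tau> x \<in> bounded_ops ?HT" if "star_representation CT ?HT \<tau>" "x \<in> carrier CT" for \<tau> x
    using that by (auto simp: star_representation_def)
  have cl: "\<tau> x \<xi> \<in> carrier ?HT" if "star_representation CT ?HT \<tau>" "x \<in> carrier CT" "\<xi> \<in> carrier ?HT" for \<tau> x \<xi>
    using bop[OF that(1,2)] that(3) by (auto simp: bounded_ops_def)
  have elem_agree: "\<sigma> (cstar_elem_tensor A B x y) \<xi> = HK.HT.hrep CT ?F (cstar_elem_tensor A B x y) \<xi>"
    if xy: "x \<in> carrier A" "y \<in> carrier B" and \<xi>: "\<xi> \<in> carrier ?HT" for x y \<xi>
  proof -
    let ?x = "cstar_elem_tensor A B x y"
    \<comment> \<open>The operator is transported to square summable families, where boundedness
      makes the set of agreement a closed subspace.\<close>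
    define U where "U \<tau> v = HK.Wt (\<tau> ?x (HK.HT.Wi v))" for \<tau> :: "_ \<Rightarrow> _ \<Rightarrow> (nat \<Rightarrow> ('h \<times> 'g) list) set" and v
    have lin: "bounded_linear (U \<tau>)" "\<And>c v. U \<tau> (c *\<^sub>C v) = c *\<^sub>C U \<tau> v"
      if \<tau>: "star_representation CT ?HT \<tau>" for \<tau>
    proof -
      have x: "?x \<in> carrier CT"
        by (rule elem_in[OF xy])
      note b = bop[OF \<tau> x, unfolded bounded_ops_def]
      have Wi_add: "HK.HT.Wi (u + v) = HK.HT.Wi u \<oplus>\<^bsub>?HT\<^esub> HK.HT.Wi v" for u v
        by (rule HK.HT.W_eqD) (simp_all add: HK.HT.add)
      have Wi_smult: "HK.HT.Wi (c *\<^sub>C v) = c \<odot>\<^bsub>?HT\<^esub> HK.HT.Wi v" for c v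
        by (rule HK.HT.W_eqD) (simp_all add: HK.HT.smult)
      show c: "U \<tau> (c *\<^sub>C v) = c *\<^sub>C U \<tau> v" for c v
        using b by (simp add: U_def Wi_smult HK.HT.smult cl[OF \<tau> x])
      show "bounded_linear (U \<tau>)"
      proof (rule bounded_linear_intro)
        show "U \<tau> (u + v) = U \<tau> u + U \<tau> v" for u v
          using b by (simp add: U_def Wi_add HK.HT.add cl[OF \<tau> x])
        show "U \<tau> (r *\<^sub>R v) = r *\<^sub>R U \<tau> v" for r v
          using c[of "complex_of_real r" v] by (simp add: cscale_of_real)
        show "norm (U \<tau> v) \<le> norm v * anorm CT ?x" for v
        proof -
          have "hnorm ?HT (\<tau> ?x (HK.HT.Wi v)) \<le> anorm CT ?x * hnorm ?HT (HK.HT.Wi v)"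
            using \<tau> x by (simp add: star_representation_def)
          thus ?thesis
            by (simp add: U_def HK.HT.hnorm_W cl[OF \<tau> x] mult.commute)
        qed
      qed
    qed
    let ?U = "U \<sigma>" and ?U' = "U (HK.HT.hrep CT ?F)"
    have \<sigma>r: "star_representation CT ?HT \<sigma>"
      using \<sigma> by blast
    have "HK.Wt \<xi> \<in> {v. ?U v = ?U' v}"
    proof (rule tv_dense)
      show "csubspace {v. ?U v = ?U' v}"
        using lin[OF \<sigma>r] lin[OF rep] by (auto simp: csubspace_def linear_simps bounded_linear.linear)
      show "closed {v. ?U v = ?U' v}"
        using lin(1)[OF \<sigma>r] lin(1)[OF rep]
        by (intro closed_Collect_eq linear_continuous_on) auto
      fix u v
      have "HK.HT.Wi (tv u v) = hilbert_elem_tensor H K (HK.H.Wi u) (HK.K.Wi v)"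
        by (rule HK.HT.W_eqD) (simp_all add: HK.elem_in HK.Wt_elem)
      thus "tv u v \<in> {v. ?U v = ?U' v}"
        using \<sigma> el xy by (simp add: U_def)
    qed
    hence "HK.Wt (\<sigma> ?x \<xi>) = HK.Wt (HK.HT.hrep CT ?F ?x \<xi>)"
      using \<xi> by (simp add: U_def)
    thus ?thesis
      using cl[OF \<sigma>r elem_in[OF xy] \<xi>] cl[OF rep elem_in[OF xy] \<xi>] by (rule HK.HT.W_eqD)
  qed
  have agree: "\<sigma> x \<xi> = HK.HT.hrep CT ?F x \<xi>" if x: "x \<in> carrier CT" and \<xi>: "\<xi> \<in> carrier ?HT" for x \<xi>
  proof -
    have ba: "bounded_additive CT (\<lambda>x. HK.Wt (\<tau> x \<xi>))" if \<tau>: "star_representation CT ?HT \<tau>" for \<tau>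
    proof -
      have "norm (HK.Wt (\<tau> x \<xi>)) \<le> norm (HK.Wt \<xi>) * anorm CT x" if "x \<in> carrier CT" for x
      proof -
        have "hnorm ?HT (\<tau> x \<xi>) \<le> anorm CT x * hnorm ?HT \<xi>"
          using \<tau> that \<xi> by (simp add: star_representation_def)
        thus ?thesis
          using \<xi> cl[OF \<tau> that \<xi>] by (simp add: HK.HT.hnorm_W mult.commute)
      qed
      thus ?thesis
        using \<tau> \<xi> unfolding bounded_additive_def star_representation_def
        by (auto simp: HK.HT.add HK.HT.smult cl[OF \<tau>])
    qed
    have "HK.Wt (\<sigma> x \<xi>) = HK.Wt (HK.HT.hrep CT ?F x \<xi>)"
      by (rule tensor_agree[OF ba ba _ x]) (use \<sigma> rep elem_agree \<xi> in auto)
    thus ?thesis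
      using cl \<sigma> rep x \<xi> by (intro HK.HT.W_eqD) auto
  qed
  show "\<sigma> = HK.HT.hrep CT ?F"
  proof (rule extensionalityI)
    show "\<sigma> \<in> extensional (carrier CT)"
      using \<sigma> by (auto simp: star_representation_def PiE_def)
    show "HK.HT.hrep CT ?F \<in> extensional (carrier CT)"
      by (simp add: HK.HT.hrep_def)
    show "\<sigma> x = HK.HT.hrep CT ?F x" if x: "x \<in> carrier CT" for x
    proof (rule extensionalityI)
      show "\<sigma> x \<in> extensional (carrier ?HT)" "HK.HT.hrep CT ?F x \<in> extensional (carrier ?HT)"
        using bop \<sigma> rep x by (auto simp: bounded_ops_def PiE_def)
    qed (rule agree[OF x])
  qed
qed

section \<open>The isomorphism \<open>\<phi>\<close>\<close>

text \<open>The combined digit is split as \<phi> prescribes: the quotient by q' goes to the first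
  factor, the remainder to the second.\<close>

definition dP :: "nat \<Rightarrow> 'i \<times> 'k \<Rightarrow> 'i \<times> 'k" where
  "dP r = map_prod (d (r div q')) (d' (r mod q'))"

sublocale P: digit_maps "q * q'" dP
proof
  have lt: "r div q' < q" "r mod q' < q'" if "r < q * q'" for r
    using that E.q_pos by (simp_all add: less_mult_imp_div_less)
  show "inj (dP r)" if "r < q * q'" for r
    unfolding dP_def using lt[OF that] by (intro prod.inj_map D.d_inj E.d_inj)
  show "range (dP r) \<inter> range (dP s) = {}" if "r < q * q'" "s < q * q'" "r \<noteq> s" for r s
  proof -
    have "r div q' \<noteq> s div q' \<or> r mod q' \<noteq> s mod q'"
      using that(3) by (metis div_mult_mod_eq)
    thus ?thesis
      using D.d_disj[of "r div q'" "s div q'"] E.d_disj[of "r mod q'" "s mod q'"] lt[OF that(1)] lt[OF that(2)]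
      by (auto simp: dP_def; blast)
  qed
  show "\<exists>r<q * q'. u \<in> range (dP r)" for u
  proof -
    obtain i k where u: "u = (i, k)" by (cases u)
    obtain r r' where r: "r < q" "i \<in> range (d r)" "r' < q'" "k \<in> range (d' r')"
      using D.d_cover[of i] E.d_cover[of k] by blast
    have "(r + 1) * q' \<le> q * q'"
      using r by (intro mult_right_mono) auto
    hence "r * q' + r' < q * q'"
      using r by simp
    moreover have "u \<in> range (dP (r * q' + r'))"
      using r by (auto simp: dP_def u)
    ultimately show ?thesis by blast
  qed
qed

abbreviation "index_AB \<delta> \<epsilon> n \<equiv> digit_index (q * q') (\<lambda>i. q' * \<delta> i + \<epsilon> i) n"
abbreviation "unit_A \<delta> \<delta>' n \<equiv> uhf_incl (\<lambda>_. q) n (unit_tensor (\<lambda>_. q) \<delta> \<delta>' n)"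
abbreviation "unit_B \<epsilon> \<epsilon>' n \<equiv> uhf_incl (\<lambda>_. q') n (unit_tensor (\<lambda>_. q') \<epsilon> \<epsilon>' n)"
abbreviation "unit_AB \<delta> \<epsilon> \<delta>' \<epsilon>' n \<equiv> uhf_incl (\<lambda>_. q * q') n
  (unit_tensor (\<lambda>_. q * q') (\<lambda>i. q' * \<delta> i + \<epsilon> i) (\<lambda>i. q' * \<delta>' i + \<epsilon>' i) n)"

lemma digit_less: "\<delta> < q \<Longrightarrow> \<epsilon> < q' \<Longrightarrow> q' * \<delta> + \<epsilon> < q * q'"
proof -
  assume lt: "\<delta> < q" "\<epsilon> < q'"
  have "(\<delta> + 1) * q' \<le> q * q'"
    using lt by (intro mult_right_mono) auto
  thus ?thesis using lt by (simp add: algebra_simps)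
qed

lemma wmap_pair:
  assumes "\<And>i. i < n \<Longrightarrow> \<delta> i < q" "\<And>i. i < n \<Longrightarrow> \<epsilon> i < q'"
  shows "P.wmap n (index_AB \<delta> \<epsilon> n) =
    map_prod (D.wmap n (digit_index q \<delta> n)) (E.wmap n (digit_index q' \<epsilon> n))"
  using assms
proof (induction n)
  case (Suc n)
  have lt: "\<delta> n < q" "\<epsilon> n < q'"
    using Suc.prems by auto
  from digit_less[OF this] have "P.wmap (Suc n) (digit_index (q * q') (\<lambda>i. q' * \<delta> i + \<epsilon> i) (Suc n)) =
      P.wmap n (index_AB \<delta> \<epsilon> n) \<circ> dP (q' * \<delta> n + \<epsilon> n)"
    by (simp only: digit_index.simps P.wmap_digit)
  also have "dP (q' * \<delta> n + \<epsilon> n) = map_prod (d (\<delta> n)) (d' (\<epsilon> n))"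
    using lt by (simp add: dP_def)
  also have "P.wmap n (index_AB \<delta> \<epsilon> n) =
      map_prod (D.wmap n (digit_index q \<delta> n)) (E.wmap n (digit_index q' \<epsilon> n))"
    by (rule Suc.IH) (use Suc.prems in auto)
  finally show ?case
    by (simp only: digit_index.simps D.wmap_digit[OF lt(1)] E.wmap_digit[OF lt(2)] map_prod.comp)
qed (simp add: fun_eq_iff)

text \<open>With paired digits the matrix units of the product algebra are tensor products of
  operators on the nose, and this is the formula that characterises \<phi>.\<close>

lemma mu_pair:
  assumes "\<And>i. i < n \<Longrightarrow> \<delta> i < q" "\<And>i. i < n \<Longrightarrow> \<epsilon> i < q'" "\<And>i. i < n \<Longrightarrow> \<delta>' i < q" "\<And>i. i < n \<Longrightarrow> \<epsilon>' i < q'"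
  shows "P.mu n (index_AB \<delta> \<epsilon> n) (index_AB \<delta>' \<epsilon>' n) =
    tens (D.mu n (digit_index q \<delta> n) (digit_index q \<delta>' n)) (E.mu n (digit_index q' \<epsilon> n) (digit_index q' \<epsilon>' n))"
  by (simp add: P.mu_def D.mu_def E.mu_def wmap_pair assms tens_mult adj_tens
      tens_shift_op[OF D.wmap_inj E.wmap_inj, symmetric])

lemma mu_tens_level:
  assumes "i < q ^ n" "k < q ^ n" "l < q' ^ n" "m < q' ^ n"
  shows "tens (D.mu n i k) (E.mu n l m) \<in> P.level n"
proof -
  obtain \<delta> \<delta>' \<epsilon> \<epsilon>' where *: "\<forall>j<n. \<delta> j < q" "digit_index q \<delta> n = i" "\<forall>j<n. \<delta>' j < q" "digit_index q \<delta>' n = k"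
    "\<forall>j<n. \<epsilon> j < q'" "digit_index q' \<epsilon> n = l" "\<forall>j<n. \<epsilon>' j < q'" "digit_index q' \<epsilon>' n = m"
    using assms[THEN digit_index_surj] by blast
  have "tens (D.mu n i k) (E.mu n l m) =
    P.mu n (index_AB \<delta> \<epsilon> n) (index_AB \<delta>' \<epsilon>' n)"
    using * by (simp add: mu_pair)
  also have "\<dots> \<in> P.level n"
    using * by (intro P.mu_level digit_index_less digit_less) auto
  finally show ?thesis .
qed

lemma digit_pair_cases:
  assumes "i < (q * q') ^ n" "k < (q * q') ^ n"
  obtains \<delta> \<epsilon> \<delta>' \<epsilon>' where "\<And>j. j < n \<Longrightarrow> \<delta> j < q" "\<And>j. j < n \<Longrightarrow> \<epsilon> j < q'"
    "\<And>j. j < n \<Longrightarrow> \<delta>' j < q" "\<And>j. j < n \<Longrightarrow> \<epsilon>' j < q'"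
    "i = index_AB \<delta> \<epsilon> n" "k = index_AB \<delta>' \<epsilon>' n"
proof -
  obtain \<beta> \<gamma> where *: "\<forall>j<n. \<beta> j < q * q'" "digit_index (q * q') \<beta> n = i" "\<forall>j<n. \<gamma> j < q * q'" "digit_index (q * q') \<gamma> n = k"
    using assms[THEN digit_index_surj] by blast
  show thesis
    by (rule that[of "\<lambda>j. \<beta> j div q'" "\<lambda>j. \<beta> j mod q'" "\<lambda>j. \<gamma> j div q'" "\<lambda>j. \<gamma> j mod q'"])
       (use * E.q_pos in \<open>auto simp: less_mult_imp_div_less\<close>)
qed

end

lemma (in digit_maps) csubspace_level_span:
  assumes S: "csubspace S" "closed S" and mu: "\<And>n i k. i < q ^ n \<Longrightarrow> k < q ^ n \<Longrightarrow> mu n i k \<in> S"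
  shows "urep ` carrier (uhf (\<lambda>_. q)) \<subseteq> S"
proof -
  have "rep n X \<in> S" for n X
    unfolding rep_def by (intro csubspace_sum[OF S(1)]) (use S(1) mu in \<open>auto simp: csubspace_def\<close>)
  thus ?thesis
    unfolding image_urep level_def by (intro closure_minimal S) auto
qed

context digit_pair
begin

abbreviation "AB \<equiv> uhf (\<lambda>_. q * q')"

sublocale AB: inj_model AB P.urep
  by (rule P.inj_model_uhf)

lemma csubspace_AB: "csubspace (P.urep ` carrier AB)" and closed_AB: "closed (P.urep ` carrier AB)"
  by (rule AB.csubspace_range[OF AB.one_closed]) (simp add: P.image_urep)

text \<open>Levels are raised to a common one and expanded into matrix units; the general case
  follows by continuity of \<open>tens\<close>.\<close>

lemma tens_closure:
  assumes "S \<in> D.urep ` carrier A" "R \<in> E.urep ` carrier B"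
  shows "tens S R \<in> P.urep ` carrier AB"
proof -
  have lev: "tens X Y \<in> P.urep ` carrier AB" if XY: "X \<in> D.level m" "Y \<in> E.level n" for X Y m n
  proof -
    define l where "l = max m n"
    have l: "X \<in> D.level l" "Y \<in> E.level l"
      using subsetD[OF D.level_mono XY(1)] subsetD[OF E.level_mono XY(2)] by (auto simp: l_def)
    then obtain X' Y' where XY': "X = D.rep l X'" "Y = E.rep l Y'"
      by (auto simp: D.level_def E.level_def)
    have "P.level l \<subseteq> P.urep ` carrier AB"
      unfolding P.image_urep by (rule order_trans[OF UN_upper closure_subset]) simp
    hence mu: "tens (D.mu l i k) (E.mu l r s) \<in> P.urep ` carrier AB"
      if "i < q ^ l" "k < q ^ l" "r < q' ^ l" "s < q' ^ l" for i k r s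
      using mu_tens_level[OF that] by blast
    have cscale: "c *\<^sub>C Z \<in> P.urep ` carrier AB" if "Z \<in> P.urep ` carrier AB" for c Z
      using csubspace_AB that unfolding csubspace_def by blast
    show ?thesis
      unfolding XY' D.rep_def E.rep_def tens_sum tens_cscale
      by (intro csubspace_sum[OF csubspace_AB] cscale mu) auto
  qed
  obtain X where X: "\<forall>n. X n \<in> (\<Union>n. D.level n)" "X \<longlonglongrightarrow> S"
    using assms(1) unfolding D.image_urep closure_sequential by blast
  obtain Y where Y: "\<forall>n. Y n \<in> (\<Union>n. E.level n)" "Y \<longlonglongrightarrow> R"
    using assms(2) unfolding E.image_urep closure_sequential by blast
  have mem: "tens (X n) (Y n) \<in> P.urep ` carrier AB" for n
    using X(1) Y(1) lev by (meson UN_E)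
  show ?thesis
    by (rule closed_sequentially[OF closed_AB mem tendsto_tens[OF X(2) Y(2)]])
qed

lemma unit_tensor_pair:
  assumes "\<And>i. i < n \<Longrightarrow> \<delta> i < q" "\<And>i. i < n \<Longrightarrow> \<epsilon> i < q'" "\<And>i. i < n \<Longrightarrow> \<delta>' i < q" "\<And>i. i < n \<Longrightarrow> \<epsilon>' i < q'"
  shows "P.urep (unit_AB \<delta> \<epsilon> \<delta>' \<epsilon>' n) =
    JT (cstar_elem_tensor A B (unit_A \<delta> \<delta>' n) (unit_B \<epsilon> \<epsilon>' n))"
  using assms
  by (simp add: unit_tensor_const digit_less P.urep_incl D.urep_incl E.urep_incl D.uhf_incl_in E.uhf_incl_in JT_elem
      P.matrix_unit_carrier D.matrix_unit_carrier E.matrix_unit_carrier P.rep_matrix_unit D.rep_matrix_unit E.rep_matrix_unit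
      digit_index_less mu_pair)

text \<open>Both sides are closed subspaces, and tensor products of matrix units span a dense part
  of each.\<close>

lemma image_urep_eq_JT: "P.urep ` carrier AB = JT ` carrier CT"
proof (rule antisym)
  show "JT ` carrier CT \<subseteq> P.urep ` carrier AB"
    by (rule tensor_span[OF csubspace_AB closed_AB]) (intro tens_closure imageI)
  show "P.urep ` carrier AB \<subseteq> JT ` carrier CT"
  proof (rule P.csubspace_level_span[OF CT.csubspace_range[OF CT.one_closed] closed_JT])
    fix n i k assume ik: "i < (q * q') ^ n" "k < (q * q') ^ n"
    from digit_pair_cases[OF ik] obtain \<delta> \<epsilon> \<delta>' \<epsilon>' where *: "\<And>j. j < n \<Longrightarrow> \<delta> j < q" "\<And>j. j < n \<Longrightarrow> \<epsilon> j < q'"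
      "\<And>j. j < n \<Longrightarrow> \<delta>' j < q" "\<And>j. j < n \<Longrightarrow> \<epsilon>' j < q'"
      "i = index_AB \<delta> \<epsilon> n" "k = index_AB \<delta>' \<epsilon>' n"
      by blast
    let ?x = "D.unit_elem n (digit_index q \<delta> n, digit_index q \<delta>' n)"
    let ?y = "E.unit_elem n (digit_index q' \<epsilon> n, digit_index q' \<epsilon>' n)"
    have "P.mu n i k = JT (cstar_elem_tensor A B ?x ?y)"
      using * by (simp add: mu_pair JT_elem D.unit_elem_in E.unit_elem_in)
        (simp add: D.unit_elem_def E.unit_elem_def D.urep_incl E.urep_incl
          D.matrix_unit_carrier E.matrix_unit_carrier D.rep_matrix_unit E.rep_matrix_unit digit_index_less)
    thus "P.mu n i k \<in> JT ` carrier CT"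
      by (simp add: elem_in D.unit_elem_in E.unit_elem_in)
  qed
qed

text \<open>As the two models have the same image, \<phi> is the map that keeps the operator.
  Another candidate has the same values on all matrix units, whose span is dense, and extensionality
  settles the points off the carrier.\<close>

lemma uhf_phi:
  shows "star_iso AB CT (uhf_phi (\<lambda>_. q) (\<lambda>_. q'))"
    "\<And>x. x \<in> carrier AB \<Longrightarrow> JT (uhf_phi (\<lambda>_. q) (\<lambda>_. q') x) = P.urep x"
proof -
  define \<phi> where "\<phi> = restrict (\<lambda>x. inv_into (carrier CT) JT (P.urep x)) (carrier AB)"
  have \<phi>: "star_iso AB CT \<phi>" "\<And>x. x \<in> carrier AB \<Longrightarrow> JT (\<phi> x) = P.urep x"
    unfolding \<phi>_def by (rule star_iso_models[OF AB.inj_model_axioms CT.inj_model_axioms image_urep_eq_JT]; assumption)+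
  have ab: "(\<lambda>_. q) \<bullet>\<^sub>s (\<lambda>_. q') = (\<lambda>_::nat. q * q')"
    by (simp add: seq_times_def)
  have in_CT: "f x \<in> carrier CT" if "star_iso AB CT f" "x \<in> carrier AB" for f x
    using that by (auto simp: star_iso_def bij_betw_def)
  have "uhf_phi (\<lambda>_. q) (\<lambda>_. q') = \<phi>"
    unfolding uhf_phi_def ab
  proof (rule the_equality)
    have "\<phi> (unit_AB j' j'' k' k'' n) =
        cstar_elem_tensor A B (unit_A j' k' n) (unit_B j'' k'' n)"
      if *: "\<forall>i<n. j' i < q \<and> k' i < q \<and> j'' i < q' \<and> k'' i < q'" for n j' k' j'' k''
    proof -
      have 1: "unit_AB j' j'' k' k'' n \<in> carrier AB"
        using * by (intro P.uhf_incl_in) (simp add: unit_tensor_const digit_less P.matrix_unit_carrier)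
      have 2: "cstar_elem_tensor A B (unit_A j' k' n) (unit_B j'' k'' n) \<in> carrier CT"
        using * by (intro elem_in D.uhf_incl_in E.uhf_incl_in) (simp_all add: unit_tensor_const D.matrix_unit_carrier E.matrix_unit_carrier)
      show ?thesis
        by (rule inj_onD[OF CT.inj _ in_CT[OF \<phi>(1) 1] 2]) (use * in \<open>simp add: \<phi>(2)[OF 1] unit_tensor_pair\<close>)
    qed
    thus "star_iso AB CT \<phi> \<and> (\<forall>n j' k' j'' k''. (\<forall>i<n. j' i < q \<and> k' i < q \<and> j'' i < q' \<and> k'' i < q') \<longrightarrow>
        \<phi> (unit_AB j' j'' k' k'' n) =
        cstar_elem_tensor A B (unit_A j' k' n) (unit_B j'' k'' n))"
      using \<phi>(1) by blast
    fix f assume f: "star_iso AB CT f \<and> (\<forall>n j' k' j'' k''. (\<forall>i<n. j' i < q \<and> k' i < q \<and> j'' i < q' \<and> k'' i < q') \<longrightarrow>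
        f (unit_AB j' j'' k' k'' n) =
        cstar_elem_tensor A B (unit_A j' k' n) (unit_B j'' k'' n))"
    hence f_iso: "star_iso AB CT f"
      by blast
    have ba: "bounded_additive AB (\<lambda>x. JT (f x))"
      unfolding bounded_additive_def
    proof (intro conjI ballI allI)
      note in_f = in_CT[OF f_iso]
      show "JT (f (x \<oplus>\<^bsub>AB\<^esub> y)) = JT (f x) + JT (f y)" if "x \<in> carrier AB" "y \<in> carrier AB" for x y
        using f_iso that in_f by (simp add: star_iso_def CT.j_add)
      show "JT (f (c \<odot>\<^bsub>AB\<^esub> x)) = c *\<^sub>C JT (f x)" if "x \<in> carrier AB" for x c
        using f_iso that in_f by (simp add: star_iso_def CT.j_smult)
      show "\<exists>C. \<forall>x\<in>carrier AB. norm (JT (f x)) \<le> C * anorm AB x"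
        using f_iso in_f by (intro exI[of _ 1]) (simp add: star_iso_def CT.norm[symmetric])
    qed
    have ba': "bounded_additive AB P.urep"
      unfolding bounded_additive_def by (auto simp: AB.j_add AB.j_smult AB.norm intro!: exI[of _ 1])
    have eq: "JT (f x) = P.urep x" if x: "x \<in> carrier AB" for x
    proof (rule AB.agreementD[OF _ x], rule P.csubspace_level_span)
      show "csubspace (P.urep ` {x \<in> carrier AB. JT (f x) = P.urep x})" "closed (P.urep ` {x \<in> carrier AB. JT (f x) = P.urep x})"
        by (rule AB.agreement_set[OF closed_AB ba ba'])+
      fix n i k assume ik: "i < (q * q') ^ n" "k < (q * q') ^ n"
      from digit_pair_cases[OF ik] obtain \<delta> \<epsilon> \<delta>' \<epsilon>' where *: "\<And>j. j < n \<Longrightarrow> \<delta> j < q" "\<And>j. j < n \<Longrightarrow> \<epsilon> j < q'"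
        "\<And>j. j < n \<Longrightarrow> \<delta>' j < q" "\<And>j. j < n \<Longrightarrow> \<epsilon>' j < q'"
        "i = index_AB \<delta> \<epsilon> n" "k = index_AB \<delta>' \<epsilon>' n"
        by blast
      let ?ut = "unit_tensor (\<lambda>_. q * q') (\<lambda>i. q' * \<delta> i + \<epsilon> i) (\<lambda>i. q' * \<delta>' i + \<epsilon>' i) n"
      let ?u = "uhf_incl (\<lambda>_. q * q') n ?ut"
      have ut: "?ut = matrix_unit ((q * q') ^ n) i k"
        using * by (simp add: unit_tensor_const digit_less)
      have "?u \<in> carrier AB" "P.urep ?u = P.mu n i k"
        unfolding ut using ik by (simp_all add: P.uhf_incl_in P.urep_incl P.matrix_unit_carrier P.rep_matrix_unit)
      moreover have "JT (f ?u) = P.urep ?u"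
        using f * by (simp add: unit_tensor_pair)
      ultimately show "P.mu n i k \<in> P.urep ` {x \<in> carrier AB. JT (f x) = P.urep x}"
        by (intro image_eqI[of _ _ ?u]) auto
    qed
    show "f = \<phi>"
    proof (rule extensionalityI)
      show "f \<in> extensional (carrier AB)" "\<phi> \<in> extensional (carrier AB)"
        using f_iso \<phi>(1) by (auto simp: star_iso_def)
      show "f x = \<phi> x" if x: "x \<in> carrier AB" for x
        by (rule inj_onD[OF CT.inj _ in_CT[OF f_iso x] in_CT[OF \<phi>(1) x]]) (simp add: eq[OF x] \<phi>(2)[OF x])
    qed
  qed
  thus "star_iso AB CT (uhf_phi (\<lambda>_. q) (\<lambda>_. q'))"
    "\<And>x. x \<in> carrier AB \<Longrightarrow> JT (uhf_phi (\<lambda>_. q) (\<lambda>_. q') x) = P.urep x"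
    using \<phi> by simp_all
qed

lemma phi_in: "x \<in> carrier AB \<Longrightarrow> uhf_phi (\<lambda>_. q) (\<lambda>_. q') x \<in> carrier CT"
  using uhf_phi(1) by (auto simp: star_iso_def bij_betw_def)

lemma phi_unit:
  assumes "\<And>i. i < n \<Longrightarrow> \<delta> i < q" "\<And>i. i < n \<Longrightarrow> \<epsilon> i < q'" "\<And>i. i < n \<Longrightarrow> \<delta>' i < q" "\<And>i. i < n \<Longrightarrow> \<epsilon>' i < q'"
  shows "uhf_phi (\<lambda>_. q) (\<lambda>_. q')
      (unit_AB \<delta> \<epsilon> \<delta>' \<epsilon>' n) =
    cstar_elem_tensor A B (unit_A \<delta> \<delta>' n) (unit_B \<epsilon> \<epsilon>' n)"
proof -
  have 1: "unit_AB \<delta> \<epsilon> \<delta>' \<epsilon>' n \<in> carrier AB"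
    using assms by (intro P.uhf_incl_in) (simp add: unit_tensor_const digit_less P.matrix_unit_carrier)
  have 2: "cstar_elem_tensor A B (unit_A \<delta> \<delta>' n) (unit_B \<epsilon> \<epsilon>' n) \<in> carrier CT"
    using assms by (intro elem_in D.uhf_incl_in E.uhf_incl_in) (simp_all add: unit_tensor_const D.matrix_unit_carrier E.matrix_unit_carrier)
  show ?thesis
    by (rule inj_onD[OF CT.inj _ phi_in[OF 1] 2]) (use assms in \<open>simp add: uhf_phi(2)[OF 1] unit_tensor_pair\<close>)
qed

lemma contr_hom_phi:
  assumes F: "contr_hom CT F"
  shows "contr_hom AB (\<lambda>x. F (uhf_phi (\<lambda>_. q) (\<lambda>_. q') x))"
proof -
  have "norm (F (uhf_phi (\<lambda>_. q) (\<lambda>_. q') x)) \<le> anorm AB x" if "x \<in> carrier AB" for x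
  proof -
    have "norm (F (uhf_phi (\<lambda>_. q) (\<lambda>_. q') x)) \<le> anorm CT (uhf_phi (\<lambda>_. q) (\<lambda>_. q') x)"
      using F phi_in[OF that] by (simp add: contr_hom_def)
    also have "\<dots> = anorm AB x"
      using uhf_phi(1) that by (simp add: star_iso_def)
    finally show ?thesis .
  qed
  thus ?thesis
    using uhf_phi(1) F phi_in by (simp add: contr_hom_def star_iso_def)
qed

end

section \<open>The two digit systems of type two\<close>

text \<open>
  The two systems differ only by an exchange of the digits, so \<open>ket 0\<close> corresponds to the constant digit
  sequence 0 in the first one and 1 in the second one. Only the digits \<open>r < 2\<close> are used.
\<close>

definition dig0 :: "nat \<Rightarrow> nat \<Rightarrow> nat" where "dig0 r t = r + 2 * t"
definition dig1 :: "nat \<Rightarrow> nat \<Rightarrow> nat" where "dig1 r t = (1 - r) + 2 * t"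

lemma dig_eq_iff:
  assumes "r < 2" "s < 2"
  shows "dig0 r t = dig0 s u \<longleftrightarrow> r = s \<and> t = u" "dig1 r t = dig1 s u \<longleftrightarrow> r = s \<and> t = u"
  using assms by (auto simp: dig0_def dig1_def less_2_cases_iff; presburger)+

interpretation U0: digit_maps 2 dig0
proof
  show "\<exists>r<2. u \<in> range (dig0 r)" for u
    by (rule exI[of _ "u mod 2"]) (auto simp: dig0_def image_iff intro!: exI[of _ "u div 2"])
qed (auto simp: dig_eq_iff inj_on_def)

interpretation U1: digit_maps 2 dig1
proof
  show "\<exists>r<2. u \<in> range (dig1 r)" for u
    \<comment> \<open>Here the parity of u is the exchanged digit.\<close>
    by (rule exI[of _ "1 - u mod 2"]) (auto simp: dig1_def image_iff intro!: exI[of _ "u div 2"])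
qed (auto simp: dig_eq_iff inj_on_def)

text \<open>This one model serves both orders: the reversed pair of representations enters through
  \<open>contr_hom_lift\<close>.\<close>

interpretation UU: digit_pair 2 2 dig0 dig1 ..

abbreviation "const_index r n \<equiv> digit_index 2 (\<lambda>_. r) n"

lemma wmap_const:
  assumes "r < 2"
  shows "U0.wmap n (const_index r n) = dig0 r ^^ n" "U1.wmap n (const_index r n) = dig1 r ^^ n"
proof -
  show "U0.wmap n (const_index r n) = dig0 r ^^ n"
    by (induction n)
       (simp_all only: digit_index.simps U0.wmap_digit[OF assms] U0.wmap.simps(1) funpow_Suc_right funpow.simps(1))
  show "U1.wmap n (const_index r n) = dig1 r ^^ n"
    by (induction n)
       (simp_all only: digit_index.simps U1.wmap_digit[OF assms] U1.wmap.simps(1) funpow_Suc_right funpow.simps(1))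
qed

text \<open>Both maps are doubling, which has the fixed point 0.\<close>

lemma funpow_zero: "(dig0 0 ^^ n) 0 = 0" "(dig1 1 ^^ n) 0 = 0"
  by (induction n) (simp_all add: dig0_def dig1_def)

text \<open>Both maps send t to 2 t + 1 and so raise every index by at least 1; the n-th iterate
  misses all indices below n.\<close>

lemma funpow_ge: "n \<le> (dig0 1 ^^ n) t" "n \<le> (dig1 0 ^^ n) t"
  by (induction n) (simp_all add: dig0_def dig1_def)

definition unit2 :: "nat \<Rightarrow> nat \<Rightarrow> (nat \<Rightarrow> nat \<times> complex mat) set" where
  "unit2 r n = uhf_incl (\<lambda>_. 2) n (unit_tensor (\<lambda>_. 2) (\<lambda>_. r) (\<lambda>_. r) n)"

lemma unit2_in: "r < 2 \<Longrightarrow> unit2 r n \<in> carrier (uhf (\<lambda>_. 2))"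
  unfolding unit2_def by (intro U0.uhf_incl_in) (simp add: unit_tensor_const U0.matrix_unit_carrier)

lemma urep_unit2:
  assumes "r < 2"
  shows "U0.urep (unit2 r n) = U0.mu n (const_index r n) (const_index r n)"
    "U1.urep (unit2 r n) = U1.mu n (const_index r n) (const_index r n)"
  using assms
  by (simp_all add: unit2_def unit_tensor_const U0.urep_incl U1.urep_incl U0.matrix_unit_carrier
      U0.rep_matrix_unit U1.rep_matrix_unit digit_index_less)

lemma adj_urep_unit2: "r < 2 \<Longrightarrow> adj (U0.urep (unit2 r n)) = U0.urep (unit2 r n)"
  "r < 2 \<Longrightarrow> adj (U1.urep (unit2 r n)) = U1.urep (unit2 r n)"
  by (simp_all add: urep_unit2 U0.adj_mu U1.adj_mu)

lemma urep_unit2_fix: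
  "ap (U0.urep (unit2 0 n)) (ket 0) = ket 0" "ap (U1.urep (unit2 1 n)) (ket 0) = ket 0"
proof -
  have "pull (dig0 0 ^^ n) (ket 0) = ket 0" "push (dig0 0 ^^ n) (ket 0) = ket 0"
    using pull_ket[of "dig0 0 ^^ n" 0] push_ket[of "dig0 0 ^^ n" 0] U0.wmap_inj[of n "const_index 0 n"]
    by (simp_all add: wmap_const funpow_zero del: One_nat_def)
  thus "ap (U0.urep (unit2 0 n)) (ket 0) = ket 0"
    by (simp add: urep_unit2 U0.mu_def ap_shift_op ap_adj_shift_op U0.wmap_inj) (simp add: wmap_const)
  have "pull (dig1 1 ^^ n) (ket 0) = ket 0" "push (dig1 1 ^^ n) (ket 0) = ket 0"
    using pull_ket[of "dig1 1 ^^ n" 0] push_ket[of "dig1 1 ^^ n" 0] U1.wmap_inj[of n "const_index 1 n"]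
    by (simp_all add: wmap_const funpow_zero del: One_nat_def)
  thus "ap (U1.urep (unit2 1 n)) (ket 0) = ket 0"
    by (simp add: urep_unit2 U1.mu_def ap_shift_op ap_adj_shift_op U1.wmap_inj del: One_nat_def)
       (simp add: wmap_const del: One_nat_def)
qed

text \<open>Strong convergence to 0 in an exact form: every basis vector is killed from some n
  on.\<close>

lemma urep_unit2_vanish:
  assumes "i < n"
  shows "ap (U0.urep (unit2 1 n)) (ket i) = 0" "ap (U1.urep (unit2 0 n)) (ket i) = 0"
proof -
  have "i \<notin> range (dig0 1 ^^ n)" "i \<notin> range (dig1 0 ^^ n)"
    using funpow_ge[of n] assms by (auto simp: not_le[symmetric])
  hence "pull (dig0 1 ^^ n) (ket i) = 0" "pull (dig1 0 ^^ n) (ket i) = 0"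
    using pull_ket_notin[of "dig0 1 ^^ n" i] pull_ket_notin[of "dig1 0 ^^ n" i]
      U0.wmap_inj[of n "const_index 1 n"] U1.wmap_inj[of n "const_index 0 n"]
    by (simp_all add: wmap_const)
  thus "ap (U0.urep (unit2 1 n)) (ket i) = 0" "ap (U1.urep (unit2 0 n)) (ket i) = 0"
    by (simp_all add: urep_unit2 U0.mu_def U1.mu_def ap_adj_shift_op U0.wmap_inj U1.wmap_inj)
       (simp_all add: wmap_const ap_linear)
qed

definition unit4 :: "nat \<Rightarrow> (nat \<Rightarrow> nat \<times> complex mat) set" where
  "unit4 n = uhf_incl (\<lambda>_. 4) n (unit_tensor (\<lambda>_. 4) (\<lambda>_. 1) (\<lambda>_. 1) n)"

abbreviation "phi2 \<equiv> uhf_phi (\<lambda>_. 2) (\<lambda>_. 2)"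

lemma phi_unit4: "phi2 (unit4 n) = cstar_elem_tensor (uhf (\<lambda>_. 2)) (uhf (\<lambda>_. 2)) (unit2 0 n) (unit2 1 n)"
  using UU.phi_unit[of n "\<lambda>_. 0" "\<lambda>_. 1" "\<lambda>_. 0" "\<lambda>_. 1"] by (simp add: unit4_def unit2_def)

lemma unit4_in: "unit4 n \<in> carrier (uhf (\<lambda>_. 4))"
  using UU.P.uhf_incl_in[of "unit_tensor (\<lambda>_. 4) (\<lambda>_. 1) (\<lambda>_. 1) n" n]
  by (simp add: unit4_def unit_tensor_const matrix_unit_def)

lemma hom0: "contr_hom (uhf (\<lambda>_. 2)) U0.urep" and hom1: "contr_hom (uhf (\<lambda>_. 2)) U1.urep"
  using star_model.hom[OF U0.star_model_uhf] star_model.hom[OF U1.star_model_uhf] by auto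

abbreviation "F01 \<equiv> cpl_lift (tlift U0.urep U1.urep)"
abbreviation "F10 \<equiv> cpl_lift (tlift U1.urep U0.urep)"

text \<open>In the first order both factors are the projections that fix \<open>ket 0\<close>; in
  the second both kill each basis vector from some n on.\<close>

lemma lift_unit4:
  "F01 (phi2 (unit4 n)) = tens (U0.urep (unit2 0 n)) (U1.urep (unit2 1 n))"
  "F10 (phi2 (unit4 n)) = tens (U1.urep (unit2 0 n)) (U0.urep (unit2 1 n))"
  unfolding phi_unit4 by (simp_all add: UU.lift_elem hom0 hom1 unit2_in)

lemma seq22: "(\<lambda>_. 2) \<bullet>\<^sub>s (\<lambda>_. 2) = (\<lambda>_. 4)"
  by (simp add: seq_times_def)

section \<open>The two product states\<close>

definition "\<omega>\<^sub>0 = vector_state (uhf (\<lambda>_. 2)) U0.urep (ket 0)"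
definition "\<omega>\<^sub>1 = vector_state (uhf (\<lambda>_. 2)) U1.urep (ket 0)"

lemma states_differ: "state_tensor_phi (\<lambda>_. 2) (\<lambda>_. 2) \<omega>\<^sub>0 \<omega>\<^sub>1 \<noteq> state_tensor_phi (\<lambda>_. 2) (\<lambda>_. 2) \<omega>\<^sub>1 \<omega>\<^sub>0"
proof -
  have in_CT: "phi2 (unit4 1) \<in> carrier (cstar_tensor (uhf (\<lambda>_. 2)) (uhf (\<lambda>_. 2)))"
    using UU.phi_in[of "unit4 1"] unit4_in by simp
  have "state_tensor_phi (\<lambda>_. 2) (\<lambda>_. 2) \<omega>\<^sub>0 \<omega>\<^sub>1 (unit4 1) =
      cip (tv (ket 0) (ket 0)) (ap (F01 (phi2 (unit4 1))) (tv (ket 0) (ket 0)))"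
    unfolding state_tensor_phi_def seq22 \<omega>\<^sub>0_def \<omega>\<^sub>1_def
      UU.state_tensor_vector_state[OF hom0 hom1 norm_ket norm_ket]
    using unit4_in in_CT by (simp add: vector_state_def)
  also have "\<dots> = 1"
    unfolding lift_unit4 ap_tens_tv urep_unit2_fix by (simp add: norm_tv cip_self)
  finally have "state_tensor_phi (\<lambda>_. 2) (\<lambda>_. 2) \<omega>\<^sub>0 \<omega>\<^sub>1 (unit4 1) = 1" .
  moreover have "state_tensor_phi (\<lambda>_. 2) (\<lambda>_. 2) \<omega>\<^sub>1 \<omega>\<^sub>0 (unit4 1) =
      cip (tv (ket 0) (ket 0)) (ap (F10 (phi2 (unit4 1))) (tv (ket 0) (ket 0)))"
    unfolding state_tensor_phi_def seq22 \<omega>\<^sub>0_def \<omega>\<^sub>1_def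
      UU.state_tensor_vector_state[OF hom1 hom0 norm_ket norm_ket]
    using unit4_in in_CT by (simp add: vector_state_def)
  \<comment> \<open>Level 1 suffices, since index 0 lies below 1.\<close>
  moreover have "\<dots> = 0"
    by (simp add: lift_unit4 ap_tens_tv urep_unit2_vanish del: One_nat_def)
  ultimately show ?thesis
    by (metis zero_neq_one)
qed

section \<open>The two representations\<close>

interpretation L: hilbert_model ell2_module Abs_ell2
  by (rule hilbert_model_ell2)

interpretation LL: hilbert_pair ell2_module Abs_ell2 ell2_module Abs_ell2 ..

abbreviation "HT \<equiv> hilbert_tensor ell2_module ell2_module"

definition "\<pi>\<^sub>0 = L.hrep (uhf (\<lambda>_. 2)) U0.urep"
definition "\<pi>\<^sub>1 = L.hrep (uhf (\<lambda>_. 2)) U1.urep"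

lemma rep_tensor_phi_hrep:
  assumes "contr_hom (uhf (\<lambda>_. 2)) f" "contr_hom (uhf (\<lambda>_. 2)) g"
  shows "rep_tensor_phi (\<lambda>_. 2) (\<lambda>_. 2) ell2_module ell2_module (L.hrep (uhf (\<lambda>_. 2)) f) (L.hrep (uhf (\<lambda>_. 2)) g) =
    LL.HT.hrep (uhf (\<lambda>_. 4)) (\<lambda>x. cpl_lift (tlift f g) (phi2 x))"
  unfolding rep_tensor_phi_def seq22 UU.rep_tensor_hrep[OF assms LL.hilbert_pair_axioms]
  using UU.phi_in by (auto simp: LL.HT.hrep_def fun_eq_iff)

lemma star_model_uhf4: "star_model (uhf (\<lambda>_. 4)) UU.P.urep"
  using UU.P.star_model_uhf by simp

lemma unitary_classes_differ:
  "unitary_class (uhf (\<lambda>_. 4)) HT (rep_tensor_phi (\<lambda>_. 2) (\<lambda>_. 2) ell2_module ell2_module \<pi>\<^sub>0 \<pi>\<^sub>1) \<noteq>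
   unitary_class (uhf (\<lambda>_. 4)) HT (rep_tensor_phi (\<lambda>_. 2) (\<lambda>_. 2) ell2_module ell2_module \<pi>\<^sub>1 \<pi>\<^sub>0)"
proof
  define \<sigma> where "\<sigma> = LL.HT.hrep (uhf (\<lambda>_. 4)) (\<lambda>x. F01 (phi2 x))"
  define \<tau> where "\<tau> = LL.HT.hrep (uhf (\<lambda>_. 4)) (\<lambda>x. F10 (phi2 x))"
  have eqs: "rep_tensor_phi (\<lambda>_. 2) (\<lambda>_. 2) ell2_module ell2_module \<pi>\<^sub>0 \<pi>\<^sub>1 = \<sigma>"
    "rep_tensor_phi (\<lambda>_. 2) (\<lambda>_. 2) ell2_module ell2_module \<pi>\<^sub>1 \<pi>\<^sub>0 = \<tau>"
    unfolding \<pi>\<^sub>0_def \<pi>\<^sub>1_def \<sigma>_def \<tau>_def by (rule rep_tensor_phi_hrep hom0 hom1)+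
  have "contr_hom (uhf (\<lambda>_. 4)) (\<lambda>x. F01 (phi2 x))"
    using UU.contr_hom_phi[OF UU.contr_hom_lift[OF hom0 hom1]] by simp
  hence "star_representation (uhf (\<lambda>_. 4)) HT \<sigma>"
    unfolding \<sigma>_def by (rule LL.HT.hrep_representation[OF star_model_uhf4])
  moreover have "unitarily_equivalent (uhf (\<lambda>_. 4)) HT \<sigma> HT \<sigma>"
    unfolding unitarily_equivalent_def hilbert_unitary_def by (intro exI[of _ "\<lambda>x. x"]) (auto simp: bij_betw_def)
  ultimately have "(HT, \<sigma>) \<in> unitary_class (uhf (\<lambda>_. 4)) HT \<sigma>"
    by (simp add: unitary_class_def)
  moreover assume "unitary_class (uhf (\<lambda>_. 4)) HT (rep_tensor_phi (\<lambda>_. 2) (\<lambda>_. 2) ell2_module ell2_module \<pi>\<^sub>0 \<pi>\<^sub>1) =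
   unitary_class (uhf (\<lambda>_. 4)) HT (rep_tensor_phi (\<lambda>_. 2) (\<lambda>_. 2) ell2_module ell2_module \<pi>\<^sub>1 \<pi>\<^sub>0)"
  \<comment> \<open>Every representation belongs to its own class, so equality of the classes
    supplies a unitary from the second tensor product to the first.\<close>
  ultimately have "(HT, \<sigma>) \<in> unitary_class (uhf (\<lambda>_. 4)) HT \<tau>"
    by (simp only: eqs)
  then obtain U where U: "hilbert_unitary HT HT U"
    and inter: "\<And>x \<xi>. x \<in> carrier (uhf (\<lambda>_. 4)) \<Longrightarrow> \<xi> \<in> carrier HT \<Longrightarrow> U (\<tau> x \<xi>) = \<sigma> x (U \<xi>)"
    by (auto simp: unitary_class_def unitarily_equivalent_def)
  \<comment> \<open>A vector fixed by all \<open>unit4 n\<close> under \<sigma>; its preimage under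
    \<open>U\<close> must then be fixed under \<tau>.\<close>
  define \<zeta> where "\<zeta> = LL.HT.Wi (ket (0, 0))"
  have bij: "bij_betw U (carrier HT) (carrier HT)"
    using U by (simp add: hilbert_unitary_def)
  have "\<zeta> \<in> U ` carrier HT"
    using bij by (simp add: \<zeta>_def bij_betw_def)
  then obtain \<xi> where \<xi>: "\<xi> \<in> carrier HT" "U \<xi> = \<zeta>"
    by (elim imageE) simp
  have fixed: "ap (F10 (phi2 (unit4 n))) (LL.Wt \<xi>) = LL.Wt \<xi>" for n
  proof -
    have "ap (F01 (phi2 (unit4 n))) (ket (0, 0)) = ket (0, 0)"
      unfolding lift_unit4 tv_ket[symmetric] ap_tens_tv urep_unit2_fix ..
    hence "\<sigma> (unit4 n) \<zeta> = \<zeta>"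
      by (intro LL.HT.W_eqD) (simp_all add: \<sigma>_def LL.HT.hrep_def unit4_in \<zeta>_def LL.HT.W_hop LL.HT.hop_in)
    hence "U (\<tau> (unit4 n) \<xi>) = U \<xi>"
      using inter[OF unit4_in \<xi>(1)] \<xi>(2) by simp
    moreover have "\<tau> (unit4 n) \<xi> \<in> carrier HT"
      by (simp add: \<tau>_def LL.HT.hrep_def unit4_in LL.HT.hop_in \<xi>(1))
    ultimately have "\<tau> (unit4 n) \<xi> = \<xi>"
      using bij \<xi>(1) by (meson bij_betw_def inj_onD)
    hence "LL.HT.hop (F10 (phi2 (unit4 n))) \<xi> = \<xi>"
      by (simp add: \<tau>_def LL.HT.hrep_def unit4_in)
    thus ?thesis
      using LL.HT.W_hop[OF \<xi>(1)] by metis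
  qed
  have "LL.Wt \<xi> = 0"
  proof (rule tv_eqI)
    fix i k
    \<comment> \<open>The projections are self-adjoint and can be moved to the basis vector; at this
      level the left factor alone already kills \<open>ket i\<close>, whatever k is.\<close>
    let ?n = "Suc i"
    have "coord (LL.Wt \<xi>) (i, k) = cip (tv (ket i) (ket k)) (ap (F10 (phi2 (unit4 ?n))) (LL.Wt \<xi>))"
      by (simp only: fixed tv_ket cip_ket_left)
    also have "\<dots> = cip (ap (adj (F10 (phi2 (unit4 ?n)))) (tv (ket i) (ket k))) (LL.Wt \<xi>)"
      by (simp only: cip_adj)
    also have "\<dots> = 0"
      unfolding lift_unit4 adj_tens ap_tens_tv
      by (simp add: adj_urep_unit2 urep_unit2_vanish)
    finally show "coord (LL.Wt \<xi>) (i, k) = coord 0 (i, k)"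
      by simp
  qed
  moreover have "cinner HT (U \<xi>) (U \<xi>) = cinner HT \<xi> \<xi>"
    using U \<xi>(1) by (simp add: hilbert_unitary_def)
  hence "cip (ket (0 :: nat, 0 :: nat)) (ket (0, 0)) = cip (LL.Wt \<xi>) (LL.Wt \<xi>)"
    using \<xi> by (simp add: LL.HT.inner \<zeta>_def)
  ultimately show False
    by (simp add: cip_self)
qed

theorem corollary1p6:
  shows "(\<exists>(a :: nat \<Rightarrow> nat) (b :: nat \<Rightarrow> nat) \<omega> \<omega>'.
            (\<forall>n. 2 \<le> a n) \<and> (\<forall>n. 2 \<le> b n) \<and>
            state (uhf a) \<omega> \<and> state (uhf b) \<omega>' \<and>
            state_tensor_phi a b \<omega> \<omega>' \<noteq> state_tensor_phi b a \<omega>' \<omega>) \<and>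
         (\<exists>(a :: nat \<Rightarrow> nat) (b :: nat \<Rightarrow> nat)
            (H :: (nat \<Rightarrow> complex) inner_module) (H' :: (nat \<Rightarrow> complex) inner_module) \<pi> \<pi>'.
            (\<forall>n. 2 \<le> a n) \<and> (\<forall>n. 2 \<le> b n) \<and>
            star_representation (uhf a) H \<pi> \<and> star_representation (uhf b) H' \<pi>' \<and>
            unitary_class (uhf (a \<bullet>\<^sub>s b)) (hilbert_tensor H H') (rep_tensor_phi a b H H' \<pi> \<pi>') \<noteq>
            unitary_class (uhf (b \<bullet>\<^sub>s a)) (hilbert_tensor H' H) (rep_tensor_phi b a H' H \<pi>' \<pi>))"
  (is "?states \<and> ?classes")
proof (rule conjI)
  have "state (uhf (\<lambda>_. 2)) \<omega>\<^sub>0" "state (uhf (\<lambda>_. 2)) \<omega>\<^sub>1"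
    unfolding \<omega>\<^sub>0_def \<omega>\<^sub>1_def
    \<comment> \<open>Both representations act on the same algebra, so the model given by the first
      digit system serves for the second state too, with \<open>hom1\<close> as its
      representation.\<close>
    by (rule star_model.state_vector_state[OF U0.star_model_uhf]; simp add: hom0 hom1)+
  thus ?states
    using states_differ by (intro exI[of _ "\<lambda>_. 2"] exI[of _ \<omega>\<^sub>0] exI[of _ \<omega>\<^sub>1]) simp
  have "star_representation (uhf (\<lambda>_. 2)) ell2_module \<pi>\<^sub>0" "star_representation (uhf (\<lambda>_. 2)) ell2_module \<pi>\<^sub>1"
    unfolding \<pi>\<^sub>0_def \<pi>\<^sub>1_def by (rule L.hrep_representation[OF U0.star_model_uhf] hom0 hom1)+
  thus ?classes
    using unitary_classes_differ
    by (intro exI[of _ "\<lambda>_. 2"] exI[of _ ell2_module] exI[of _ \<pi>\<^sub>0] exI[of _ \<pi>\<^sub>1]) (simp add: seq22)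
qed

end
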